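(* Let $\Theta$ be an open subset of $\mathbb{R}^d$, $\sigma>0$, $A\in\mathbb{R}^{M\times P}$, $\mu_0\in\mathbb{R}^P$, and $Y=\mu_0+W$ with $W\sim\mathcal N(0,\sigma^2\mathrm{Id}_P)$. Let $\mu:\mathbb{R}^P\times\Theta\to\mathbb{R}^P$ satisfy: (A.1) $y\mapsto\mu(y,\theta)$ is Lipschitz continuous with a Lipschitz constant $L_1$ independent of $\theta$; (A.2) $\mu(0,\theta)=0$ for every $\theta\in\Theta$; (A.3) $\theta\mapsto\mu(y,\theta)$ is Lipschitz continuous with a Lipschitz constant $L_2$ independent of $y$. Define the risk $R(\mu_0,\theta)=\mathbb{E}_W\|A(\mu(Y,\theta)-\mu_0)\|^2$ and the degrees of freedom $\mathrm{df}(\mu_0,\theta)=\sum_{i=1}^P\operatorname{cov}\big((AY)_i,(A\mu(Y,\theta))_i\big)/\sigma^2$. For $\epsilon>0$ define $$\widehat{\mathrm{df}}^{\mathrm{FD}}(y,\theta,\epsilon)=\frac1\epsilon\sum_{i=1}^P\big(A^*A(\mu(y+\epsilon e_i,\theta)-\mu(y,\theta))\big)_i,$$ $$\nabla_2\widehat{\mathrm{df}}^{\mathrm{FD}}(y,\theta,\epsilon)=\frac1\epsilon\sum_{i=1}^P\big(J_2\mu(y+\epsilon e_i,\theta)-J_2\mu(y,\theta)\big)^*A^*Ae_i,$$ $$\mathrm{SUGAR}^{\mathrm{FD}}(y,\theta,\epsilon)=2\,J_2\mu(y,\theta)^*A^*A(\mu(y,\theta)-y)+2\sigma^2\,\nabla_2\widehat{\mathrm{df}}^{\mathrm{FD}}(y,\theta,\epsilon).$$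 Then $\theta\mapsto R(\mu_0,\theta)$ and $\theta\mapsto\mathrm{df}(\mu_0,\theta)$ are weakly differentiable, and for any Lebesgue point $\theta$, $$\lim_{\epsilon\to0}\mathbb{E}_W\big[\mathrm{SUGAR}^{\mathrm{FD}}(Y,\theta,\epsilon)\big]=\nabla_2R(\mu_0,\theta)\quad\text{and}\quad\lim_{\epsilon\to0}\mathbb{E}_W\big[\nabla_2\widehat{\mathrm{df}}^{\mathrm{FD}}(Y,\theta,\epsilon)\big]=\nabla_2\mathrm{df}(\mu_0,\theta).$$
   Context: $(e_i)_{1\le i\le P}$ is the canonical basis of $\mathbb{R}^P$. $J_2\mu(y,\theta)\in\mathbb{R}^{P\times d}$ is the weak Jacobian of $\mu$ with respect to $\theta$, and $\nabla_2 f=J_2f^*$ is the weak gradient with respect to $\theta$. Weak derivatives are defined Lebesgue-almost everywhere, and pointwise identities involving them are understood at Lebesgue points (i.e. Lebesgue-a.e.). $\mathbb{E}_W$ denotes expectation with respect to the noise $W$.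
   Formalization: The covariance sum defining df runs over all M components of AY instead of i=1..P (undefined if M<P, claim false if M>P), and the weak Jacobian J_2μ is taken in a version jointly Borel measurable in (y,θ), so that E_W makes sense. *)

theory Defs
  imports "HOL-Probability.Probability"
begin

definition partial_deriv :: "(real^'d \<Rightarrow> real) \<Rightarrow> 'd \<Rightarrow> real^'d \<Rightarrow> real" where
  "partial_deriv f k x = frechet_derivative f (at x) (axis k 1)"

coinductive smooth_fun :: "(real^'d \<Rightarrow> real) \<Rightarrow> bool" where
  "(\<And>x. f differentiable (at x)) \<Longrightarrow> (\<And>k. smooth_fun (partial_deriv f k)) \<Longrightarrow> smooth_fun f"

definition test_fun :: "(real^'d) set \<Rightarrow> (real^'d \<Rightarrow> real) \<Rightarrow> bool" where
  "test_fun U \<phi> \<longleftrightarrow> smooth_fun \<phi> \<and> compact (closure {x. \<phi> x \<noteq> 0})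
                     \<and> closure {x. \<phi> x \<noteq> 0} \<subseteq> U"

definition locally_integrable_on :: "(real^'d) set \<Rightarrow> (real^'d \<Rightarrow> real) \<Rightarrow> bool" where
  "locally_integrable_on U f \<longleftrightarrow> (\<forall>K. compact K \<and> K \<subseteq> U \<longrightarrow> set_integrable lborel K f)"

definition weak_gradient_on :: "(real^'d) set \<Rightarrow> (real^'d \<Rightarrow> real) \<Rightarrow> (real^'d \<Rightarrow> real^'d) \<Rightarrow> bool" where
  "weak_gradient_on U f g \<longleftrightarrow>
     locally_integrable_on U f \<and> (\<forall>k. locally_integrable_on U (\<lambda>x. g x $ k)) \<and>
     (\<forall>\<phi>. test_fun U \<phi> \<longrightarrow> (\<forall>k.
        (LINT x:U|lborel. f x * partial_deriv \<phi> k x) = - (LINT x:U|lborel. g x $ k * \<phi> x)))"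

definition weakly_differentiable_on :: "(real^'d) set \<Rightarrow> (real^'d \<Rightarrow> real) \<Rightarrow> bool" where
  "weakly_differentiable_on U f \<longleftrightarrow> (\<exists>g. weak_gradient_on U f g)"

definition weak_jacobian_on :: "(real^'d) set \<Rightarrow> (real^'d \<Rightarrow> real^'p) \<Rightarrow> (real^'d \<Rightarrow> real^'d^'p) \<Rightarrow> bool" where
  "weak_jacobian_on U h J \<longleftrightarrow> (\<forall>i. weak_gradient_on U (\<lambda>x. h x $ i) (\<lambda>x. J x $ i))"

definition gauss_noise :: "real \<Rightarrow> (real^'p) measure" where
  "gauss_noise \<sigma> = density lborel (\<lambda>w. ennreal (\<Prod>i\<in>UNIV. normal_density 0 \<sigma> (w $ i)))"

definition EW :: "real \<Rightarrow> real^'p \<Rightarrow> (real^'p \<Rightarrow> 'b::{banach,second_countable_topology}) \<Rightarrow> 'b" where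
  "EW \<sigma> \<mu>0 F = integral\<^sup>L (gauss_noise \<sigma>) (\<lambda>w. F (\<mu>0 + w))"

definition risk :: "real \<Rightarrow> real^'p^'m \<Rightarrow> (real^'p \<Rightarrow> real^'d \<Rightarrow> real^'p) \<Rightarrow> real^'p \<Rightarrow> real^'d \<Rightarrow> real" where
  "risk \<sigma> A \<mu> \<mu>0 \<theta> = EW \<sigma> \<mu>0 (\<lambda>y. (norm (A *v (\<mu> y \<theta> - \<mu>0)))\<^sup>2)"

text \<open>df = sum_j cov((AY)_j, (A mu(Y,theta))_j) / sigma^2, summing over the M components of AY.\<close>
definition dof :: "real \<Rightarrow> real^'p^'m \<Rightarrow> (real^'p \<Rightarrow> real^'d \<Rightarrow> real^'p) \<Rightarrow> real^'p \<Rightarrow> real^'d \<Rightarrow> real" where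
  "dof \<sigma> A \<mu> \<mu>0 \<theta> =
     (\<Sum>j\<in>UNIV. EW \<sigma> \<mu>0 (\<lambda>y. (A *v y) $ j * (A *v \<mu> y \<theta>) $ j)
               - EW \<sigma> \<mu>0 (\<lambda>y. (A *v y) $ j) * EW \<sigma> \<mu>0 (\<lambda>y. (A *v \<mu> y \<theta>) $ j)) / \<sigma>\<^sup>2"

definition df_FD :: "real^'p^'m \<Rightarrow> (real^'p \<Rightarrow> real^'d \<Rightarrow> real^'p) \<Rightarrow> real^'p \<Rightarrow> real^'d \<Rightarrow> real \<Rightarrow> real" where
  "df_FD A \<mu> y \<theta> \<epsilon> =
     (1 / \<epsilon>) * (\<Sum>i\<in>UNIV. ((transpose A ** A) *v (\<mu> (y + \<epsilon> *\<^sub>R axis i 1) \<theta> - \<mu> y \<theta>)) $ i)"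

definition grad_df_FD :: "real^'p^'m \<Rightarrow> (real^'p \<Rightarrow> real^'d \<Rightarrow> real^'d^'p) \<Rightarrow> real^'p \<Rightarrow> real^'d \<Rightarrow> real \<Rightarrow> real^'d" where
  "grad_df_FD A J y \<theta> \<epsilon> =
     (1 / \<epsilon>) *\<^sub>R (\<Sum>i\<in>UNIV. transpose (J (y + \<epsilon> *\<^sub>R axis i 1) \<theta> - J y \<theta>)
                             *v ((transpose A ** A) *v axis i 1))"

definition SUGAR_FD :: "real \<Rightarrow> real^'p^'m \<Rightarrow> (real^'p \<Rightarrow> real^'d \<Rightarrow> real^'p) \<Rightarrow> (real^'p \<Rightarrow> real^'d \<Rightarrow> real^'d^'p)
                         \<Rightarrow> real^'p \<Rightarrow> real^'d \<Rightarrow> real \<Rightarrow> real^'d" where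
  "SUGAR_FD \<sigma> A \<mu> J y \<theta> \<epsilon> =
     2 *\<^sub>R (transpose (J y \<theta>) *v ((transpose A ** A) *v (\<mu> y \<theta> - y)))
     + (2 * \<sigma>\<^sup>2) *\<^sub>R grad_df_FD A J y \<theta> \<epsilon>"

end

theory Submission
  imports Defs
begin

text \<open>
  No Stein identity is needed. Since \<open>E[AY] = A \<mu>0\<close>, the degrees of freedom equal
  \<open>E[\<langle>A W, A \<mu>(Y, \<theta>)\<rangle>] / \<sigma>\<^sup>2\<close>, so by Fubini their weak gradient is
  \<open>E[J\<^sup>T A\<^sup>T A W] / \<sigma>\<^sup>2\<close>, and that of the risk is \<open>2 E[J\<^sup>T A\<^sup>T A (\<mu>(Y, \<theta>) - \<mu>0)]\<close>.
  Translating the Gaussian moves the finite difference in the data from \<open>J\<close> to the Gaussian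
  density, whose derivative in direction \<open>i\<close> produces the factor \<open>W\<^sub>i / \<sigma>\<^sup>2\<close>; hence
  \<open>E[\<nabla>\<^sub>2 df_FD]\<close> tends to \<open>E[J\<^sup>T A\<^sup>T A W] / \<sigma>\<^sup>2\<close>.

  Domination in these limits rests on \<open>\<bar>J\<bar> \<le> L2\<close> almost everywhere. This and the chain rule
  for squares of Lipschitz functions come from difference quotients in \<open>\<theta>\<close>: they are bounded by
  the Lipschitz constant and converge weakly to the weak gradient, first against test functions and
  then, by density, against continuous functions with compact support.
\<close>

section \<open>Smooth functions with compact support\<close>

text \<open>The hypotheses concern \<mu>(y, .) for each fixed y, whereas the limits are expectations
  over y at a fixed \<theta>. Joint measurability of \<open>J\<close> is the bridge: a bound valid
  for every y and almost every \<theta> is, by Fubini, valid for almost every \<theta> and almost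
  every y. The Gaussian law and its translates are absolutely continuous with respect to Lebesgue
  measure, so a single null set of parameters serves all \<epsilon>; the remaining \<theta> play the
  part of the Lebesgue points.

  \<open>J\<close> is pinned down only through its pairings with test functions. Every pointwise
  fact about it has to be recovered from integrals, which calls for a supply of test functions rich
  enough to approximate continuous ones, built by hand so that the coinductive smoothness predicate
  can be verified.

  The two limits are tied by one cancellation. SUGAR contains the residual \<mu>(Y, \<theta>) - Y,
  the gradient of the risk contains \<mu>(Y, \<theta>) - \<mu>0; they differ by W, and J^T A^T A W
  is what \<sigma>^2 times the finite-difference term contributes in expectation in the
  limit.\<close>

definition flat :: "real poly \<Rightarrow> real \<Rightarrow> real" where
  "flat P t = (if t > 0 then poly P (1 / t) * exp (- (1 / t)) else 0)"

lemma poly_div_exp_tendsto_0: "((\<lambda>x. poly P x / exp x) \<longlongrightarrow> (0::real)) at_top"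
proof -
  \<comment> \<open>The extra power x^k makes the induction close: splitting off a coefficient of P
    moves one factor x out of the polynomial.\<close>
  have "((\<lambda>x. x ^ k * poly P x / exp x) \<longlongrightarrow> (0::real)) at_top" for k
  proof (induction P arbitrary: k)
    case 0
    then show ?case by simp
  next
    case (pCons a P)
    have "((\<lambda>x. a * (x ^ k / exp x) + x ^ Suc k * poly P x / exp x) \<longlongrightarrow> a * 0 + 0) at_top"
      by (intro tendsto_intros tendsto_power_div_exp_0 pCons.IH)
    then show ?case
      by (simp add: algebra_simps add_divide_distrib)
  qed
  from this[of 0] show ?thesis by simp
qed

text \<open>With s = 1/t, the derivative of P(s) exp(-s) in t is s^2 (P(s) - P'(s)) exp(-s), which
  explains the factor \<open>[:0, 0, 1:]\<close>. Carrying the polynomial P as a parameter makes the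
  family closed under differentiation, so one derivative yields all of them.\<close>

lemma flat_has_real_derivative:
  "(flat P has_real_derivative flat ([:0, 0, 1:] * (P - pderiv P)) t) (at t)"
proof -
  consider "t > 0" | "t < 0" | "t = 0" by linarith
  then show ?thesis
  proof cases
    case 1
    have "((\<lambda>t. poly P (1 / t) * exp (- (1 / t))) has_real_derivative
        flat ([:0, 0, 1:] * (P - pderiv P)) t) (at t)"
      using 1
      by (auto intro!: derivative_eq_intros poly_DERIV[THEN DERIV_chain2]
          simp: flat_def field_simps power2_eq_square)
    moreover have "\<forall>\<^sub>F x in nhds t. poly P (1 / x) * exp (- (1 / x)) = flat P x"
      using eventually_nhds_in_open[of "{0<..}" t] 1 by (auto elim!: eventually_mono simp: flat_def)
    ultimately show ?thesis
      by (rule DERIV_cong_ev[OF refl _ refl, THEN iffD1, rotated])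
  next
    case 2
    have "((\<lambda>t. 0) has_real_derivative flat ([:0, 0, 1:] * (P - pderiv P)) t) (at t)"
      using 2 by (auto simp: flat_def)
    moreover have "\<forall>\<^sub>F x in nhds t. 0 = flat P x"
      using eventually_nhds_in_open[of "{..<0}" t] 2 by (auto elim!: eventually_mono simp: flat_def)
    ultimately show ?thesis
      by (rule DERIV_cong_ev[OF refl _ refl, THEN iffD1, rotated])
  next
    case 3
    \<comment> \<open>At 0 the difference quotient is \<open>flat P h / h\<close>. For h > 0 put x =
      1/h; it becomes x P(x) / exp x, hence the polynomial \<open>[:0, 1:] * P\<close>.\<close>
    have "((\<lambda>h. poly ([:0, 1:] * P) (inverse h) / exp (inverse h)) \<longlongrightarrow> 0) (at_right 0)"
      by (rule filterlim_compose[OF poly_div_exp_tendsto_0 filterlim_inverse_at_top_right])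
    then have R: "((\<lambda>h. flat P h / h) \<longlongrightarrow> 0) (at_right 0)"
      by (rule Lim_transform_eventually)
        (auto simp: flat_def field_simps exp_minus eventually_at intro!: exI[of _ 1])
    have L: "((\<lambda>h. flat P h / h) \<longlongrightarrow> 0) (at_left 0)"
      by (rule Lim_transform_eventually[of "\<lambda>_. 0"])
        (auto simp: flat_def eventually_at intro!: exI[of _ 1])
    have "((\<lambda>h. flat P h / h) \<longlongrightarrow> 0) (at 0)"
      using L R filterlim_split_at by blast
    then show ?thesis
      using 3 by (simp add: DERIV_def flat_def)
  qed
qed

text \<open>An explicit algebra of functions that contains the bumps used below and is closed under
  partial derivatives; this turns the coinductive smoothness predicate into a structural
  induction.\<close>
inductive elementary_smooth :: "(real^'d \<Rightarrow> real) \<Rightarrow> bool" where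
  linear: "bounded_linear f \<Longrightarrow> elementary_smooth f"
| const: "elementary_smooth (\<lambda>x. c)"
| flat: "elementary_smooth (\<lambda>x. flat P (s * x $ k + c))"
| add: "elementary_smooth f \<Longrightarrow> elementary_smooth g \<Longrightarrow> elementary_smooth (\<lambda>x. f x + g x)"
| mult: "elementary_smooth f \<Longrightarrow> elementary_smooth g \<Longrightarrow> elementary_smooth (\<lambda>x. f x * g x)"

lemma elementary_smooth_deriv:
  assumes "elementary_smooth f"
  shows "(\<forall>x. f differentiable (at x)) \<and> (\<forall>k. elementary_smooth (partial_deriv f k))"
  using assms
proof induction
  case (linear f)
  then have D: "(f has_derivative f) (at x)" for x
    by (rule bounded_linear.has_derivative[OF _ has_derivative_ident])
  then have "frechet_derivative f (at x) = f" for x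
    by (metis frechet_derivative_at)
  then have "partial_deriv f k = (\<lambda>x. f (axis k 1))" for k
    by (auto simp: partial_deriv_def)
  then show ?case
    using D by (auto simp: differentiable_def intro: elementary_smooth.const)
next
  case (const c)
  then show ?case by (auto simp: partial_deriv_def intro: elementary_smooth.const)
next
  case (flat P s k c)
  let ?Q = "[:0, 0, 1:] * (P - pderiv P)"
  have D: "((\<lambda>x. flat P (s * x $ k + c)) has_derivative
      (\<lambda>h. flat ?Q (s * x $ k + c) * (s * h $ k))) (at x)" for x
  proof -
    have "((\<lambda>x. s * x $ k + c) has_derivative (\<lambda>h. s * h $ k)) (at x)"
      by (auto intro!: derivative_eq_intros bounded_linear.has_derivative[OF bounded_linear_vec_nth])
    from DERIV_compose_FDERIV[OF flat_has_real_derivative this]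
    show ?thesis by (simp add: mult.commute)
  qed
  have "frechet_derivative (\<lambda>x. flat P (s * x $ k + c)) (at x) =
      (\<lambda>h. flat ?Q (s * x $ k + c) * (s * h $ k))" for x
    by (rule frechet_derivative_at[OF D, symmetric])
  then have pd: "partial_deriv (\<lambda>x. flat P (s * x $ k + c)) j =
      (\<lambda>x. flat ?Q (s * x $ k + c) * (s * axis j 1 $ k))" for j
    by (intro ext) (simp only: partial_deriv_def)
  have "elementary_smooth (\<lambda>x. flat ?Q (s * x $ k + c) * (s * axis j 1 $ k))" for j
    by (rule elementary_smooth.mult[OF elementary_smooth.flat elementary_smooth.const])
  then show ?case
    unfolding pd by (intro conjI allI differentiableI[OF D])
next
  case (add f g)
  have D: "((\<lambda>x. f x + g x) has_derivative
      (\<lambda>h. frechet_derivative f (at x) h + frechet_derivative g (at x) h)) (at x)" for x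
    using add.IH by (intro has_derivative_add) (simp_all add: frechet_derivative_works[symmetric])
  have "frechet_derivative (\<lambda>x. f x + g x) (at x) =
      (\<lambda>h. frechet_derivative f (at x) h + frechet_derivative g (at x) h)" for x
    by (rule frechet_derivative_at[OF D, symmetric])
  then have pd: "partial_deriv (\<lambda>x. f x + g x) j =
      (\<lambda>x. partial_deriv f j x + partial_deriv g j x)" for j
    by (intro ext) (simp only: partial_deriv_def)
  show ?case
    unfolding pd using add.IH by (intro conjI allI differentiableI[OF D] elementary_smooth.add) auto
next
  case (mult f g)
  have D: "((\<lambda>x. f x * g x) has_derivative
      (\<lambda>h. f x * frechet_derivative g (at x) h + frechet_derivative f (at x) h * g x)) (at x)" for x
    using mult.IH by (intro has_derivative_mult) (simp_all add: frechet_derivative_works[symmetric])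
  have "frechet_derivative (\<lambda>x. f x * g x) (at x) =
      (\<lambda>h. f x * frechet_derivative g (at x) h + frechet_derivative f (at x) h * g x)" for x
    by (rule frechet_derivative_at[OF D, symmetric])
  then have pd: "partial_deriv (\<lambda>x. f x * g x) j =
      (\<lambda>x. f x * partial_deriv g j x + partial_deriv f j x * g x)" for j
    by (intro ext) (simp only: partial_deriv_def)
  have "elementary_smooth (\<lambda>x. f x * partial_deriv g j x + partial_deriv f j x * g x)" for j
    using mult by (intro elementary_smooth.add[OF elementary_smooth.mult elementary_smooth.mult]) auto
  then show ?case
    unfolding pd by (intro conjI allI differentiableI[OF D])
qed

lemma elementary_smooth_imp_smooth_fun: "elementary_smooth f \<Longrightarrow> smooth_fun f"
proof (coinduction arbitrary: f)
  case (smooth_fun f)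
  then show ?case
    using elementary_smooth_deriv[OF smooth_fun] by (intro exI[of _ f]) simp
qed

lemma elementary_smooth_prod:
  "finite I \<Longrightarrow> (\<And>i. i \<in> I \<Longrightarrow> elementary_smooth (f i)) \<Longrightarrow> elementary_smooth (\<lambda>x. \<Prod>i\<in>I. f i x)"
  by (induction I rule: finite_induct) (simp_all add: elementary_smooth.const elementary_smooth.mult)

lemma real_polynomial_elementary_smooth: "real_polynomial_function p \<Longrightarrow> elementary_smooth p"
  by (induction rule: real_polynomial_function.induct) (rule elementary_smooth.intros; assumption)+

section \<open>Bumps on boxes and smooth cut-offs for open sets\<close>

text \<open>With N = n + 1, the product over i of exp(-1 / (N (x_i - a_i))) exp(-1 / (N (b_i -
  x_i))) inside the open box, and 0 outside. The scale N sits inside \<open>flat\<close>, so the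
  values rise to 1 at every point of the box while the set where the bump is nonzero stays the same
  for all n.\<close>

definition box_bump :: "real^'d \<Rightarrow> real^'d \<Rightarrow> nat \<Rightarrow> real^'d \<Rightarrow> real" where
  "box_bump a b n x = (\<Prod>i\<in>UNIV. flat 1 (real (Suc n) * x $ i + - (real (Suc n) * a $ i)) *
     flat 1 (- real (Suc n) * x $ i + real (Suc n) * b $ i))"

lemma elementary_smooth_box_bump: "elementary_smooth (box_bump a b n)"
  unfolding box_bump_def[abs_def]
  by (intro elementary_smooth_prod elementary_smooth.mult elementary_smooth.flat) simp

lemma flat_1_bounds: "0 \<le> flat 1 t" "flat 1 t \<le> 1"
  by (auto simp: flat_def)

lemma box_bump_bounds: "0 \<le> box_bump a b n x" "box_bump a b n x \<le> 1"
  unfolding box_bump_def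
  by (auto intro!: prod_nonneg prod_le_1 mult_nonneg_nonneg mult_le_one simp: flat_1_bounds)

lemma box_bump_outside:
  assumes "x \<notin> box a b" shows "box_bump a b n x = 0"
proof -
  obtain i where "x $ i \<le> a $ i \<or> b $ i \<le> x $ i"
    using assms by (auto simp: mem_box_cart not_less)
  then have "real (Suc n) * x $ i \<le> real (Suc n) * a $ i \<or>
      real (Suc n) * b $ i \<le> real (Suc n) * x $ i"
    by (auto intro: mult_left_mono)
  then have "flat 1 (real (Suc n) * x $ i + - (real (Suc n) * a $ i)) *
     flat 1 (- real (Suc n) * x $ i + real (Suc n) * b $ i) = 0"
    unfolding flat_def by (auto simp del: of_nat_Suc)
  then show ?thesis
    unfolding box_bump_def by (rule prod_zero[OF finite bexI[OF _ UNIV_I]])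
qed

lemma flat_1_scaled_tendsto:
  assumes "t > 0" shows "(\<lambda>n. flat 1 (real (Suc n) * t)) \<longlonglongrightarrow> 1"
proof -
  have "(\<lambda>n. exp (- (1 / t) * (1 / real (Suc n)))) \<longlonglongrightarrow> exp (- (1 / t) * 0)"
    by (intro tendsto_intros LIMSEQ_Suc lim_1_over_n)
  moreover have "flat 1 (real (Suc n) * t) = exp (- (1 / t) * (1 / real (Suc n)))" for n
    using assms by (simp add: flat_def mult.commute)
  ultimately show ?thesis by simp
qed

lemma box_bump_tendsto:
  assumes "x \<in> box a b" shows "(\<lambda>n. box_bump a b n x) \<longlonglongrightarrow> 1"
proof -
  have "(\<lambda>n. box_bump a b n x) \<longlonglongrightarrow> (\<Prod>i\<in>(UNIV::'a set). 1 * 1)"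
    unfolding box_bump_def
  proof (intro tendsto_prod tendsto_mult)
    fix i
    show "(\<lambda>n. flat 1 (real (Suc n) * x $ i + - (real (Suc n) * a $ i))) \<longlonglongrightarrow> 1"
      using flat_1_scaled_tendsto[of "x $ i - a $ i"] assms
      by (simp add: mem_box_cart right_diff_distrib)
    show "(\<lambda>n. flat 1 (- real (Suc n) * x $ i + real (Suc n) * b $ i)) \<longlonglongrightarrow> 1"
      using flat_1_scaled_tendsto[of "b $ i - x $ i"] assms
      by (simp add: mem_box_cart right_diff_distrib del: of_nat_Suc)
  qed
  then show ?thesis by simp
qed

text \<open>Cover U by countably many boxes B_j and take 1 minus the product over j \<le> n of (1 -
  n-th bump on B_j). All factors lie in [0, 1], so a single box containing x drives the product to
  0; outside U every factor equals 1. Finite products and sums stay within the elementary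
  class.\<close>

lemma open_indicator_elementary_smooth_limit:
  fixes U :: "(real^'d) set"
  assumes "open U"
  obtains \<kappa> :: "nat \<Rightarrow> real^'d \<Rightarrow> real" where
    "\<And>n. elementary_smooth (\<kappa> n)" "\<And>n x. 0 \<le> \<kappa> n x" "\<And>n x. \<kappa> n x \<le> 1"
    "\<And>n x. x \<notin> U \<Longrightarrow> \<kappa> n x = 0" "\<And>x. x \<in> U \<Longrightarrow> (\<lambda>n. \<kappa> n x) \<longlonglongrightarrow> 1"
proof -
  obtain D where D: "countable D" "D \<subseteq> Pow U" "\<And>X. X \<in> D \<Longrightarrow> \<exists>a b. X = box a b" "\<Union>D = U"
    using open_countable_Union_open_box[OF assms] by metis
  \<comment> \<open>The empty box is added so that the enumerated set is nonempty even when U is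
    empty.\<close>
  define B where "B = from_nat_into (insert {} D)"
  have rng: "range B = insert {} D"
    unfolding B_def using D(1) by (intro range_from_nat_into) auto
  have "\<exists>a b. B j = box a b" for j
  proof -
    have "B j \<in> insert {} D" using rng by auto
    then show ?thesis
    proof
      assume "B j = {}"
      then have "B j = box 0 0" by simp
      then show ?thesis by blast
    qed (rule D(3))
  qed
  then have "\<forall>j. \<exists>p. B j = box (fst p) (snd p)" by simp
  from choice[OF this] obtain p where p: "\<forall>j. B j = box (fst (p j)) (snd (p j))" by blast
  define a b where "a j = fst (p j)" and "b j = snd (p j)" for j
  have ab: "B j = box (a j) (b j)" for j
    using p by (simp add: a_def b_def)
  \<comment> \<open>Differences are spelled as \<open>1 + (-1) * _\<close> because
    \<open>elementary_smooth\<close> has introduction rules for sums, products and constants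
    only.\<close>
  define \<kappa> where "\<kappa> n x = 1 + (-1) * (\<Prod>j\<in>{..n}. 1 + (-1) * box_bump (a j) (b j) n x)" for n x
  have bnd: "0 \<le> (\<Prod>j\<in>{..n}. 1 + (-1) * box_bump (a j) (b j) n x)"
    "(\<Prod>j\<in>{..n}. 1 + (-1) * box_bump (a j) (b j) n x) \<le> 1" for n x
    by (auto intro!: prod_nonneg prod_le_1 simp: box_bump_bounds)
  show ?thesis
  proof
    show "elementary_smooth (\<kappa> n)" for n
      unfolding \<kappa>_def[abs_def]
      by (intro elementary_smooth.add elementary_smooth.mult elementary_smooth.const
          elementary_smooth_prod elementary_smooth_box_bump) simp
    show "0 \<le> \<kappa> n x" "\<kappa> n x \<le> 1" for n x
      using bnd[of n x] by (auto simp: \<kappa>_def)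
    show "\<kappa> n x = 0" if "x \<notin> U" for n x
    proof -
      have "x \<notin> box (a j) (b j)" for j
      proof -
        have "B j \<in> insert {} D" using rng by auto
        then have "B j \<subseteq> U" using D(2) by auto
        then show ?thesis using that unfolding ab by auto
      qed
      then show ?thesis by (simp add: \<kappa>_def box_bump_outside)
    qed
    show "(\<lambda>n. \<kappa> n x) \<longlonglongrightarrow> 1" if "x \<in> U" for x
    proof -
      have "\<exists>j. x \<in> B j"
      proof -
        have "x \<in> \<Union>D" using \<open>x \<in> U\<close> D(4) by simp
        then obtain X where "X \<in> D" "x \<in> X" by blast
        then have "X \<in> range B" unfolding rng by simp
        then show ?thesis using \<open>x \<in> X\<close> by auto
      qed
      then obtain j where j: "x \<in> B j" by blast
      have "(\<lambda>n. 1 - box_bump (a j) (b j) n x) \<longlonglongrightarrow> 1 - 1"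
        using j ab by (intro tendsto_intros box_bump_tendsto) auto
      then have lim: "(\<lambda>n. 1 - box_bump (a j) (b j) n x) \<longlonglongrightarrow> 0" by simp
      have "(\<lambda>n. (\<Prod>j\<in>{..n}. 1 + (-1) * box_bump (a j) (b j) n x)) \<longlonglongrightarrow> 0"
      proof (rule tendsto_sandwich[OF _ _ tendsto_const lim])
        show "\<forall>\<^sub>F n in sequentially. 0 \<le> (\<Prod>j\<in>{..n}. 1 + (-1) * box_bump (a j) (b j) n x)"
          using bnd by simp
        show "\<forall>\<^sub>F n in sequentially. (\<Prod>j\<in>{..n}. 1 + (-1) * box_bump (a j) (b j) n x)
            \<le> 1 - box_bump (a j) (b j) n x"
          using eventually_ge_at_top[of j]
        proof eventually_elim
          case (elim n)
          have "(\<Prod>j\<in>{..n}. 1 + (-1) * box_bump (a j) (b j) n x) =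
             (1 - box_bump (a j) (b j) n x) * (\<Prod>j\<in>{..n} - {j}. 1 + (-1) * box_bump (a j) (b j) n x)"
            using elim by (subst prod.remove[of _ j]) auto
          also have "\<dots> \<le> (1 - box_bump (a j) (b j) n x) * 1"
            by (intro mult_left_mono prod_le_1) (auto simp: box_bump_bounds)
          finally show ?case by simp
        qed
      qed
      from tendsto_diff[OF tendsto_const[of 1] this] show ?thesis by (simp add: \<kappa>_def)
    qed
  qed
qed

text \<open>Stone--Weierstrass polynomials, cut off to the support of the limit.\<close>
lemma continuous_test_fun_limit:
  fixes \<psi> :: "real^'d \<Rightarrow> real"
  assumes cont: "continuous_on UNIV \<psi>" and supp: "compact (closure {x. \<psi> x \<noteq> 0})"
    and sub: "closure {x. \<psi> x \<noteq> 0} \<subseteq> U"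
  obtains \<phi> B where "\<And>n. test_fun U (\<phi> n)" "\<And>n x. \<bar>\<phi> n x\<bar> \<le> B"
    "\<And>n x. \<psi> x = 0 \<Longrightarrow> \<phi> n x = 0" "\<And>x. (\<lambda>n. \<phi> n x) \<longlonglongrightarrow> \<psi> x"
proof -
  let ?V = "{x. \<psi> x \<noteq> 0}"
  have "open ?V"
    using open_vimage[OF _ cont, of "-{0}"] by (simp add: vimage_def open_Compl)
  then obtain \<kappa> :: "nat \<Rightarrow> real^'d \<Rightarrow> real" where \<kappa>:
    "\<And>n. elementary_smooth (\<kappa> n)" "\<And>n x. 0 \<le> \<kappa> n x" "\<And>n x. \<kappa> n x \<le> 1"
    "\<And>n x. x \<notin> ?V \<Longrightarrow> \<kappa> n x = 0" "\<And>x. x \<in> ?V \<Longrightarrow> (\<lambda>n. \<kappa> n x) \<longlonglongrightarrow> 1"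
    by (rule open_indicator_elementary_smooth_limit) auto
  have "\<exists>p. real_polynomial_function p \<and> (\<forall>x\<in>closure ?V. norm (\<psi> x - p x) < 1 / Suc n)" for n
    using Stone_Weierstrass_polynomial_function[OF supp continuous_on_subset[OF cont subset_UNIV], of "1 / Suc n"]
    by (auto simp: real_polynomial_function_eq)
  then have "\<exists>p. \<forall>n. real_polynomial_function (p n) \<and> (\<forall>x\<in>closure ?V. \<bar>\<psi> x - p n x\<bar> < 1 / Suc n)"
    unfolding real_norm_def by (intro choice allI)
  then obtain p where p: "\<And>n. real_polynomial_function (p n)"
    "\<And>n x. x \<in> closure ?V \<Longrightarrow> \<bar>\<psi> x - p n x\<bar> < 1 / Suc n"
    by blast
  obtain B where B: "\<And>x. x \<in> closure ?V \<Longrightarrow> \<bar>\<psi> x\<bar> \<le> B"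
    using compact_imp_bounded[OF compact_continuous_image[OF continuous_on_subset[OF cont subset_UNIV] supp]]
    unfolding bounded_iff by auto
  \<comment> \<open>The polynomial is close to \<psi> only on the compact support; \<kappa> n
    vanishes wherever \<psi> does, so values of \<open>p n\<close> elsewhere are irrelevant. The
    outcome is bounded pointwise convergence, the form that dominated convergence consumes.\<close>
  define \<phi> where "\<phi> n x = p n x * \<kappa> n x" for n x
  have z: "\<phi> n x = 0" if "\<psi> x = 0" for n x
    using \<kappa>(4) that by (simp add: \<phi>_def)
  show ?thesis
  proof
    show "test_fun U (\<phi> n)" for n
    proof -
      have "closure {x. \<phi> n x \<noteq> 0} \<subseteq> closure ?V"
        using z by (intro closure_mono) auto
      moreover from this have "compact (closure {x. \<phi> n x \<noteq> 0})"
        using compact_Int_closed[OF supp, of "closure {x. \<phi> n x \<noteq> 0}"] by (simp add: Int_absorb1)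
      ultimately show ?thesis
        unfolding test_fun_def using sub
        using elementary_smooth_imp_smooth_fun[OF elementary_smooth.mult[OF
            real_polynomial_elementary_smooth[OF p(1)] \<kappa>(1)]]
        by (auto simp: \<phi>_def[abs_def])
    qed
    show "\<bar>\<phi> n x\<bar> \<le> \<bar>B\<bar> + 1" for n x
    proof (cases "\<psi> x = 0")
      case False
      then have x: "x \<in> closure ?V" by (intro subsetD[OF closure_subset]) simp
      have "\<bar>p n x\<bar> \<le> \<bar>B\<bar> + 1"
      proof -
        have "1 / real (Suc n) \<le> 1" by simp
        then show ?thesis using p(2)[OF x, of n] B[OF x] by linarith
      qed
      moreover have "\<bar>\<phi> n x\<bar> \<le> \<bar>p n x\<bar> * 1"
        unfolding \<phi>_def abs_mult using \<kappa>(2,3) by (intro mult_left_mono) auto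
      ultimately show ?thesis by simp
    qed (simp add: z)
    show "\<phi> n x = 0" if "\<psi> x = 0" for n x by (rule z[OF that])
    show "(\<lambda>n. \<phi> n x) \<longlonglongrightarrow> \<psi> x" for x
    proof (cases "\<psi> x = 0")
      case False
      then have x: "x \<in> closure ?V" by (intro subsetD[OF closure_subset]) simp
      have "(\<lambda>n. p n x) \<longlonglongrightarrow> \<psi> x"
      proof (rule LIM_zero_cancel, rule Lim_null_comparison)
        show "\<forall>\<^sub>F n in sequentially. norm (p n x - \<psi> x) \<le> 1 / Suc n"
          using p(2)[OF x] by (auto simp: abs_minus_commute intro!: always_eventually less_imp_le)
        show "(\<lambda>n. 1 / real (Suc n)) \<longlonglongrightarrow> 0" by (intro LIMSEQ_Suc lim_1_over_n)
      qed
      from tendsto_mult[OF this \<kappa>(5)[of x]] False show ?thesis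
        by (simp add: \<phi>_def)
    qed (simp add: z)
  qed
qed

section \<open>Basic properties of test functions\<close>

lemma smooth_fun_differentiable: "smooth_fun \<phi> \<Longrightarrow> \<phi> differentiable (at x)"
  by (erule smooth_fun.cases) simp

lemma smooth_fun_partial_deriv: "smooth_fun \<phi> \<Longrightarrow> smooth_fun (partial_deriv \<phi> k)"
  by (erule smooth_fun.cases) simp

lemma smooth_fun_continuous: "smooth_fun \<phi> \<Longrightarrow> continuous_on S \<phi>"
  by (intro differentiable_imp_continuous_on)
    (simp add: differentiable_on_def differentiable_at_withinI smooth_fun_differentiable)

lemma smooth_fun_borel: "smooth_fun \<phi> \<Longrightarrow> \<phi> \<in> borel_measurable borel"
  by (intro borel_measurable_continuous_onI smooth_fun_continuous)

lemma partial_deriv_outside_support: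
  assumes "x \<notin> closure {x. \<phi> x \<noteq> 0}"
  shows "partial_deriv \<phi> k x = 0"
proof -
  have "(\<phi> has_derivative (\<lambda>_. 0)) (at x)"
  proof (rule has_derivative_transform_within_open[of "\<lambda>_. 0" _ _ _ "- closure {x. \<phi> x \<noteq> 0}"])
    show "x \<in> - closure {x. \<phi> x \<noteq> 0}" using assms by simp
    show "0 = \<phi> y" if "y \<in> - closure {x. \<phi> x \<noteq> 0}" for y
      using that subsetD[OF closure_subset[of "{x. \<phi> x \<noteq> 0}"], of y] by auto
  qed auto
  then have "frechet_derivative \<phi> (at x) = (\<lambda>_. 0)"
    by (rule frechet_derivative_at[symmetric])
  then show ?thesis by (simp add: partial_deriv_def)
qed

lemma test_fun_outside: "test_fun U \<phi> \<Longrightarrow> x \<notin> closure {x. \<phi> x \<noteq> 0} \<Longrightarrow> \<phi> x = 0"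
  using subsetD[OF closure_subset[of "{x. \<phi> x \<noteq> 0}"], of x] by auto

lemma test_fun_partial_deriv:
  assumes "test_fun U \<phi>" shows "test_fun U (partial_deriv \<phi> k)"
proof -
  have "closure {x. partial_deriv \<phi> k x \<noteq> 0} \<subseteq> closure {x. \<phi> x \<noteq> 0}"
    using partial_deriv_outside_support[of _ \<phi> k] by (intro closure_minimal) auto
  then show ?thesis
    using assms compact_Int_closed[of "closure {x. \<phi> x \<noteq> 0}" "closure {x. partial_deriv \<phi> k x \<noteq> 0}"]
    unfolding test_fun_def by (auto simp: Int_absorb1 smooth_fun_partial_deriv)
qed

lemma compact_support_bounded:
  fixes \<psi> :: "'a::euclidean_space \<Rightarrow> real"
  assumes "continuous_on UNIV \<psi>" "compact (closure {x. \<psi> x \<noteq> 0})"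
  obtains B where "B \<ge> 0" "\<And>x. \<bar>\<psi> x\<bar> \<le> B"
proof -
  obtain B where B: "\<And>x. x \<in> closure {x. \<psi> x \<noteq> 0} \<Longrightarrow> \<bar>\<psi> x\<bar> \<le> B"
    using compact_imp_bounded[OF compact_continuous_image[OF continuous_on_subset[OF assms(1) subset_UNIV] assms(2)]]
    unfolding bounded_iff by auto
  have "\<bar>\<psi> x\<bar> \<le> \<bar>B\<bar>" for x
  proof (cases "\<psi> x = 0")
    case False
    then have "x \<in> closure {x. \<psi> x \<noteq> 0}" by (intro subsetD[OF closure_subset]) simp
    from B[OF this] show ?thesis by simp
  qed simp
  then show ?thesis by (intro that[of "\<bar>B\<bar>"]) auto
qed

lemma test_fun_bounded:
  assumes "test_fun U \<phi>" obtains B where "B \<ge> 0" "\<And>x. \<bar>\<phi> x\<bar> \<le> B"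
  using assms compact_support_bounded[of \<phi>] smooth_fun_continuous unfolding test_fun_def by blast

lemma test_fun_borel: "test_fun U \<phi> \<Longrightarrow> \<phi> \<in> borel_measurable borel"
  by (simp add: test_fun_def smooth_fun_borel)

lemma has_real_derivative_along_axis:
  assumes "smooth_fun \<phi>"
  shows "((\<lambda>t. \<phi> (x + t *\<^sub>R axis k 1)) has_real_derivative
    partial_deriv \<phi> k (x + t *\<^sub>R axis k 1)) (at t)"
proof -
  let ?y = "x + t *\<^sub>R axis k 1"
  have "(\<phi> has_derivative frechet_derivative \<phi> (at ?y)) (at ?y)"
    using smooth_fun_differentiable[OF assms] frechet_derivative_works by blast
  moreover have "((\<lambda>t. x + t *\<^sub>R axis k 1) has_derivative (\<lambda>h. h *\<^sub>R axis k 1)) (at t)"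
    by (auto intro!: derivative_eq_intros)
  ultimately have "((\<lambda>t. \<phi> (x + t *\<^sub>R axis k 1)) has_derivative
      (\<lambda>h. frechet_derivative \<phi> (at ?y) (h *\<^sub>R axis k 1))) (at t)"
    using has_derivative_compose by blast
  moreover have "frechet_derivative \<phi> (at ?y) (h *\<^sub>R axis k 1) = partial_deriv \<phi> k ?y * h" for h
    using linear_cmul[OF linear_frechet_derivative[OF smooth_fun_differentiable[OF assms]]]
    by (simp add: partial_deriv_def mult.commute)
  ultimately show ?thesis
    by (simp add: has_field_derivative_def)
qed

lemma smooth_fun_increment_bound:
  assumes "smooth_fun \<phi>" "\<And>x. \<bar>partial_deriv \<phi> k x\<bar> \<le> B" "h > 0"
  shows "\<bar>\<phi> (x + h *\<^sub>R axis k 1) - \<phi> x\<bar> \<le> B * h"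
proof -
  obtain z where "\<phi> (x + h *\<^sub>R axis k 1) - \<phi> (x + 0 *\<^sub>R axis k 1) =
      (h - 0) * partial_deriv \<phi> k (x + z *\<^sub>R axis k 1)"
    using MVT2[OF assms(3), of "\<lambda>t. \<phi> (x + t *\<^sub>R axis k 1)"
        "\<lambda>t. partial_deriv \<phi> k (x + t *\<^sub>R axis k 1)"]
      has_real_derivative_along_axis[OF assms(1)] by blast
  then show ?thesis
    using assms(2)[of "x + z *\<^sub>R axis k 1"] assms(3) by (simp add: abs_mult mult.commute)
qed

lemma compact_support_integrable:
  fixes \<psi> :: "'a::euclidean_space \<Rightarrow> real"
  assumes K: "compact K" and [measurable]: "\<psi> \<in> borel_measurable borel"
    and "\<And>x. x \<in> K \<Longrightarrow> \<bar>\<psi> x\<bar> \<le> B" and z: "\<And>x. x \<notin> K \<Longrightarrow> \<psi> x = 0"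
  shows "integrable lborel \<psi>"
proof (rule Bochner_Integration.integrable_bound)
  show "integrable lborel (\<lambda>x. B * indicat_real K x)"
    using emeasure_compact_finite[OF K] K
    by (intro integrable_mult_right integrable_real_indicator) (auto simp: compact_imp_closed)
  show "AE x in lborel. norm (\<psi> x) \<le> norm (B * indicat_real K x)"
    using assms(3,4) by (intro always_eventually allI) (force simp: indicator_def)
qed measurable

lemma lborel_integral_translate:
  fixes f :: "'a::euclidean_space \<Rightarrow> 'b::{banach,second_countable_topology}"
  assumes "f \<in> borel_measurable borel"
  shows "(\<integral>x. f (x + c) \<partial>lborel) = (\<integral>x. f x \<partial>lborel)"
proof -
  have "(\<integral>x. f x \<partial>lborel) = (\<integral>x. f x \<partial>(distr lborel borel ((+) c)))"
    by (simp only: lborel_distr_plus)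
  also have "\<dots> = (\<integral>x. f (c + x) \<partial>lborel)"
    using assms by (intro integral_distr) auto
  finally show ?thesis by (simp add: add.commute)
qed

section \<open>Difference quotients and Lipschitz functions\<close>

text \<open>Backward difference with step 1 / (n + 1). Under the integral, translation turns it into
  a forward difference quotient of the test function; indexing by n gives sequences, as dominated
  convergence requires.\<close>

definition diff_quot :: "'d \<Rightarrow> nat \<Rightarrow> (real^'d \<Rightarrow> real) \<Rightarrow> real^'d \<Rightarrow> real" where
  "diff_quot k n f x = real (Suc n) * (f x - f (x - (1 / real (Suc n)) *\<^sub>R axis k 1))"

lemma diff_quot_borel [measurable]:
  assumes [measurable]: "f \<in> borel_measurable borel"
  shows "diff_quot k n f \<in> borel_measurable borel"
  unfolding diff_quot_def[abs_def] by measurable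

text \<open>Discrete integration by parts: by translation invariance, pairing \<phi> with the
  quotient of F is minus the pairing of F with the forward quotient of \<phi>. The latter is bounded
  by the supremum of the partial derivative and converges to it pointwise, so local boundedness of F
  suffices for the limit.\<close>

lemma diff_quot_test_tendsto:
  fixes F :: "real^'d \<Rightarrow> real"
  assumes F[measurable]: "F \<in> borel_measurable borel"
    and bnd: "\<And>R. \<exists>M. \<forall>x\<in>cball 0 R. \<bar>F x\<bar> \<le> M"
    and \<phi>: "test_fun U \<phi>"
  shows "(\<lambda>n. \<integral>x. diff_quot k n F x * \<phi> x \<partial>lborel) \<longlonglongrightarrow> - (\<integral>x. F x * partial_deriv \<phi> k x \<partial>lborel)"
proof -
  let ?e = "axis k 1 :: real^'d"
  have [measurable]: "\<phi> \<in> borel_measurable borel" "partial_deriv \<phi> k \<in> borel_measurable borel"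
    using \<phi> test_fun_partial_deriv test_fun_borel by blast+
  have sm: "smooth_fun \<phi>" using \<phi> by (simp add: test_fun_def)
  obtain B where B: "B \<ge> 0" "\<And>x. \<bar>partial_deriv \<phi> k x\<bar> \<le> B"
    using test_fun_bounded[OF test_fun_partial_deriv[OF \<phi>]] by blast
  obtain B0 where B0: "B0 \<ge> 0" "\<And>x. \<bar>\<phi> x\<bar> \<le> B0"
    using test_fun_bounded[OF \<phi>] by blast
  have "bounded (closure {x. \<phi> x \<noteq> 0})"
    using \<phi> by (simp add: test_fun_def compact_imp_bounded)
  then obtain R where R: "closure {x. \<phi> x \<noteq> 0} \<subseteq> cball 0 R"
    unfolding bounded_iff by (auto simp: subset_eq)
  have zero: "\<phi> x = 0" "partial_deriv \<phi> k x = 0" if "x \<notin> cball 0 R" for x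
    using contra_subsetD[OF R that] test_fun_outside[OF \<phi>, of x] partial_deriv_outside_support[of x \<phi> k]
    by auto
  \<comment> \<open>Steps are at most 1, so the ball of radius R + 1 contains the supports of \<phi>
    and of all its translates.\<close>
  obtain M where M: "\<And>x. x \<in> cball 0 (R + 1) \<Longrightarrow> \<bar>F x\<bar> \<le> M" using bnd[of "R + 1"] by blast
  have M0: "\<bar>F x\<bar> \<le> \<bar>M\<bar>" if "x \<in> cball 0 (R + 1)" for x using M[OF that] by simp
  define s where "s n = 1 / real (Suc n)" for n
  have s: "s n > 0" "s n \<le> 1" "real (Suc n) = 1 / s n" for n by (auto simp: s_def)
  define Q where "Q n x = (\<phi> (x + s n *\<^sub>R ?e) - \<phi> x) / s n" for n x
  have out: "x + s n *\<^sub>R ?e \<notin> cball 0 R" if "x \<notin> cball 0 (R + 1)" for x n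
  proof -
    have "norm x \<le> norm (x + s n *\<^sub>R ?e) + norm (s n *\<^sub>R ?e)"
      using norm_triangle_ineq4[of "x + s n *\<^sub>R ?e" "s n *\<^sub>R ?e"] by simp
    then show ?thesis using that s(1,2)[of n] by simp
  qed
  have Qz: "Q n x = 0" if "x \<notin> cball 0 (R + 1)" for n x
    using zero(1)[OF out[OF that, of n]] zero(1)[of x] that by (simp add: Q_def)
  have Qb: "\<bar>Q n x\<bar> \<le> B" for n x
    using smooth_fun_increment_bound[OF sm B(2) s(1), of x n] s(1)[of n]
    by (simp add: Q_def abs_divide divide_le_eq)
  have [measurable]: "Q n \<in> borel_measurable borel" for n
    unfolding Q_def[abs_def] by measurable
  have Qlim: "(\<lambda>n. Q n x) \<longlonglongrightarrow> partial_deriv \<phi> k x" for x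
  proof -
    have "((\<lambda>h. (\<phi> (x + h *\<^sub>R ?e) - \<phi> x) / h) \<longlongrightarrow> partial_deriv \<phi> k x) (at 0)"
      using has_real_derivative_along_axis[OF sm, of x k 0] by (simp add: DERIV_def)
    moreover have "filterlim s (at 0) sequentially"
      unfolding filterlim_at
    proof
      show "\<forall>\<^sub>F n in sequentially. s n \<in> UNIV \<and> s n \<noteq> 0" using s(1) by (auto simp: less_imp_neq[symmetric])
      show "s \<longlonglongrightarrow> 0" unfolding s_def[abs_def] by (intro LIMSEQ_Suc lim_1_over_n)
    qed
    ultimately show ?thesis
      unfolding Q_def by (rule filterlim_compose)
  qed
  have main: "(\<integral>x. diff_quot k n F x * \<phi> x \<partial>lborel) = - (\<integral>x. F x * Q n x \<partial>lborel)" for n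
  proof -
    have i1: "integrable lborel (\<lambda>x. F x * \<phi> x)"
    proof (rule compact_support_integrable[OF compact_cball[of 0 "R + 1"], where B = "\<bar>M\<bar> * B0"])
      show "\<bar>F x * \<phi> x\<bar> \<le> \<bar>M\<bar> * B0" if "x \<in> cball 0 (R + 1)" for x
        unfolding abs_mult by (intro mult_mono M0 B0 that) auto
      show "F x * \<phi> x = 0" if "x \<notin> cball 0 (R + 1)" for x using that zero(1)[of x] by simp
    qed measurable
    have i2: "integrable lborel (\<lambda>x. F x * \<phi> (x + s n *\<^sub>R ?e))"
    proof (rule compact_support_integrable[OF compact_cball[of 0 "R + 1"], where B = "\<bar>M\<bar> * B0"])
      show "\<bar>F x * \<phi> (x + s n *\<^sub>R ?e)\<bar> \<le> \<bar>M\<bar> * B0" if "x \<in> cball 0 (R + 1)" for x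
        unfolding abs_mult by (intro mult_mono M0 B0 that) auto
      show "F x * \<phi> (x + s n *\<^sub>R ?e) = 0" if "x \<notin> cball 0 (R + 1)" for x
        using zero(1)[OF out[OF that]] by simp
    qed measurable
    have i3: "integrable lborel (\<lambda>x. F (x - s n *\<^sub>R ?e) * \<phi> x)"
    proof (rule compact_support_integrable[OF compact_cball[of 0 R], where B = "\<bar>M\<bar> * B0"])
      show "\<bar>F (x - s n *\<^sub>R ?e) * \<phi> x\<bar> \<le> \<bar>M\<bar> * B0" if "x \<in> cball 0 R" for x
      proof -
        have "norm (x - s n *\<^sub>R ?e) \<le> norm x + norm (s n *\<^sub>R ?e)" by (rule norm_triangle_ineq4)
        then have "x - s n *\<^sub>R ?e \<in> cball 0 (R + 1)" using that s(1,2)[of n] by simp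
        then show ?thesis unfolding abs_mult by (intro mult_mono M0 B0) auto
      qed
      show "F (x - s n *\<^sub>R ?e) * \<phi> x = 0" if "x \<notin> cball 0 R" for x using zero(1)[OF that] by simp
    qed measurable
    have "(\<integral>x. F (x - s n *\<^sub>R ?e) * \<phi> x \<partial>lborel) =
        (\<integral>x. F ((x + s n *\<^sub>R ?e) - s n *\<^sub>R ?e) * \<phi> (x + s n *\<^sub>R ?e) \<partial>lborel)"
      by (rule lborel_integral_translate[symmetric]) measurable
    then have tr: "(\<integral>x. F (x - s n *\<^sub>R ?e) * \<phi> x \<partial>lborel) = (\<integral>x. F x * \<phi> (x + s n *\<^sub>R ?e) \<partial>lborel)"
      by simp
    have "(\<integral>x. diff_quot k n F x * \<phi> x \<partial>lborel) =
        (\<integral>x. (1 / s n) * (F x * \<phi> x - F (x - s n *\<^sub>R ?e) * \<phi> x) \<partial>lborel)"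
      unfolding diff_quot_def s(3)[of n] by (intro Bochner_Integration.integral_cong) (auto simp: algebra_simps)
    also have "\<dots> = (1 / s n) * ((\<integral>x. F x * \<phi> x \<partial>lborel) - (\<integral>x. F (x - s n *\<^sub>R ?e) * \<phi> x \<partial>lborel))"
      using i1 i3 by simp
    also have "\<dots> = - ((1 / s n) * ((\<integral>x. F x * \<phi> (x + s n *\<^sub>R ?e) \<partial>lborel) - (\<integral>x. F x * \<phi> x \<partial>lborel)))"
      unfolding tr by (simp add: algebra_simps)
    also have "\<dots> = - (\<integral>x. (1 / s n) * (F x * \<phi> (x + s n *\<^sub>R ?e) - F x * \<phi> x) \<partial>lborel)"
      using i1 i2 by simp
    also have "\<dots> = - (\<integral>x. F x * Q n x \<partial>lborel)"
      by (intro arg_cong[of _ _ uminus] Bochner_Integration.integral_cong)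
        (auto simp: Q_def diff_divide_distrib right_diff_distrib)
    finally show ?thesis .
  qed
  have "(\<lambda>n. \<integral>x. F x * Q n x \<partial>lborel) \<longlonglongrightarrow> (\<integral>x. F x * partial_deriv \<phi> k x \<partial>lborel)"
  proof (rule integral_dominated_convergence[where w = "\<lambda>x. (\<bar>M\<bar> * B) * indicat_real (cball 0 (R + 1)) x"])
    show "integrable lborel (\<lambda>x. (\<bar>M\<bar> * B) * indicat_real (cball 0 (R + 1)) x)"
      by (intro integrable_mult_right integrable_real_indicator) (simp_all add: emeasure_lborel_cball_finite[unfolded infinity_ennreal_def])
    show "AE x in lborel. (\<lambda>n. F x * Q n x) \<longlonglongrightarrow> F x * partial_deriv \<phi> k x"
      by (intro always_eventually allI tendsto_intros Qlim)
    show "AE x in lborel. norm (F x * Q n x) \<le> (\<bar>M\<bar> * B) * indicat_real (cball 0 (R + 1)) x" for n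
    proof (intro always_eventually allI)
      fix x show "norm (F x * Q n x) \<le> (\<bar>M\<bar> * B) * indicat_real (cball 0 (R + 1)) x"
      proof (cases "x \<in> cball 0 (R + 1)")
        case True
        then show ?thesis
          using mult_mono[OF M0[OF True] Qb[of n x]] by (simp add: abs_mult)
      qed (simp add: Qz)
    qed
  qed measurable
  then show ?thesis unfolding main by (rule tendsto_minus)
qed

text \<open>Take an open V containing -S with V \<inter> S of measure below e. Its complement is a
  closed subset of S, hence a countable union of compact subsets of S and therefore null; what is
  left of S has measure below e.\<close>

lemma null_sets_if_compact_null:
  fixes S :: "'a::euclidean_space set"
  assumes S: "S \<in> sets borel" and null: "\<And>T. compact T \<Longrightarrow> T \<subseteq> S \<Longrightarrow> T \<in> null_sets lborel"
  shows "S \<in> null_sets lborel"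
proof -
  have le: "emeasure lborel S \<le> ennreal e" if e: "e > 0" for e
  proof -
    have "- S \<in> sets borel" using S by simp
    from outer_regular_lborel[OF this e] obtain V
      where V: "open V" "- S \<subseteq> V" "emeasure lborel (V - - S) < ennreal e" by blast
    have "- V = (\<Union>n::nat. - V \<inter> cball 0 (real n))"
    proof safe
      fix x :: 'a assume "x \<notin> V"
      moreover have "x \<in> cball 0 (real (nat \<lceil>norm x\<rceil>))" by (simp add: of_nat_ceiling)
      ultimately show "x \<in> (\<Union>n::nat. - V \<inter> cball 0 (real n))" by blast
    qed
    also have "\<dots> \<in> null_sets lborel"
    proof (intro null_sets_UN null)
      fix n
      show "compact (- V \<inter> cball 0 (real n))"
        using V(1) by (intro closed_Int_compact) auto
      show "- V \<inter> cball 0 (real n) \<subseteq> S" using V(2) by blast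
    qed
    finally have nV: "- V \<in> null_sets lborel" .
    have "emeasure lborel S \<le> emeasure lborel ((V - - S) \<union> - V)"
      using V(1) S by (intro emeasure_mono) auto
    also have "\<dots> = emeasure lborel (V - - S)"
      using V(1) S by (intro emeasure_Un_null_set nV) auto
    finally show ?thesis using V(3) by simp
  qed
  have "emeasure lborel S \<le> 0"
    by (rule ennreal_le_epsilon) (use le in auto)
  then show ?thesis using S by (intro null_setsI) auto
qed

section \<open>Weak gradients of Lipschitz functions: bound and chain rule for squares\<close>

locale lipschitz_weak_gradient =
  fixes U :: "(real^'d) set" and f :: "real^'d \<Rightarrow> real" and g :: "real^'d \<Rightarrow> real^'d" and L :: real
  assumes openU: "open U" and lip: "L-lipschitz_on U f" and wg: "weak_gradient_on U f g"
    and g_borel [measurable]: "g \<in> borel_measurable borel"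
begin

lemma g_nth_borel [measurable]: "(\<lambda>x. g x $ k) \<in> borel_measurable borel"
  by (rule measurable_compose[OF g_borel borel_measurable_nth])

lemma L_nonneg: "0 \<le> L"
  using lip by (rule lipschitz_on_nonneg)

text \<open>Extension by zero gives a Borel function on the whole space, so that difference
  quotients and translations make sense everywhere. Its possible jump at the boundary of U is never
  seen: all pairings are with functions supported in a compact subset of U.\<close>

definition f_ext :: "real^'d \<Rightarrow> real" where "f_ext x = (if x \<in> U then f x else 0)"

lemma f_ext_borel [measurable]: "f_ext \<in> borel_measurable borel"
  unfolding f_ext_def[abs_def]
  by (rule borel_measurable_continuous_on_if)
    (use openU lipschitz_on_continuous_on[OF lip] in auto)

lemma f_ext_locally_bounded: "\<exists>M. \<forall>x\<in>cball 0 R. \<bar>f_ext x\<bar> \<le> M"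
proof (cases "U = {}")
  case True
  then have "f_ext x = 0" for x unfolding f_ext_def by simp
  then show ?thesis by auto
next
  case False
  then obtain x0 where x0: "x0 \<in> U" by blast
  have "\<bar>f_ext x\<bar> \<le> \<bar>f x0\<bar> + L * (\<bar>R\<bar> + norm x0)" if "x \<in> cball 0 R" for x
  proof (cases "x \<in> U")
    case True
    have "\<bar>f x - f x0\<bar> \<le> L * dist x x0"
      using lipschitz_onD[OF lip True x0] by (simp add: dist_real_def)
    also have "\<dots> \<le> L * (\<bar>R\<bar> + norm x0)"
      using that norm_triangle_ineq4[of x x0] L_nonneg by (intro mult_left_mono) (auto simp: dist_norm)
    finally show ?thesis using True by (simp add: f_ext_def)
  qed (use L_nonneg in \<open>simp add: f_ext_def\<close>)
  then show ?thesis by blast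
qed

lemma g_integrable:
  assumes "compact K" "K \<subseteq> U"
  shows "integrable lborel (\<lambda>x. indicat_real K x * g x $ k)"
  using wg assms by (auto simp: weak_gradient_on_def locally_integrable_on_def set_integrable_def)

lemma g_times_integrable:
  assumes K: "compact K" "K \<subseteq> U" and [measurable]: "\<psi> \<in> borel_measurable borel"
    and B: "\<And>x. \<bar>\<psi> x\<bar> \<le> B" and z: "\<And>x. x \<notin> K \<Longrightarrow> \<psi> x = 0"
  shows "integrable lborel (\<lambda>x. g x $ k * \<psi> x)"
proof (rule Bochner_Integration.integrable_bound)
  show "integrable lborel (\<lambda>x. B * (indicat_real K x * g x $ k))"
    by (intro integrable_mult_right g_integrable K)
  show "(\<lambda>x. g x $ k * \<psi> x) \<in> borel_measurable lborel" by measurable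
  show "AE x in lborel. norm (g x $ k * \<psi> x) \<le> norm (B * (indicat_real K x * g x $ k))"
  proof (intro always_eventually allI)
    fix x show "norm (g x $ k * \<psi> x) \<le> norm (B * (indicat_real K x * g x $ k))"
    proof (cases "x \<in> K")
      case True
      have "\<bar>\<psi> x\<bar> * \<bar>g x $ k\<bar> \<le> \<bar>B\<bar> * \<bar>g x $ k\<bar>"
        using B[of x] by (intro mult_right_mono) auto
      then show ?thesis using True by (simp add: abs_mult mult.commute)
    qed (simp add: z)
  qed
qed

text \<open>A test function and its derivatives vanish off U, so the integrals over U may be taken
  over the whole space, where translation invariance is available.\<close>

lemma weak_identity:
  assumes \<phi>: "test_fun U \<phi>"
  shows "(\<integral>x. f_ext x * partial_deriv \<phi> k x \<partial>lborel) = - (\<integral>x. g x $ k * \<phi> x \<partial>lborel)"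
proof -
  have "(LINT x:U|lborel. f x * partial_deriv \<phi> k x) = - (LINT x:U|lborel. g x $ k * \<phi> x)"
    using wg \<phi> by (simp add: weak_gradient_on_def)
  moreover have "(LINT x:U|lborel. f x * partial_deriv \<phi> k x) = (\<integral>x. f_ext x * partial_deriv \<phi> k x \<partial>lborel)"
    unfolding set_lebesgue_integral_def
    by (intro Bochner_Integration.integral_cong) (auto simp: f_ext_def indicator_def)
  moreover have "(LINT x:U|lborel. g x $ k * \<phi> x) = (\<integral>x. g x $ k * \<phi> x \<partial>lborel)"
    unfolding set_lebesgue_integral_def
  proof (intro Bochner_Integration.integral_cong refl)
    fix x
    have "\<phi> x = 0" if "x \<notin> U"
      using test_fun_outside[OF \<phi>, of x] \<phi> that unfolding test_fun_def by blast
    then show "indicator U x *\<^sub>R (g x $ k * \<phi> x) = g x $ k * \<phi> x"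
      by (cases "x \<in> U") auto
  qed
  ultimately show ?thesis by simp
qed

lemma diff_quot_test:
  assumes \<phi>: "test_fun U \<phi>"
  shows "(\<lambda>n. \<integral>x. diff_quot k n f_ext x * \<phi> x \<partial>lborel) \<longlonglongrightarrow> (\<integral>x. g x $ k * \<phi> x \<partial>lborel)"
  using diff_quot_test_tendsto[OF f_ext_borel f_ext_locally_bounded \<phi>, of k] weak_identity[OF \<phi>] by simp

text \<open>A closed \<epsilon>-neighbourhood of K lies in U. Once the step is below \<epsilon>,
  both points of the quotient are in U and the Lipschitz estimate applies, uniformly over K.\<close>

lemma diff_quot_bounded:
  assumes "compact K" "K \<subseteq> U"
  shows "\<forall>\<^sub>F n in sequentially. \<forall>x\<in>K. x - (1 / real (Suc n)) *\<^sub>R axis k 1 \<in> U \<and> \<bar>diff_quot k n f_ext x\<bar> \<le> L"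
proof -
  obtain \<epsilon> where \<epsilon>: "\<epsilon> > 0" "(\<Union>x\<in>K. cball x \<epsilon>) \<subseteq> U"
    using compact_subset_open_imp_cball_epsilon_subset[OF assms(1) openU assms(2)] by blast
  have "(\<lambda>n. 1 / real (Suc n)) \<longlonglongrightarrow> 0" by (intro LIMSEQ_Suc lim_1_over_n)
  then have "\<forall>\<^sub>F n in sequentially. 1 / real (Suc n) < \<epsilon>"
    using \<epsilon>(1) by (rule order_tendstoD)
  then show ?thesis
  proof eventually_elim
    case (elim n)
    show ?case
    proof
      fix x assume x: "x \<in> K"
      let ?y = "x - (1 / real (Suc n)) *\<^sub>R axis k 1"
      have d: "dist x ?y = 1 / real (Suc n)" by (simp add: dist_norm)
      then have "?y \<in> cball x \<epsilon>" using elim by simp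
      then have y: "?y \<in> U" using \<epsilon>(2) x by blast
      have xU: "x \<in> U" using x assms(2) by blast
      have "\<bar>f x - f ?y\<bar> \<le> L * (1 / real (Suc n))"
        using lipschitz_onD[OF lip xU y] unfolding d by (simp add: dist_real_def)
      then have "real (Suc n) * \<bar>f x - f ?y\<bar> \<le> real (Suc n) * (L * (1 / real (Suc n)))"
        by (intro mult_left_mono) auto
      then have "\<bar>diff_quot k n f_ext x\<bar> \<le> L"
        using xU y by (simp add: diff_quot_def f_ext_def abs_mult del: of_nat_Suc)
      with y show "?y \<in> U \<and> \<bar>diff_quot k n f_ext x\<bar> \<le> L" by simp
    qed
  qed
qed

lemma diff_quot_pairing_bound:
  assumes K: "compact K" and [measurable]: "\<psi> \<in> borel_measurable borel"
    and B: "\<And>x. \<bar>\<psi> x\<bar> \<le> B" and z: "\<And>x. x \<notin> K \<Longrightarrow> \<psi> x = 0"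
    and n: "\<And>x. x \<in> K \<Longrightarrow> \<bar>diff_quot k n f_ext x\<bar> \<le> L"
  shows "integrable lborel (\<lambda>x. diff_quot k n f_ext x * \<psi> x)"
    "\<bar>\<integral>x. diff_quot k n f_ext x * \<psi> x \<partial>lborel\<bar> \<le> L * (\<integral>x. \<bar>\<psi> x\<bar> \<partial>lborel)"
proof -
  have le: "\<bar>diff_quot k n f_ext x * \<psi> x\<bar> \<le> L * \<bar>\<psi> x\<bar>" for x
    using n[of x] z[of x] by (cases "x \<in> K") (auto simp: abs_mult intro: mult_right_mono)
  have le': "\<bar>diff_quot k n f_ext x * \<psi> x\<bar> \<le> L * B" for x
    using le[of x] mult_left_mono[OF B[of x] L_nonneg] by linarith
  show int: "integrable lborel (\<lambda>x. diff_quot k n f_ext x * \<psi> x)"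
    using z by (intro compact_support_integrable[OF K _ le']) auto
  have "integrable lborel \<psi>"
    by (rule compact_support_integrable[OF K _ B z]) auto
  then have i2: "integrable lborel (\<lambda>x. L * \<bar>\<psi> x\<bar>)" by simp
  have "\<bar>\<integral>x. diff_quot k n f_ext x * \<psi> x \<partial>lborel\<bar> \<le> (\<integral>x. \<bar>diff_quot k n f_ext x * \<psi> x\<bar> \<partial>lborel)"
    using integral_norm_bound[of lborel "\<lambda>x. diff_quot k n f_ext x * \<psi> x"] by simp
  also have "\<dots> \<le> (\<integral>x. L * \<bar>\<psi> x\<bar> \<partial>lborel)"
    using int i2 le by (intro integral_mono) auto
  finally show "\<bar>\<integral>x. diff_quot k n f_ext x * \<psi> x \<partial>lborel\<bar> \<le> L * (\<integral>x. \<bar>\<psi> x\<bar> \<partial>lborel)"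
    by simp
qed

text \<open>The bound by L times the L^1 norm of \<phi> is uniform in n for the difference
  quotients, hence survives their limit. It is next widened to continuous functions and to
  indicators of compact sets, where it can be localised.\<close>

lemma test_pairing_bound:
  assumes \<phi>: "test_fun U \<phi>"
  shows "\<bar>\<integral>x. g x $ k * \<phi> x \<partial>lborel\<bar> \<le> L * (\<integral>x. \<bar>\<phi> x\<bar> \<partial>lborel)"
proof -
  have K: "compact (closure {x. \<phi> x \<noteq> 0})" "closure {x. \<phi> x \<noteq> 0} \<subseteq> U"
    using \<phi> by (auto simp: test_fun_def)
  obtain B where B: "\<And>x. \<bar>\<phi> x\<bar> \<le> B" using test_fun_bounded[OF \<phi>] by blast
  have "\<forall>\<^sub>F n in sequentially. \<bar>\<integral>x. diff_quot k n f_ext x * \<phi> x \<partial>lborel\<bar> \<le> L * (\<integral>x. \<bar>\<phi> x\<bar> \<partial>lborel)"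
    using diff_quot_bounded[OF K, of k]
  proof eventually_elim
    case (elim n)
    then show ?case
      by (intro diff_quot_pairing_bound(2)[OF K(1) test_fun_borel[OF \<phi>] B test_fun_outside[OF \<phi>]]) auto
  qed
  from tendsto_upperbound[OF tendsto_rabs[OF diff_quot_test[OF \<phi>]] this] show ?thesis by simp
qed

text \<open>Both sides pass to the limit along test functions with a common bound that vanish
  outside the support of \<psi>. On the left the majorant comes from local integrability of g, since
  no bound on g is known yet.\<close>

lemma continuous_pairing_bound:
  assumes cont: "continuous_on UNIV \<psi>" and K: "compact (closure {x. \<psi> x \<noteq> 0})"
    "closure {x. \<psi> x \<noteq> 0} \<subseteq> U"
  shows "\<bar>\<integral>x. g x $ k * \<psi> x \<partial>lborel\<bar> \<le> L * (\<integral>x. \<bar>\<psi> x\<bar> \<partial>lborel)"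
proof -
  let ?K = "closure {x. \<psi> x \<noteq> 0}"
  obtain \<phi> B where \<phi>: "\<And>n. test_fun U (\<phi> n)" "\<And>n x. \<bar>\<phi> n x\<bar> \<le> B"
    "\<And>n x. \<psi> x = 0 \<Longrightarrow> \<phi> n x = 0" "\<And>x. (\<lambda>n. \<phi> n x) \<longlonglongrightarrow> \<psi> x"
    using continuous_test_fun_limit[OF assms] by blast
  have [measurable]: "\<psi> \<in> borel_measurable borel" using cont by (rule borel_measurable_continuous_onI)
  have [measurable]: "\<phi> n \<in> borel_measurable borel" for n using \<phi>(1) by (rule test_fun_borel)
  have z: "\<phi> n x = 0" if "x \<notin> ?K" for n x
    using \<phi>(3) that subsetD[OF closure_subset[of "{x. \<psi> x \<noteq> 0}"], of x] by auto
  have B: "0 \<le> B" using \<phi>(2)[of 0 0] by simp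
  have Kb: "?K \<in> sets borel" by simp
  have "(\<lambda>n. \<integral>x. g x $ k * \<phi> n x \<partial>lborel) \<longlonglongrightarrow> (\<integral>x. g x $ k * \<psi> x \<partial>lborel)"
  proof (rule integral_dominated_convergence[where w = "\<lambda>x. B * \<bar>indicat_real ?K x * g x $ k\<bar>"])
    show "integrable lborel (\<lambda>x. B * \<bar>indicat_real ?K x * g x $ k\<bar>)"
      by (intro integrable_mult_right integrable_abs g_integrable K)
    show "AE x in lborel. (\<lambda>n. g x $ k * \<phi> n x) \<longlonglongrightarrow> g x $ k * \<psi> x"
      by (intro always_eventually allI tendsto_intros \<phi>(4))
    show "AE x in lborel. norm (g x $ k * \<phi> n x) \<le> B * \<bar>indicat_real ?K x * g x $ k\<bar>" for n
    proof (intro always_eventually allI)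
      fix x show "norm (g x $ k * \<phi> n x) \<le> B * \<bar>indicat_real ?K x * g x $ k\<bar>"
        using mult_right_mono[OF \<phi>(2)[of n x] abs_ge_zero[of "g x $ k"]] z[of x n]
        by (cases "x \<in> ?K") (auto simp: abs_mult mult.commute)
    qed
  qed measurable
  moreover have "(\<lambda>n. \<integral>x. \<bar>\<phi> n x\<bar> \<partial>lborel) \<longlonglongrightarrow> (\<integral>x. \<bar>\<psi> x\<bar> \<partial>lborel)"
  proof (rule integral_dominated_convergence[where w = "\<lambda>x. B * indicat_real ?K x"])
    show "integrable lborel (\<lambda>x. B * indicat_real ?K x)"
      using emeasure_compact_finite[OF K(1)] Kb
      by (intro integrable_mult_right integrable_real_indicator) auto
    show "AE x in lborel. (\<lambda>n. \<bar>\<phi> n x\<bar>) \<longlonglongrightarrow> \<bar>\<psi> x\<bar>"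
      by (intro always_eventually allI tendsto_intros \<phi>(4))
    show "AE x in lborel. norm \<bar>\<phi> n x\<bar> \<le> B * indicat_real ?K x" for n
    proof (intro always_eventually allI)
      fix x show "norm \<bar>\<phi> n x\<bar> \<le> B * indicat_real ?K x"
        using \<phi>(2)[of n x] z[of x n] by (cases "x \<in> ?K") auto
    qed
  qed measurable
  ultimately show ?thesis
    using test_pairing_bound[OF \<phi>(1)]
    by (intro LIMSEQ_le[OF tendsto_rabs tendsto_mult[OF tendsto_const]]) auto
qed

lemma compact_pairing_bound:
  assumes C: "compact C" "C \<subseteq> U"
  shows "\<bar>\<integral>x. g x $ k * indicat_real C x \<partial>lborel\<bar> \<le> L * (\<integral>x. indicat_real C x \<partial>lborel)"
proof (cases "C = {}")
  case False
  obtain \<epsilon> where \<epsilon>: "\<epsilon> > 0" "(\<Union>x\<in>C. cball x \<epsilon>) \<subseteq> U"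
    using compact_subset_open_imp_cball_epsilon_subset[OF C(1) openU C(2)] by blast
  let ?K = "{x. infdist x C \<le> \<epsilon>}"
  have K: "compact ?K" by (rule compact_infdist_le[OF False C(1) \<epsilon>(1)])
  have KU: "?K \<subseteq> U"
  proof
    fix x assume x: "x \<in> ?K"
    obtain c where "c \<in> C" "infdist x C = dist x c"
      by (rule infdist_attains_inf[OF compact_imp_closed[OF C(1)] False])
    then have "x \<in> (\<Union>x\<in>C. cball x \<epsilon>)" using x by (auto simp: dist_commute)
    then show "x \<in> U" using \<epsilon>(2) by blast
  qed
  \<comment> \<open>Tents decreasing to the indicator of C. Measuring the distance in units of
    \<epsilon> keeps all of them supported in \<open>?K\<close>, a neighbourhood of C inside
    U.\<close>
  define \<psi> where "\<psi> n x = max 0 (1 - real (Suc n) * (infdist x C / \<epsilon>))" for n x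
  have cont: "continuous_on UNIV (\<psi> n)" for n
    unfolding \<psi>_def by (intro continuous_intros) (use \<epsilon> in auto)
  have [measurable]: "\<psi> n \<in> borel_measurable borel" for n
    by (rule borel_measurable_continuous_onI[OF cont])
  have [measurable]: "C \<in> sets borel" by (intro borel_closed compact_imp_closed C)
  have Ks: "?K \<in> sets borel" by (intro borel_closed compact_imp_closed K)
  have bnd: "0 \<le> \<psi> n x" "\<psi> n x \<le> 1" for n x
    using \<epsilon>(1) infdist_nonneg[of x C] by (auto simp: \<psi>_def)
  have z: "\<psi> n x = 0" if "x \<notin> ?K" for n x
  proof -
    have "1 \<le> infdist x C / \<epsilon>" using that \<epsilon>(1) by simp
    then have "1 * 1 \<le> real (Suc n) * (infdist x C / \<epsilon>)" by (intro mult_mono) auto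
    then show ?thesis by (simp add: \<psi>_def)
  qed
  have supp: "closure {x. \<psi> n x \<noteq> 0} \<subseteq> ?K" for n
    using z compact_imp_closed[OF K] by (intro closure_minimal) blast+
  have suppc: "compact (closure {x. \<psi> n x \<noteq> 0})" for n
    using compact_Int_closed[OF K closed_closure[of "{x. \<psi> n x \<noteq> 0}"]] supp[of n]
    by (simp only: Int_absorb1)
  have lim: "(\<lambda>n. \<psi> n x) \<longlonglongrightarrow> indicat_real C x" for x
  proof (cases "x \<in> C")
    case True
    then show ?thesis by (simp add: \<psi>_def)
  next
    case False
    then have pos: "infdist x C / \<epsilon> > 0"
      using infdist_pos_not_in_closed[OF compact_imp_closed[OF C(1)] \<open>C \<noteq> {}\<close>, of x] \<epsilon>(1) by simp
    from reals_Archimedean3[OF pos, rule_format, of 1]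
    obtain N where N: "1 < real N * (infdist x C / \<epsilon>)" by blast
    have "\<psi> n x = 0" if "n \<ge> N" for n
    proof -
      have "real N * (infdist x C / \<epsilon>) \<le> real (Suc n) * (infdist x C / \<epsilon>)"
        using that pos by (intro mult_right_mono) auto
      then show ?thesis using N by (simp add: \<psi>_def)
    qed
    then have "\<forall>\<^sub>F n in sequentially. \<psi> n x = 0"
      by (rule eventually_sequentiallyI)
    then have "(\<lambda>n. \<psi> n x) \<longlonglongrightarrow> 0" by (rule tendsto_eventually)
    then show ?thesis using False by simp
  qed
  have "(\<lambda>n. \<integral>x. g x $ k * \<psi> n x \<partial>lborel) \<longlonglongrightarrow> (\<integral>x. g x $ k * indicat_real C x \<partial>lborel)"
  proof (rule integral_dominated_convergence[where w = "\<lambda>x. \<bar>indicat_real ?K x * g x $ k\<bar>"])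
    show "integrable lborel (\<lambda>x. \<bar>indicat_real ?K x * g x $ k\<bar>)"
      by (intro integrable_abs g_integrable K KU)
    show "AE x in lborel. (\<lambda>n. g x $ k * \<psi> n x) \<longlonglongrightarrow> g x $ k * indicat_real C x"
      by (intro always_eventually allI tendsto_intros lim)
    show "AE x in lborel. norm (g x $ k * \<psi> n x) \<le> \<bar>indicat_real ?K x * g x $ k\<bar>" for n
    proof (intro always_eventually allI)
      fix x
      have "\<bar>g x $ k\<bar> * \<bar>\<psi> n x\<bar> \<le> \<bar>g x $ k\<bar> * 1"
        using bnd[of n x] by (intro mult_left_mono) auto
      then show "norm (g x $ k * \<psi> n x) \<le> \<bar>indicat_real ?K x * g x $ k\<bar>"
        using z[of x n] by (cases "x \<in> ?K") (auto simp: abs_mult)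
    qed
  qed measurable
  moreover have "(\<lambda>n. \<integral>x. \<bar>\<psi> n x\<bar> \<partial>lborel) \<longlonglongrightarrow> (\<integral>x. indicat_real C x \<partial>lborel)"
  proof (rule integral_dominated_convergence[where w = "indicat_real ?K"])
    show "integrable lborel (indicat_real ?K)"
      using emeasure_compact_finite[OF K] Ks by (intro integrable_real_indicator) auto
    show "AE x in lborel. (\<lambda>n. \<bar>\<psi> n x\<bar>) \<longlonglongrightarrow> indicat_real C x"
      using bnd lim by (intro always_eventually allI) simp
    show "AE x in lborel. norm \<bar>\<psi> n x\<bar> \<le> indicat_real ?K x" for n
    proof (intro always_eventually allI)
      fix x show "norm \<bar>\<psi> n x\<bar> \<le> indicat_real ?K x"
        using bnd[of n x] z[of x n] by (cases "x \<in> ?K") auto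
    qed
  qed measurable
  ultimately show ?thesis
    using continuous_pairing_bound[OF cont suppc subset_trans[OF supp KU]]
    by (intro LIMSEQ_le[OF tendsto_rabs tendsto_mult[OF tendsto_const]]) auto
qed simp

text \<open>The function (s g_k - L) 1_C is positive on C, yet the pairing bound makes its integral
  nonpositive; so it vanishes almost everywhere and C is null. The sign s treats the upper and the
  lower bound at once.\<close>

lemma compact_exceeding_null:
  assumes C: "compact C" "C \<subseteq> U" and s: "\<bar>s\<bar> = 1" and gt: "\<And>x. x \<in> C \<Longrightarrow> L < s * g x $ k"
  shows "C \<in> null_sets lborel"
proof -
  have [measurable]: "C \<in> sets borel" by (intro borel_closed compact_imp_closed C)
  have iC: "integrable lborel (indicat_real C)"
    using emeasure_compact_finite[OF C(1)] by (intro integrable_real_indicator) auto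
  have ig: "integrable lborel (\<lambda>x. g x $ k * indicat_real C x)"
    using g_integrable[OF C] by (simp add: mult.commute)
  define h where "h x = s * (g x $ k * indicat_real C x) - L * indicat_real C x" for x
  have ih: "integrable lborel h"
    unfolding h_def[abs_def] using iC ig by simp
  have h0: "0 \<le> h x" for x
    using gt[of x] by (cases "x \<in> C") (auto simp: h_def)
  have "s * (\<integral>x. g x $ k * indicat_real C x \<partial>lborel) \<le> \<bar>\<integral>x. g x $ k * indicat_real C x \<partial>lborel\<bar>"
    using abs_ge_self[of "s * (\<integral>x. g x $ k * indicat_real C x \<partial>lborel)"] s by (simp add: abs_mult)
  then have "integral\<^sup>L lborel h \<le> 0"
    unfolding h_def[abs_def] using iC ig compact_pairing_bound[OF C, of k] by simp
  moreover have "0 \<le> integral\<^sup>L lborel h"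
    by (rule Bochner_Integration.integral_nonneg) (rule h0)
  ultimately have "integral\<^sup>L lborel h = 0" by linarith
  then have "AE x in lborel. h x = 0"
    using integral_nonneg_eq_0_iff_AE[OF ih] h0 by simp
  then have "AE x in lborel. x \<notin> C"
  proof eventually_elim
    case (elim x)
    then show ?case using gt[of x] by (auto simp: h_def)
  qed
  then show ?thesis
    using AE_iff_null_sets[of C lborel] by simp
qed

text \<open>A Borel set all of whose compact subsets are null is itself null; this is applied to the
  sets where g_k or -g_k exceeds L.\<close>

lemma gradient_component_bound: "AE x in lborel. x \<in> U \<longrightarrow> \<bar>g x $ k\<bar> \<le> L"
proof -
  have *: "AE x in lborel. \<not> (x \<in> U \<and> L < s * g x $ k)" if s: "\<bar>s\<bar> = 1" for s
  proof -
    have [measurable]: "U \<in> sets borel" using openU by simp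
    have "{x. x \<in> U \<and> L < s * g x $ k} \<in> null_sets lborel"
      by (rule null_sets_if_compact_null, measurable, rule compact_exceeding_null[OF _ _ s]) auto
    then show ?thesis by (rule AE_I'[of _ lborel]) auto
  qed
  show ?thesis
    using *[of 1, simplified] *[of "-1", simplified] by eventually_elim auto
qed

text \<open>Replacing \<psi> by a test function \<phi> m costs at most L times the L^1 norm of
  \<psi> - \<phi> m, both for the quotients, uniformly in large n, and for g. The extension beyond
  test functions is what the chain rule needs: its multiplier 2 f \<phi> is continuous but in
  general not smooth.\<close>

lemma diff_quot_continuous:
  assumes cont: "continuous_on UNIV \<psi>" and K: "compact (closure {x. \<psi> x \<noteq> 0})"
    "closure {x. \<psi> x \<noteq> 0} \<subseteq> U"
  shows "(\<lambda>n. \<integral>x. diff_quot k n f_ext x * \<psi> x \<partial>lborel) \<longlonglongrightarrow> (\<integral>x. g x $ k * \<psi> x \<partial>lborel)"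
proof -
  let ?K = "closure {x. \<psi> x \<noteq> 0}"
  obtain \<phi> B where \<phi>: "\<And>n. test_fun U (\<phi> n)" "\<And>n x. \<bar>\<phi> n x\<bar> \<le> B"
    "\<And>n x. \<psi> x = 0 \<Longrightarrow> \<phi> n x = 0" "\<And>x. (\<lambda>n. \<phi> n x) \<longlonglongrightarrow> \<psi> x"
    using continuous_test_fun_limit[OF assms] by blast
  obtain B' where B': "\<And>x. \<bar>\<psi> x\<bar> \<le> B'" using compact_support_bounded[OF cont K(1)] by blast
  have [measurable]: "\<psi> \<in> borel_measurable borel" using cont by (rule borel_measurable_continuous_onI)
  have [measurable]: "\<phi> n \<in> borel_measurable borel" for n using \<phi>(1) by (rule test_fun_borel)
  have z': "\<psi> x = 0" if "x \<notin> ?K" for x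
    using that subsetD[OF closure_subset[of "{x. \<psi> x \<noteq> 0}"], of x] by auto
  have z: "\<phi> n x = 0" if "x \<notin> ?K" for n x
    using \<phi>(3) z'[OF that] by simp
  have Ks: "?K \<in> sets borel" by simp
  have d: "\<bar>\<psi> x - \<phi> n x\<bar> \<le> B + B'" for n x
    using \<phi>(2)[of n x] B'[of x] by linarith
  have lim0: "(\<lambda>n. \<integral>x. \<bar>\<psi> x - \<phi> n x\<bar> \<partial>lborel) \<longlonglongrightarrow> (\<integral>x. 0 \<partial>(lborel::(real^'d) measure))"
  proof (rule integral_dominated_convergence[where w = "\<lambda>x. (B + B') * indicat_real ?K x"])
    show "integrable lborel (\<lambda>x. (B + B') * indicat_real ?K x)"
      using emeasure_compact_finite[OF K(1)] Ks
      by (intro integrable_mult_right integrable_real_indicator) auto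
    show "AE x in lborel. (\<lambda>n. \<bar>\<psi> x - \<phi> n x\<bar>) \<longlonglongrightarrow> 0"
    proof (intro always_eventually allI)
      fix x
      have "(\<lambda>n. \<bar>\<psi> x - \<phi> n x\<bar>) \<longlonglongrightarrow> \<bar>\<psi> x - \<psi> x\<bar>" by (intro tendsto_intros \<phi>(4))
      then show "(\<lambda>n. \<bar>\<psi> x - \<phi> n x\<bar>) \<longlonglongrightarrow> 0" by simp
    qed
    show "AE x in lborel. norm \<bar>\<psi> x - \<phi> n x\<bar> \<le> (B + B') * indicat_real ?K x" for n
    proof (intro always_eventually allI)
      fix x show "norm \<bar>\<psi> x - \<phi> n x\<bar> \<le> (B + B') * indicat_real ?K x"
        using d[of x n] z[of x n] z'[of x] by (cases "x \<in> ?K") auto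
    qed
  qed measurable
  show ?thesis
  proof (rule LIMSEQ_I)
    fix e :: real assume e: "e > 0"
    \<comment> \<open>Two replacement errors of size L e' have to fit into e / 2; the summand 1
      keeps the denominator positive when L = 0.\<close>
    define e' where "e' = (e / 2) / (2 * L + 1)"
    have e': "e' > 0" using e L_nonneg by (simp add: e'_def)
    have "\<forall>\<^sub>F m in sequentially. (\<integral>x. \<bar>\<psi> x - \<phi> m x\<bar> \<partial>lborel) < e'"
      using order_tendstoD(2)[OF lim0, of e'] e' by simp
    from eventually_happens'[OF sequentially_bot this]
    obtain m where m: "(\<integral>x. \<bar>\<psi> x - \<phi> m x\<bar> \<partial>lborel) < e'" by blast
    have ig: "integrable lborel (\<lambda>x. g x $ k * \<psi> x)" "integrable lborel (\<lambda>x. g x $ k * \<phi> m x)"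
      by (rule g_times_integrable[OF K _ B' z'], measurable)
        (rule g_times_integrable[OF K _ \<phi>(2) z], measurable)
    have "continuous_on UNIV (\<lambda>x. \<psi> x - \<phi> m x)"
      using \<phi>(1) by (intro continuous_intros cont smooth_fun_continuous) (simp add: test_fun_def)
    moreover have sub: "closure {x. \<psi> x - \<phi> m x \<noteq> 0} \<subseteq> ?K"
    proof (rule closure_mono, rule subsetI)
      fix x assume "x \<in> {x. \<psi> x - \<phi> m x \<noteq> 0}"
      then show "x \<in> {x. \<psi> x \<noteq> 0}" using \<phi>(3)[of x m] by (cases "\<psi> x = 0") simp_all
    qed
    moreover from this have "compact (closure {x. \<psi> x - \<phi> m x \<noteq> 0})"
      using compact_Int_closed[OF K(1) closed_closure[of "{x. \<psi> x - \<phi> m x \<noteq> 0}"]]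
      by (simp only: Int_absorb1)
    ultimately have "\<bar>\<integral>x. g x $ k * (\<psi> x - \<phi> m x) \<partial>lborel\<bar> \<le> L * (\<integral>x. \<bar>\<psi> x - \<phi> m x\<bar> \<partial>lborel)"
      by - (intro continuous_pairing_bound subset_trans[OF sub K(2)]; assumption)
    then have g1: "\<bar>(\<integral>x. g x $ k * \<psi> x \<partial>lborel) - (\<integral>x. g x $ k * \<phi> m x \<partial>lborel)\<bar>
        \<le> L * (\<integral>x. \<bar>\<psi> x - \<phi> m x\<bar> \<partial>lborel)"
      using ig by (simp add: right_diff_distrib)
    have "\<forall>\<^sub>F n in sequentially.
        \<bar>(\<integral>x. diff_quot k n f_ext x * \<phi> m x \<partial>lborel) - (\<integral>x. g x $ k * \<phi> m x \<partial>lborel)\<bar> < e / 2"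
      using tendstoD[OF diff_quot_test[OF \<phi>(1)[of m], of k], of "e / 2"] e by (simp add: dist_real_def)
    then have "\<forall>\<^sub>F n in sequentially.
        \<bar>(\<integral>x. diff_quot k n f_ext x * \<psi> x \<partial>lborel) - (\<integral>x. g x $ k * \<psi> x \<partial>lborel)\<bar> < e"
      using diff_quot_bounded[OF K, of k]
    proof eventually_elim
      case (elim n)
      have n: "\<bar>diff_quot k n f_ext x\<bar> \<le> L" if "x \<in> ?K" for x
        using bspec[OF elim(2) that] by (rule conjunct2)
      have i1: "integrable lborel (\<lambda>x. diff_quot k n f_ext x * \<psi> x)"
        by (rule diff_quot_pairing_bound(1)[OF K(1) _ B' z' n]) measurable
      have i2: "integrable lborel (\<lambda>x. diff_quot k n f_ext x * \<phi> m x)"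
        by (rule diff_quot_pairing_bound(1)[OF K(1) _ \<phi>(2) z n]) measurable
      have "\<bar>\<integral>x. diff_quot k n f_ext x * (\<psi> x - \<phi> m x) \<partial>lborel\<bar> \<le> L * (\<integral>x. \<bar>\<psi> x - \<phi> m x\<bar> \<partial>lborel)"
      proof (rule diff_quot_pairing_bound(2)[OF K(1) _ d _ n])
        show "(\<lambda>x. \<psi> x - \<phi> m x) \<in> borel_measurable borel" by measurable
        show "\<psi> x - \<phi> m x = 0" if "x \<notin> ?K" for x
          using z[OF that, of m] z'[OF that] by simp
      qed
      then have d1: "\<bar>(\<integral>x. diff_quot k n f_ext x * \<psi> x \<partial>lborel) - (\<integral>x. diff_quot k n f_ext x * \<phi> m x \<partial>lborel)\<bar>
          \<le> L * (\<integral>x. \<bar>\<psi> x - \<phi> m x\<bar> \<partial>lborel)"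
        using i1 i2 by (simp add: right_diff_distrib)
      have "L * (\<integral>x. \<bar>\<psi> x - \<phi> m x\<bar> \<partial>lborel) \<le> L * e'"
        using m L_nonneg by (intro mult_left_mono) auto
      moreover have "2 * (L * e') \<le> e / 2"
      proof -
        have "2 * (L * e') \<le> (2 * L + 1) * e'" using e' by (simp add: algebra_simps)
        also have "\<dots> = e / 2"
        proof -
          have cancel: "a * (e / 2 / a) = e / 2" if "a \<noteq> 0" for a :: real
            using that by simp
          have "2 * L + 1 \<noteq> 0" using L_nonneg by linarith
          from cancel[OF this] show ?thesis unfolding e'_def .
        qed
        finally show ?thesis .
      qed
      ultimately show ?case using d1 g1 elim(1) by linarith
    qed
    then show "\<exists>no. \<forall>n\<ge>no. norm ((\<integral>x. diff_quot k n f_ext x * \<psi> x \<partial>lborel) - (\<integral>x. g x $ k * \<psi> x \<partial>lborel)) < e"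
      unfolding eventually_sequentially real_norm_def .
  qed
qed

text \<open>Continuity is checked on two open sets that cover the space: on U the extension agrees
  with f, and off the support of \<phi> the product is 0. The boundary of U lies in the second
  set.\<close>

lemma f_ext_times_test_continuous:
  assumes \<phi>: "test_fun U \<phi>" shows "continuous_on UNIV (\<lambda>x. f_ext x * \<phi> x)"
proof -
  let ?K = "closure {x. \<phi> x \<noteq> 0}"
  have "continuous_on U f_ext"
    using lipschitz_on_continuous_on[OF lip] by (rule continuous_on_cong[THEN iffD1, rotated -1]) (auto simp: f_ext_def)
  moreover have "continuous_on U \<phi>"
    using \<phi> by (intro smooth_fun_continuous) (simp add: test_fun_def)
  ultimately have "continuous_on U (\<lambda>x. f_ext x * \<phi> x)"
    by (rule continuous_on_mult)
  moreover have "continuous_on (- ?K) (\<lambda>x. f_ext x * \<phi> x)"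
  proof (rule continuous_on_cong[THEN iffD1, OF refl _ continuous_on_const[of _ 0]])
    fix x assume "x \<in> - ?K"
    then show "0 = f_ext x * \<phi> x" using test_fun_outside[OF \<phi>, of x] by simp
  qed
  ultimately have "continuous_on (U \<union> - ?K) (\<lambda>x. f_ext x * \<phi> x)"
    by (intro continuous_on_open_Un openU) auto
  moreover have "U \<union> - ?K = UNIV" using \<phi> by (auto simp: test_fun_def)
  ultimately show ?thesis by simp
qed

text \<open>One of the two factors is absorbed into the multiplier, where it is again at most L on
  K; the linear pairing bound then yields L^2.\<close>

lemma diff_quot_square_pairing:
  assumes K: "compact K" and [measurable]: "\<phi> \<in> borel_measurable borel"
    and B: "\<And>x. \<bar>\<phi> x\<bar> \<le> B" and z: "\<And>x. x \<notin> K \<Longrightarrow> \<phi> x = 0"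
    and n: "\<And>x. x \<in> K \<Longrightarrow> \<bar>diff_quot k n f_ext x\<bar> \<le> L"
  shows "integrable lborel (\<lambda>x. (diff_quot k n f_ext x)\<^sup>2 * \<phi> x)"
    "\<bar>\<integral>x. (diff_quot k n f_ext x)\<^sup>2 * \<phi> x \<partial>lborel\<bar> \<le> L\<^sup>2 * (\<integral>x. \<bar>\<phi> x\<bar> \<partial>lborel)"
proof -
  have bd: "\<bar>diff_quot k n f_ext x * \<phi> x\<bar> \<le> L * B" for x
  proof (cases "x \<in> K")
    case True
    then show ?thesis unfolding abs_mult by (intro mult_mono n B L_nonneg) auto
  next
    case False
    then show ?thesis using B[of x] L_nonneg z[OF False] by simp
  qed
  have z': "diff_quot k n f_ext x * \<phi> x = 0" if "x \<notin> K" for x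
    using z[OF that] by simp
  have meas: "(\<lambda>x. diff_quot k n f_ext x * \<phi> x) \<in> borel_measurable borel" by measurable
  have eq: "diff_quot k n f_ext x * (diff_quot k n f_ext x * \<phi> x) = (diff_quot k n f_ext x)\<^sup>2 * \<phi> x" for x
    by (simp add: power2_eq_square)
  note sq = diff_quot_pairing_bound[OF K meas bd z' n, unfolded eq]
  show "integrable lborel (\<lambda>x. (diff_quot k n f_ext x)\<^sup>2 * \<phi> x)" by (rule sq(1))
  have i\<phi>: "integrable lborel (\<lambda>x. L * \<bar>\<phi> x\<bar>)"
    by (intro integrable_mult_right integrable_abs compact_support_integrable[OF K assms(2) B z])
  have iq: "integrable lborel (\<lambda>x. \<bar>diff_quot k n f_ext x * \<phi> x\<bar>)"
    by (intro integrable_abs diff_quot_pairing_bound(1)[OF K assms(2) B z n])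
  have le: "\<bar>diff_quot k n f_ext x * \<phi> x\<bar> \<le> L * \<bar>\<phi> x\<bar>" for x
    using n[of x] z[of x] by (cases "x \<in> K") (auto simp: abs_mult intro: mult_right_mono)
  have "(\<integral>x. \<bar>diff_quot k n f_ext x * \<phi> x\<bar> \<partial>lborel) \<le> (\<integral>x. L * \<bar>\<phi> x\<bar> \<partial>lborel)"
    by (rule integral_mono[OF iq i\<phi> le])
  then have "L * (\<integral>x. \<bar>diff_quot k n f_ext x * \<phi> x\<bar> \<partial>lborel) \<le> L * (L * (\<integral>x. \<bar>\<phi> x\<bar> \<partial>lborel))"
    using L_nonneg by (intro mult_left_mono) simp_all
  with sq(2) show "\<bar>\<integral>x. (diff_quot k n f_ext x)\<^sup>2 * \<phi> x \<partial>lborel\<bar> \<le> L\<^sup>2 * (\<integral>x. \<bar>\<phi> x\<bar> \<partial>lborel)"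
    unfolding power2_eq_square[of L] mult.assoc[symmetric] by linarith
qed

text \<open>Write D_n for the difference quotient with step h = 1 / (n + 1). Then D_n(f^2) = 2 f D_n
  f - h (D_n f)^2. Paired with \<phi>, the first term converges because 2 f \<phi> is continuous
  with compact support in U, and the second is at most h L^2 times the L^1 norm of \<phi>. The left
  side converges by discrete integration by parts.\<close>

lemma square_weak_identity:
  assumes \<phi>: "test_fun U \<phi>"
  shows "(\<integral>x. (f_ext x)\<^sup>2 * partial_deriv \<phi> k x \<partial>lborel) = - (\<integral>x. g x $ k * (2 * f_ext x * \<phi> x) \<partial>lborel)"
proof -
  let ?K = "closure {x. \<phi> x \<noteq> 0}"
  have K: "compact ?K" "?K \<subseteq> U" using \<phi> by (auto simp: test_fun_def)
  have [measurable]: "\<phi> \<in> borel_measurable borel" using \<phi> by (rule test_fun_borel)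
  define \<psi> where "\<psi> x = 2 * f_ext x * \<phi> x" for x
  have c\<psi>: "continuous_on UNIV \<psi>"
    using continuous_on_mult[OF continuous_on_const[of _ 2] f_ext_times_test_continuous[OF \<phi>]]
    by (simp add: \<psi>_def[abs_def] mult.assoc)
  have [measurable]: "\<psi> \<in> borel_measurable borel" unfolding \<psi>_def[abs_def] by measurable
  have z: "\<phi> x = 0" if "x \<notin> ?K" for x using test_fun_outside[OF \<phi> that] .
  have sub: "closure {x. \<psi> x \<noteq> 0} \<subseteq> ?K"
    by (intro closure_mono) (auto simp: \<psi>_def)
  have c: "compact (closure {x. \<psi> x \<noteq> 0})"
    using compact_Int_closed[OF K(1) closed_closure[of "{x. \<psi> x \<noteq> 0}"]] sub
    by (simp only: Int_absorb1)
  have z\<psi>: "\<psi> x = 0" if "x \<notin> ?K" for x using z[OF that] by (simp add: \<psi>_def)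
  obtain B where B: "\<And>x. \<bar>\<phi> x\<bar> \<le> B" using test_fun_bounded[OF \<phi>] by blast
  obtain B' where B': "\<And>x. \<bar>\<psi> x\<bar> \<le> B'" using compact_support_bounded[OF c\<psi> c] by blast
  have bnd2: "\<exists>M. \<forall>x\<in>cball 0 R. \<bar>(f_ext x)\<^sup>2\<bar> \<le> M" for R
  proof -
    obtain M where "\<And>x. x \<in> cball 0 R \<Longrightarrow> \<bar>f_ext x\<bar> \<le> M" using f_ext_locally_bounded by blast
    then have "\<bar>(f_ext x)\<^sup>2\<bar> \<le> M\<^sup>2" if "x \<in> cball 0 R" for x
      using power_mono[of "\<bar>f_ext x\<bar>" M 2] that by (simp del: mem_cball)
    then show ?thesis by (intro exI[of _ "M\<^sup>2"] ballI)
  qed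
  have expand: "diff_quot k n (\<lambda>x. (f_ext x)\<^sup>2) x * \<phi> x =
      diff_quot k n f_ext x * \<psi> x - (1 / real (Suc n)) * ((diff_quot k n f_ext x)\<^sup>2 * \<phi> x)" for n x
  proof -
    define y where "y = f_ext (x - (1 / real (Suc n)) *\<^sub>R axis k 1)"
    have "real (Suc n) * ((f_ext x)\<^sup>2 - y\<^sup>2) * \<phi> x = real (Suc n) * (f_ext x - y) * (2 * f_ext x * \<phi> x)
        - (1 / real (Suc n)) * ((real (Suc n) * (f_ext x - y))\<^sup>2 * \<phi> x)"
    proof -
      have "(1 / N) * ((N * (f_ext x - y))\<^sup>2 * \<phi> x) = N * (f_ext x - y)\<^sup>2 * \<phi> x" if "N \<noteq> 0" for N
        using that by (simp add: power2_eq_square)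
      moreover have "N * ((f_ext x)\<^sup>2 - y\<^sup>2) * \<phi> x = N * (f_ext x - y) * (2 * f_ext x * \<phi> x) - N * (f_ext x - y)\<^sup>2 * \<phi> x" for N
        by (simp add: power2_eq_square algebra_simps)
      ultimately show ?thesis by (simp del: of_nat_Suc)
    qed
    then show ?thesis unfolding y_def diff_quot_def \<psi>_def .
  qed
  let ?C = "L\<^sup>2 * (\<integral>x. \<bar>\<phi> x\<bar> \<partial>lborel)"
  have err: "(\<lambda>n. (1 / real (Suc n)) * (\<integral>x. (diff_quot k n f_ext x)\<^sup>2 * \<phi> x \<partial>lborel)) \<longlonglongrightarrow> 0"
  proof (rule Lim_null_comparison[where g = "\<lambda>n. (1 / real (Suc n)) * ?C"])
    show "\<forall>\<^sub>F n in sequentially. norm ((1 / real (Suc n)) * (\<integral>x. (diff_quot k n f_ext x)\<^sup>2 * \<phi> x \<partial>lborel))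
        \<le> (1 / real (Suc n)) * ?C"
      using diff_quot_bounded[OF K, of k]
    proof eventually_elim
      case (elim n)
      have n: "\<bar>diff_quot k n f_ext x\<bar> \<le> L" if "x \<in> ?K" for x
        using bspec[OF elim that] by (rule conjunct2)
      have "(1 / real (Suc n)) * \<bar>\<integral>x. (diff_quot k n f_ext x)\<^sup>2 * \<phi> x \<partial>lborel\<bar> \<le> (1 / real (Suc n)) * ?C"
        using diff_quot_square_pairing(2)[OF K(1) _ B z n] by (intro mult_left_mono) simp_all
      then show ?case by (simp add: abs_mult del: of_nat_Suc)
    qed
    have "(\<lambda>n. (1 / real (Suc n)) * ?C) \<longlonglongrightarrow> 0 * ?C"
      by (rule tendsto_mult[OF LIMSEQ_Suc[OF lim_1_over_n] tendsto_const])
    then show "(\<lambda>n. (1 / real (Suc n)) * ?C) \<longlonglongrightarrow> 0" by (simp del: of_nat_Suc)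
  qed
  have split: "\<forall>\<^sub>F n in sequentially. (\<integral>x. diff_quot k n f_ext x * \<psi> x \<partial>lborel) -
      (1 / real (Suc n)) * (\<integral>x. (diff_quot k n f_ext x)\<^sup>2 * \<phi> x \<partial>lborel) =
      (\<integral>x. diff_quot k n (\<lambda>x. (f_ext x)\<^sup>2) x * \<phi> x \<partial>lborel)"
    using diff_quot_bounded[OF K, of k]
  proof eventually_elim
    case (elim n)
    have n: "\<bar>diff_quot k n f_ext x\<bar> \<le> L" if "x \<in> ?K" for x
      using bspec[OF elim that] by (rule conjunct2)
    have i1: "integrable lborel (\<lambda>x. diff_quot k n f_ext x * \<psi> x)"
      by (rule diff_quot_pairing_bound(1)[OF K(1) _ B' z\<psi> n]) measurable
    have i2: "integrable lborel (\<lambda>x. (1 / real (Suc n)) * ((diff_quot k n f_ext x)\<^sup>2 * \<phi> x))"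
      by (rule integrable_mult_right, rule diff_quot_square_pairing(1)[OF K(1) _ B z n]) measurable
    show ?case
      unfolding expand Bochner_Integration.integral_diff[OF i1 i2] integral_mult_right_zero ..
  qed
  have "(\<lambda>n. (\<integral>x. diff_quot k n f_ext x * \<psi> x \<partial>lborel) -
      (1 / real (Suc n)) * (\<integral>x. (diff_quot k n f_ext x)\<^sup>2 * \<phi> x \<partial>lborel)) \<longlonglongrightarrow> (\<integral>x. g x $ k * \<psi> x \<partial>lborel) - 0"
    by (intro tendsto_diff err diff_quot_continuous[OF c\<psi> c subset_trans[OF sub K(2)]])
  then have "(\<lambda>n. \<integral>x. diff_quot k n (\<lambda>x. (f_ext x)\<^sup>2) x * \<phi> x \<partial>lborel) \<longlonglongrightarrow> (\<integral>x. g x $ k * \<psi> x \<partial>lborel) - 0"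
    by (rule Lim_transform_eventually[OF _ split])
  moreover have "(\<lambda>n. \<integral>x. diff_quot k n (\<lambda>x. (f_ext x)\<^sup>2) x * \<phi> x \<partial>lborel) \<longlonglongrightarrow>
      - (\<integral>x. (f_ext x)\<^sup>2 * partial_deriv \<phi> k x \<partial>lborel)"
    by (rule diff_quot_test_tendsto[OF _ bnd2 \<phi>]) measurable
  ultimately have "(\<integral>x. g x $ k * \<psi> x \<partial>lborel) - 0 = - (\<integral>x. (f_ext x)\<^sup>2 * partial_deriv \<phi> k x \<partial>lborel)"
    by (rule LIMSEQ_unique)
  then show ?thesis unfolding \<psi>_def by simp
qed

lemma square_weak_gradient: "weak_gradient_on U (\<lambda>x. (f x)\<^sup>2) (\<lambda>x. (2 * f x) *\<^sub>R g x)"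
  unfolding weak_gradient_on_def locally_integrable_on_def
proof (intro conjI allI impI; (elim conjE)?)
  fix K assume K: "compact K" "K \<subseteq> U"
  have cf: "continuous_on K f"
    using lipschitz_on_continuous_on[OF lip] K(2) by (rule continuous_on_subset)
  show "set_integrable lborel K (\<lambda>x. (f x)\<^sup>2)"
    unfolding set_integrable_def by (intro borel_integrable_compact K continuous_intros cf)
  fix k
  obtain R where R: "K \<subseteq> cball 0 R"
    using compact_imp_bounded[OF K(1)] unfolding bounded_iff by (auto simp: subset_eq)
  obtain M where M: "\<And>x. x \<in> cball 0 R \<Longrightarrow> \<bar>f_ext x\<bar> \<le> M" using f_ext_locally_bounded by blast
  have "K \<in> sets borel" by (intro borel_closed compact_imp_closed K)
  have "integrable lborel (\<lambda>x. g x $ k * (indicat_real K x * (2 * f_ext x)))"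
  proof (rule g_times_integrable[OF K, where B = "2 * \<bar>M\<bar>"])
    show "(\<lambda>x. indicat_real K x * (2 * f_ext x)) \<in> borel_measurable borel"
      using f_ext_borel \<open>K \<in> sets borel\<close>
      by (intro borel_measurable_times borel_measurable_indicator borel_measurable_const)
    show "indicat_real K x * (2 * f_ext x) = 0" if "x \<notin> K" for x using that by simp
    fix x show "\<bar>indicat_real K x * (2 * f_ext x)\<bar> \<le> 2 * \<bar>M\<bar>"
      using M[of x] R by (cases "x \<in> K") (auto simp: abs_mult)
  qed
  moreover have "g x $ k * (indicat_real K x * (2 * f_ext x)) = indicat_real K x *\<^sub>R (((2 * f x) *\<^sub>R g x) $ k)" for x
    using K(2) by (cases "x \<in> K") (auto simp: f_ext_def)
  ultimately show "set_integrable lborel K (\<lambda>x. ((2 * f x) *\<^sub>R g x) $ k)"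
    unfolding set_integrable_def by simp
next
  fix \<phi> k assume \<phi>: "test_fun U \<phi>"
  have "(LINT x:U|lborel. (f x)\<^sup>2 * partial_deriv \<phi> k x) = (\<integral>x. (f_ext x)\<^sup>2 * partial_deriv \<phi> k x \<partial>lborel)"
    unfolding set_lebesgue_integral_def
    by (intro Bochner_Integration.integral_cong) (auto simp: f_ext_def indicator_def)
  moreover have "(LINT x:U|lborel. ((2 * f x) *\<^sub>R g x) $ k * \<phi> x) = (\<integral>x. g x $ k * (2 * f_ext x * \<phi> x) \<partial>lborel)"
    unfolding set_lebesgue_integral_def
    by (intro Bochner_Integration.integral_cong) (auto simp: f_ext_def indicator_def)
  ultimately show "(LINT x:U|lborel. (f x)\<^sup>2 * partial_deriv \<phi> k x) =
      - (LINT x:U|lborel. ((2 * f x) *\<^sub>R g x) $ k * \<phi> x)"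
    using square_weak_identity[OF \<phi>] by simp
qed

end

lemma borel_measurable_vec_nth [measurable]:
  fixes f :: "'a \<Rightarrow> 'b::euclidean_space^'n"
  assumes "f \<in> borel_measurable M" shows "(\<lambda>x. f x $ i) \<in> borel_measurable M"
  by (rule measurable_compose[OF assms borel_measurable_continuous_onI])
    (rule linear_continuous_on[OF bounded_linear_vec_nth])

section \<open>Calculus of weak gradients\<close>

lemma locally_integrable_times_test:
  assumes f: "locally_integrable_on U f" and \<phi>: "test_fun U \<phi>"
  shows "set_integrable lborel U (\<lambda>x. f x * \<phi> x)"
proof -
  let ?K = "closure {x. \<phi> x \<noteq> 0}"
  have K: "compact ?K" "?K \<subseteq> U" using \<phi> by (auto simp: test_fun_def)
  obtain B where B: "\<And>x. \<bar>\<phi> x\<bar> \<le> B" using test_fun_bounded[OF \<phi>] by blast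
  have [measurable]: "\<phi> \<in> borel_measurable borel" using \<phi> by (rule test_fun_borel)
  have i: "integrable lborel (\<lambda>x. indicat_real ?K x * f x)"
    using f K by (simp add: locally_integrable_on_def set_integrable_def)
  have [measurable]: "(\<lambda>x. indicat_real ?K x * f x) \<in> borel_measurable borel"
    using borel_measurable_integrable[OF i] by simp
  have "integrable lborel (\<lambda>x. indicat_real ?K x * f x * \<phi> x)"
  proof (rule Bochner_Integration.integrable_bound)
    show "integrable lborel (\<lambda>x. B * (indicat_real ?K x * f x))"
      by (rule integrable_mult_right[OF i])
    show "(\<lambda>x. indicat_real ?K x * f x * \<phi> x) \<in> borel_measurable lborel"
      by measurable
    show "AE x in lborel. norm (indicat_real ?K x * f x * \<phi> x) \<le> norm (B * (indicat_real ?K x * f x))"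
    proof (intro always_eventually allI)
      fix x
      have "\<bar>indicat_real ?K x * f x\<bar> * \<bar>\<phi> x\<bar> \<le> \<bar>indicat_real ?K x * f x\<bar> * \<bar>B\<bar>"
        using B[of x] by (intro mult_left_mono) auto
      then show "norm (indicat_real ?K x * f x * \<phi> x) \<le> norm (B * (indicat_real ?K x * f x))"
        by (simp add: abs_mult mult.commute)
    qed
  qed
  moreover have "indicat_real ?K x * f x * \<phi> x = indicat_real U x *\<^sub>R (f x * \<phi> x)" for x
    using K(2) test_fun_outside[OF \<phi>, of x] by (cases "x \<in> ?K") auto
  ultimately show ?thesis
    unfolding set_integrable_def by simp
qed

lemma weak_gradient_on_add:
  assumes "weak_gradient_on U f g" "weak_gradient_on U f' g'"
  shows "weak_gradient_on U (\<lambda>x. f x + f' x) (\<lambda>x. g x + g' x)"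
  unfolding weak_gradient_on_def
proof (intro conjI allI impI)
  show "locally_integrable_on U (\<lambda>x. f x + f' x)"
    using assms by (auto simp: weak_gradient_on_def locally_integrable_on_def intro!: set_integral_add)
  show "locally_integrable_on U (\<lambda>x. (g x + g' x) $ k)" for k
    using assms by (auto simp: weak_gradient_on_def locally_integrable_on_def intro!: set_integral_add)
  fix \<phi> k assume \<phi>: "test_fun U \<phi>"
  note int = locally_integrable_times_test[OF _ test_fun_partial_deriv[OF \<phi>]]
    locally_integrable_times_test[OF _ \<phi>]
  have "(LINT x:U|lborel. (f x + f' x) * partial_deriv \<phi> k x) =
      (LINT x:U|lborel. f x * partial_deriv \<phi> k x) + (LINT x:U|lborel. f' x * partial_deriv \<phi> k x)"
    unfolding distrib_right using assms by (intro set_integral_add(2) int) (auto simp: weak_gradient_on_def)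
  moreover have "(LINT x:U|lborel. (g x + g' x) $ k * \<phi> x) =
      (LINT x:U|lborel. g x $ k * \<phi> x) + (LINT x:U|lborel. g' x $ k * \<phi> x)"
    unfolding vector_add_component distrib_right
    using assms by (intro set_integral_add(2) int) (auto simp: weak_gradient_on_def)
  ultimately show "(LINT x:U|lborel. (f x + f' x) * partial_deriv \<phi> k x) =
      - (LINT x:U|lborel. (g x + g' x) $ k * \<phi> x)"
    using assms \<phi> by (simp add: weak_gradient_on_def)
qed

lemma weak_gradient_on_scaleR:
  assumes "weak_gradient_on U f g"
  shows "weak_gradient_on U (\<lambda>x. c * f x) (\<lambda>x. c *\<^sub>R g x)"
  using assms
  by (auto simp: weak_gradient_on_def locally_integrable_on_def mult.assoc)

text \<open>That a partial derivative of a test function integrates to 0 is read off from the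
  difference quotients: those of a constant vanish identically, yet their pairings converge to minus
  the integral in question.\<close>

lemma weak_gradient_on_const: "weak_gradient_on (U :: (real^'d) set) (\<lambda>x. c) (\<lambda>x. 0)"
  unfolding weak_gradient_on_def locally_integrable_on_def
proof (intro conjI allI impI; (elim conjE)?)
  fix K :: "(real^'d) set" and k :: 'd
  assume K: "compact K"
  show "set_integrable lborel K (\<lambda>x. c)" "set_integrable lborel K (\<lambda>x. 0 $ k :: real)"
    unfolding set_integrable_def by (intro borel_integrable_compact K continuous_on_const)+
next
  fix \<phi> :: "real^'d \<Rightarrow> real" and k assume \<phi>: "test_fun U \<phi>"
  have "(\<lambda>n. \<integral>x. diff_quot k n (\<lambda>x. c) x * \<phi> x \<partial>lborel) \<longlonglongrightarrow> - (\<integral>x. c * partial_deriv \<phi> k x \<partial>lborel)"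
    by (rule diff_quot_test_tendsto[OF _ _ \<phi>]) auto
  then have "(\<lambda>n. 0 :: real) \<longlonglongrightarrow> - (\<integral>x. c * partial_deriv \<phi> k x \<partial>lborel)"
    by (simp add: diff_quot_def)
  then have "(\<integral>x. c * partial_deriv \<phi> k x \<partial>lborel) = 0"
    using LIMSEQ_unique[OF tendsto_const] by fastforce
  moreover have "(LINT x:U|lborel. c * partial_deriv \<phi> k x) = (\<integral>x. c * partial_deriv \<phi> k x \<partial>lborel)"
    unfolding set_lebesgue_integral_def
  proof (intro Bochner_Integration.integral_cong refl)
    fix x
    have "closure {x. \<phi> x \<noteq> 0} \<subseteq> U" using \<phi> by (simp add: test_fun_def)
    then show "indicat_real U x *\<^sub>R (c * partial_deriv \<phi> k x) = c * partial_deriv \<phi> k x"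
      using partial_deriv_outside_support[of x \<phi> k] by (cases "x \<in> U") auto
  qed
  moreover have "(LINT x:U|lborel. 0 $ k * \<phi> x) = 0"
    by (simp add: set_lebesgue_integral_def)
  ultimately show "(LINT x:U|lborel. c * partial_deriv \<phi> k x) = - (LINT x:U|lborel. 0 $ k * \<phi> x)"
    by linarith
qed

lemma weak_gradient_on_sum:
  assumes "finite I" "\<And>i. i \<in> I \<Longrightarrow> weak_gradient_on U (f i) (g i)"
  shows "weak_gradient_on U (\<lambda>x. \<Sum>i\<in>I. f i x) (\<lambda>x. \<Sum>i\<in>I. g i x)"
  using assms
proof (induction I rule: finite_induct)
  case empty
  then show ?case using weak_gradient_on_const[of U 0] by simp
next
  case (insert i I)
  have "weak_gradient_on U (\<lambda>x. f i x + (\<Sum>i\<in>I. f i x)) (\<lambda>x. g i x + (\<Sum>i\<in>I. g i x))"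
    using insert.prems insert.IH by (intro weak_gradient_on_add) simp_all
  then show ?case using insert.hyps by simp
qed

lemma locally_integrable_on_cong:
  assumes "\<And>x. x \<in> U \<Longrightarrow> f x = f' x" "locally_integrable_on U f"
  shows "locally_integrable_on U f'"
  unfolding locally_integrable_on_def
proof (intro allI impI; elim conjE)
  fix K assume K: "compact K" "K \<subseteq> U"
  have eq: "(\<lambda>x. indicat_real K x *\<^sub>R f x) = (\<lambda>x. indicat_real K x *\<^sub>R f' x)"
    using assms(1) K(2) by (intro ext) (auto simp: indicator_def)
  have "set_integrable lborel K f"
    using assms(2) K unfolding locally_integrable_on_def by simp
  then show "set_integrable lborel K f'"
    unfolding set_integrable_def eq .
qed

text \<open>Only values on U count. This matters for the degrees of freedom, whose integral formula
  is available only for parameters in the open set.\<close>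

lemma weak_gradient_on_cong:
  assumes f: "\<And>x. x \<in> U \<Longrightarrow> f x = f' x" and g: "\<And>x. x \<in> U \<Longrightarrow> g x = g' x"
    and wg: "weak_gradient_on U f g"
  shows "weak_gradient_on U f' g'"
proof -
  have ef: "(\<lambda>x. indicat_real U x *\<^sub>R (f x * a x)) = (\<lambda>x. indicat_real U x *\<^sub>R (f' x * a x))" for a
    by (rule ext) (simp add: f indicator_def)
  have eg: "(\<lambda>x. indicat_real U x *\<^sub>R (g x $ k * a x)) = (\<lambda>x. indicat_real U x *\<^sub>R (g' x $ k * a x))" for a k
    by (rule ext) (simp add: g indicator_def)
  have lf: "locally_integrable_on U f'"
    by (rule locally_integrable_on_cong[OF f]) (use wg in \<open>simp_all add: weak_gradient_on_def\<close>)
  have gk: "g x $ k = g' x $ k" if "x \<in> U" for x k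
    using g[OF that] by simp
  have lg: "locally_integrable_on U (\<lambda>x. g' x $ k)" for k
    by (rule locally_integrable_on_cong[OF gk]) (use wg in \<open>simp_all add: weak_gradient_on_def\<close>)
  have "(LINT x:U|lborel. f' x * partial_deriv \<phi> k x) = - (LINT x:U|lborel. g' x $ k * \<phi> x)"
    if "test_fun U \<phi>" for \<phi> k
  proof -
    have "(LINT x:U|lborel. f x * partial_deriv \<phi> k x) = - (LINT x:U|lborel. g x $ k * \<phi> x)"
      using wg that by (simp add: weak_gradient_on_def)
    then show ?thesis
      unfolding set_lebesgue_integral_def ef eg .
  qed
  then show ?thesis
    using lf lg unfolding weak_gradient_on_def by blast
qed

lemma transpose_matrix_vector_eq_sum:
  fixes J :: "real^'d^'p"
  shows "transpose J *v v = (\<Sum>i\<in>UNIV. (v $ i) *\<^sub>R J $ i)"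
  by (simp add: vec_eq_iff matrix_vector_mult_def transpose_def mult.commute)

lemma weak_gradient_on_inner:
  fixes J :: "real^'d \<Rightarrow> real^'d^'p"
  assumes "weak_jacobian_on U h J"
  shows "weak_gradient_on U (\<lambda>x. v \<bullet> h x) (\<lambda>x. transpose (J x) *v v)"
  unfolding transpose_matrix_vector_eq_sum inner_vec_def inner_real_def
  using assms by (intro weak_gradient_on_sum weak_gradient_on_scaleR) (auto simp: weak_jacobian_on_def)

lemma inner_lipschitz:
  fixes h :: "'a::metric_space \<Rightarrow> real^'p"
  assumes "L-lipschitz_on U h" shows "(norm v * L)-lipschitz_on U (\<lambda>x. v \<bullet> h x)"
proof (rule lipschitz_onI)
  fix x y assume xy: "x \<in> U" "y \<in> U"
  have "dist (v \<bullet> h x) (v \<bullet> h y) = \<bar>v \<bullet> (h x - h y)\<bar>"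
    by (simp add: dist_real_def inner_diff_right)
  also have "\<dots> \<le> norm v * norm (h x - h y)" by (rule Cauchy_Schwarz_ineq2)
  also have "\<dots> \<le> norm v * (L * dist x y)"
    using lipschitz_onD[OF assms xy] by (intro mult_left_mono) (auto simp: dist_norm)
  finally show "dist (v \<bullet> h x) (v \<bullet> h y) \<le> norm v * L * dist x y" by (simp add: mult.assoc)
qed (use lipschitz_on_nonneg[OF assms] in simp)

text \<open>The squared norm is a sum over the rows A_j of squares of the scalar Lipschitz functions
  \<langle>A_j, h - c\<rangle>. The chain rule acts on each row, and the sum of (A u)_j J^T A_j over
  j is J^T A^T A u.\<close>

lemma weak_gradient_on_norm_square:
  fixes J :: "real^'d \<Rightarrow> real^'d^'p" and A :: "real^'p^'m"
  assumes U: "open U" and lip: "L-lipschitz_on U h" and J: "weak_jacobian_on U h J"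
    and [measurable]: "J \<in> borel_measurable borel"
  shows "weak_gradient_on U (\<lambda>x. (norm (A *v (h x - c)))\<^sup>2)
    (\<lambda>x. 2 *\<^sub>R (transpose (J x) *v ((transpose A ** A) *v (h x - c))))"
proof -
  have sq: "weak_gradient_on U (\<lambda>x. ((A *v (h x - c)) $ j)\<^sup>2)
      (\<lambda>x. (2 * (A *v (h x - c)) $ j) *\<^sub>R (transpose (J x) *v (A $ j)))" for j
  proof -
    let ?f = "\<lambda>x. A $ j \<bullet> h x + (- (A $ j \<bullet> c))"
    have eq: "?f x = (A *v (h x - c)) $ j" for x
      by (simp add: matrix_vector_mul_component inner_diff_right)
    have "weak_gradient_on U ?f (\<lambda>x. transpose (J x) *v (A $ j) + 0)"
      by (intro weak_gradient_on_add weak_gradient_on_inner[OF J] weak_gradient_on_const)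
    moreover have "(norm (A $ j) * L)-lipschitz_on U ?f"
      using inner_lipschitz[OF lip, of "A $ j"] by (auto simp: lipschitz_on_def dist_real_def)
    moreover have "(\<lambda>x. transpose (J x) *v (A $ j)) \<in> borel_measurable borel"
      unfolding transpose_matrix_vector_eq_sum by measurable
    ultimately interpret lipschitz_weak_gradient U ?f "\<lambda>x. transpose (J x) *v (A $ j)" "norm (A $ j) * L"
      using U by unfold_locales auto
    show ?thesis using square_weak_gradient unfolding eq .
  qed
  have "weak_gradient_on U (\<lambda>x. \<Sum>j\<in>UNIV. ((A *v (h x - c)) $ j)\<^sup>2)
      (\<lambda>x. \<Sum>j\<in>UNIV. (2 * (A *v (h x - c)) $ j) *\<^sub>R (transpose (J x) *v (A $ j)))"
    by (intro weak_gradient_on_sum sq) simp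
  moreover have "(norm v)\<^sup>2 = (\<Sum>j\<in>UNIV. (v $ j)\<^sup>2)" for v :: "real^'m"
    unfolding power2_norm_eq_inner inner_vec_def by (simp add: power2_eq_square)
  moreover have "2 *\<^sub>R (transpose (J x) *v ((transpose A ** A) *v u)) =
      (\<Sum>j\<in>UNIV. (2 * (A *v u) $ j) *\<^sub>R (transpose (J x) *v (A $ j)))" for x u
    unfolding matrix_vector_mul_assoc[symmetric] transpose_matrix_vector_eq_sum[of A]
    by (simp add: linear_sum[OF matrix_vector_mul_linear] matrix_vector_mult_scaleR scaleR_sum_right)
  ultimately show ?thesis by simp
qed

text \<open>Each component of h inherits the constant L because the canonical basis vectors have
  norm 1; the finitely many exceptional sets, one for each entry, are merged.\<close>

lemma weak_jacobian_bound:
  fixes J :: "real^'d \<Rightarrow> real^'d^'p"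
  assumes U: "open U" and lip: "L-lipschitz_on U h" and J: "weak_jacobian_on U h J"
    and [measurable]: "J \<in> borel_measurable borel"
  shows "AE x in lborel. x \<in> U \<longrightarrow> (\<forall>i k. \<bar>J x $ i $ k\<bar> \<le> L)"
proof -
  have "AE x in lborel. x \<in> U \<longrightarrow> \<bar>J x $ i $ k\<bar> \<le> L" for i k
  proof -
    have "L-lipschitz_on U (\<lambda>x. h x $ i)"
      using inner_lipschitz[OF lip, of "axis i 1"] by (simp add: inner_axis')
    then interpret lipschitz_weak_gradient U "\<lambda>x. h x $ i" "\<lambda>x. J x $ i" L
      using U J by unfold_locales (auto simp: weak_jacobian_on_def)
    show ?thesis by (rule gradient_component_bound)
  qed
  then have "AE x in lborel. \<forall>i\<in>UNIV. \<forall>k\<in>UNIV. x \<in> U \<longrightarrow> \<bar>J x $ i $ k\<bar> \<le> L"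
    by (intro AE_finite_allI) auto
  then show ?thesis by eventually_elim auto
qed

section \<open>Exchanging weak gradient and expectation\<close>

lemma integrable_mult_bounded:
  fixes f g :: "'a \<Rightarrow> real"
  assumes f: "integrable M f" and [measurable]: "g \<in> borel_measurable M" and B: "\<And>x. \<bar>g x\<bar> \<le> B"
  shows "integrable M (\<lambda>x. f x * g x)"
proof (rule Bochner_Integration.integrable_bound)
  show "integrable M (\<lambda>x. f x * B)" using f by simp
  have [measurable]: "f \<in> borel_measurable M" using f by simp
  show "(\<lambda>x. f x * g x) \<in> borel_measurable M" by measurable
  show "AE x in M. norm (f x * g x) \<le> norm (f x * B)"
  proof (intro always_eventually allI)
    fix x
    have "\<bar>f x\<bar> * \<bar>g x\<bar> \<le> \<bar>f x\<bar> * \<bar>B\<bar>" using B[of x] by (intro mult_left_mono) auto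
    then show "norm (f x * g x) \<le> norm (f x * B)" by (simp add: abs_mult)
  qed
qed

text \<open>After multiplication by a test function, Fubini moves the weak derivative under the
  integral over w. Test functions have compact support in U, so integrability on the product is
  asked only over compact K.\<close>

lemma weak_gradient_on_expectation:
  fixes M :: "'w measure" and U :: "(real^'d) set"
  assumes M: "sigma_finite_measure M"
    and wg: "\<And>w. weak_gradient_on U (F w) (G w)"
    and iF: "\<And>K. compact K \<Longrightarrow> K \<subseteq> U \<Longrightarrow> integrable (M \<Otimes>\<^sub>M lborel) (\<lambda>(w, x). indicat_real K x * F w x)"
    and iG: "\<And>K. compact K \<Longrightarrow> K \<subseteq> U \<Longrightarrow> integrable (M \<Otimes>\<^sub>M lborel) (\<lambda>(w, x). indicat_real K x *\<^sub>R G w x)"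
  shows "weak_gradient_on U (\<lambda>x. \<integral>w. F w x \<partial>M) (\<lambda>x. \<integral>w. G w x \<partial>M)"
proof -
  interpret M: sigma_finite_measure M by (rule M)
  interpret P: pair_sigma_finite M "lborel :: (real^'d) measure" ..
  show ?thesis
    unfolding weak_gradient_on_def locally_integrable_on_def set_integrable_def
  proof (intro conjI allI impI; (elim conjE)?)
    fix K and k :: 'd assume K: "compact K" "K \<subseteq> U"
    have "integrable lborel (\<lambda>x. \<integral>w. indicat_real K x * F w x \<partial>M)"
      by (rule P.integrable_snd[OF iF[OF K]])
    then show "integrable lborel (\<lambda>x. indicat_real K x *\<^sub>R (\<integral>w. F w x \<partial>M))" by simp
    have "integrable lborel (\<lambda>x. \<integral>w. indicat_real K x *\<^sub>R G w x \<partial>M)"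
      by (rule P.integrable_snd[OF iG[OF K]])
    then have "integrable lborel (\<lambda>x. indicat_real K x *\<^sub>R (\<integral>w. G w x \<partial>M))" by simp
    from integrable_bounded_linear[OF bounded_linear_vec_nth this]
    show "integrable lborel (\<lambda>x. indicat_real K x *\<^sub>R (\<integral>w. G w x \<partial>M) $ k)" by simp
  next
    fix \<phi> k assume \<phi>: "test_fun U \<phi>"
    let ?K = "closure {x. \<phi> x \<noteq> 0}"
    have K: "compact ?K" "?K \<subseteq> U" using \<phi> by (auto simp: test_fun_def)
    have [measurable]: "\<phi> \<in> borel_measurable borel" "partial_deriv \<phi> k \<in> borel_measurable borel"
      using test_fun_borel[OF \<phi>] test_fun_borel[OF test_fun_partial_deriv[OF \<phi>]] by auto
    obtain B where B: "\<And>x. \<bar>\<phi> x\<bar> \<le> B" using test_fun_bounded[OF \<phi>] by blast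
    obtain B' where B': "\<And>x. \<bar>partial_deriv \<phi> k x\<bar> \<le> B'"
      using test_fun_bounded[OF test_fun_partial_deriv[OF \<phi>]] by blast
    have supp: "indicat_real U x * (c * \<phi> x) = indicat_real ?K x * c * \<phi> x"
      "indicat_real U x * (c * partial_deriv \<phi> k x) = indicat_real ?K x * c * partial_deriv \<phi> k x" for x c
      using K(2) test_fun_outside[OF \<phi>, of x] partial_deriv_outside_support[of x \<phi> k]
      by (cases "x \<in> ?K"; auto)+
    have iFp: "integrable (M \<Otimes>\<^sub>M lborel) (\<lambda>(w, x). indicat_real ?K x * F w x * partial_deriv \<phi> k x)"
    proof -
      have "integrable (M \<Otimes>\<^sub>M lborel) (\<lambda>z. (case z of (w, x) \<Rightarrow> indicat_real ?K x * F w x) * partial_deriv \<phi> k (snd z))"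
        by (rule integrable_mult_bounded[OF iF[OF K] _ B']) measurable
      then show ?thesis by (simp add: case_prod_beta')
    qed
    have iGk: "integrable (M \<Otimes>\<^sub>M lborel) (\<lambda>(w, x). indicat_real ?K x * (G w x $ k))"
      using integrable_bounded_linear[OF bounded_linear_vec_nth iG[OF K], of k] by (simp add: case_prod_beta')
    have iGp: "integrable (M \<Otimes>\<^sub>M lborel) (\<lambda>(w, x). indicat_real ?K x * (G w x $ k) * \<phi> x)"
    proof -
      have "integrable (M \<Otimes>\<^sub>M lborel) (\<lambda>z. (case z of (w, x) \<Rightarrow> indicat_real ?K x * (G w x $ k)) * \<phi> (snd z))"
        by (rule integrable_mult_bounded[OF iGk _ B]) measurable
      then show ?thesis by (simp add: case_prod_beta')
    qed
    have "(LINT x:U|lborel. (\<integral>w. F w x \<partial>M) * partial_deriv \<phi> k x) =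
        (\<integral>x. (\<integral>w. indicat_real ?K x * F w x * partial_deriv \<phi> k x \<partial>M) \<partial>lborel)"
      unfolding set_lebesgue_integral_def real_scaleR_def supp by simp
    also have "\<dots> = (\<integral>w. (\<integral>x. indicat_real ?K x * F w x * partial_deriv \<phi> k x \<partial>lborel) \<partial>M)"
      by (rule P.Fubini_integral[OF iFp])
    also have "\<dots> = (\<integral>w. (LINT x:U|lborel. F w x * partial_deriv \<phi> k x) \<partial>M)"
      unfolding set_lebesgue_integral_def real_scaleR_def supp ..
    also have "\<dots> = (\<integral>w. - (LINT x:U|lborel. G w x $ k * \<phi> x) \<partial>M)"
    proof (rule arg_cong[of _ _ "integral\<^sup>L M"], rule ext)
      fix w show "(LINT x:U|lborel. F w x * partial_deriv \<phi> k x) = - (LINT x:U|lborel. G w x $ k * \<phi> x)"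
        using wg[of w] \<phi> unfolding weak_gradient_on_def by simp
    qed
    also have "\<dots> = - (\<integral>w. (\<integral>x. indicat_real ?K x * (G w x $ k) * \<phi> x \<partial>lborel) \<partial>M)"
      unfolding set_lebesgue_integral_def real_scaleR_def supp by simp
    also have "(\<integral>w. (\<integral>x. indicat_real ?K x * (G w x $ k) * \<phi> x \<partial>lborel) \<partial>M) =
        (\<integral>x. (\<integral>w. indicat_real ?K x * (G w x $ k) * \<phi> x \<partial>M) \<partial>lborel)"
      by (rule P.Fubini_integral[OF iGp, symmetric])
    \<comment> \<open>Taking a component commutes with the integral over w only where the vector
      integrand is integrable, otherwise the default value 0 could intervene. Fubini guarantees
      integrability for almost every x in the support, hence equality almost everywhere rather than
      everywhere.\<close>
    also have "\<dots> = (\<integral>x. indicat_real ?K x * ((\<integral>w. G w x \<partial>M) $ k) * \<phi> x \<partial>lborel)"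
    proof (rule integral_cong_AE)
      show "(\<lambda>x. \<integral>w. indicat_real ?K x * (G w x $ k) * \<phi> x \<partial>M) \<in> borel_measurable lborel"
        by (rule borel_measurable_integrable[OF P.integrable_snd[OF iGp]])
      have "(\<lambda>x. \<integral>w. indicat_real ?K x *\<^sub>R G w x \<partial>M) \<in> borel_measurable lborel"
        by (rule borel_measurable_integrable[OF P.integrable_snd[OF iG[OF K]]])
      then have "(\<lambda>x. (\<integral>w. indicat_real ?K x *\<^sub>R G w x \<partial>M) $ k * \<phi> x) \<in> borel_measurable lborel"
        by measurable
      then show "(\<lambda>x. indicat_real ?K x * ((\<integral>w. G w x \<partial>M) $ k) * \<phi> x) \<in> borel_measurable lborel"
        by simp
      show "AE x in lborel. (\<integral>w. indicat_real ?K x * (G w x $ k) * \<phi> x \<partial>M) =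
          indicat_real ?K x * ((\<integral>w. G w x \<partial>M) $ k) * \<phi> x"
        using P.AE_integrable_snd[OF iG[OF K]]
      proof eventually_elim
        case (elim x)
        have "(\<integral>w. (indicat_real ?K x *\<^sub>R G w x) $ k \<partial>M) = (\<integral>w. indicat_real ?K x *\<^sub>R G w x \<partial>M) $ k"
          by (rule integral_bounded_linear[OF bounded_linear_vec_nth elim])
        then show ?case by simp
      qed
    qed
    also have "\<dots> = (LINT x:U|lborel. (\<integral>w. G w x \<partial>M) $ k * \<phi> x)"
      unfolding set_lebesgue_integral_def real_scaleR_def supp ..
    finally show "(LINT x:U|lborel. (\<integral>w. F w x \<partial>M) * partial_deriv \<phi> k x) =
        - (LINT x:U|lborel. (\<integral>w. G w x \<partial>M) $ k * \<phi> x)" .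
  qed
qed

section \<open>The Gaussian measure\<close>

definition gauss_density :: "real \<Rightarrow> real^'p \<Rightarrow> real" where
  "gauss_density \<sigma> w = (\<Prod>i\<in>UNIV. normal_density 0 \<sigma> (w $ i))"

lemma gauss_noise_eq: "gauss_noise \<sigma> = density lborel (\<lambda>w. ennreal (gauss_density \<sigma> w))"
  by (simp add: gauss_noise_def gauss_density_def)

lemma gauss_density_borel [measurable]: "gauss_density \<sigma> \<in> borel_measurable borel"
  unfolding gauss_density_def[abs_def] by measurable

lemma gauss_density_nonneg: "0 \<le> gauss_density \<sigma> w"
  unfolding gauss_density_def by (intro prod_nonneg) simp

lemma sets_gauss_noise [measurable_cong]: "sets (gauss_noise \<sigma>) = sets borel"
  by (simp add: gauss_noise_eq)

lemma space_gauss_noise [simp]: "space (gauss_noise \<sigma>) = UNIV"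
  by (simp add: gauss_noise_eq)

lemma borel_measurable_gauss_noise [simp]: "borel_measurable (gauss_noise \<sigma>) = borel_measurable borel"
  by (rule measurable_cong_sets) (simp_all add: sets_gauss_noise)

lemma Basis_real_vec: "(Basis :: (real^'p) set) = range (\<lambda>i. axis i 1)"
  by (auto simp: Basis_vec_def)

lemma prob_space_gauss_noise:
  assumes "\<sigma> > 0" shows "prob_space (gauss_noise \<sigma> :: (real^'p) measure)"
proof
  have inj: "inj (\<lambda>i. axis i (1::real) :: real^'p)"
    by (rule injI) (simp add: axis_eq_axis)
  have prod: "(\<Prod>b\<in>Basis. normal_density 0 \<sigma> (x \<bullet> b)) = gauss_density \<sigma> x" for x :: "real^'p"
    unfolding Basis_real_vec gauss_density_def by (subst prod.reindex[OF inj]) (simp add: inner_axis)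
  have one: "(\<integral>\<^sup>+x. ennreal (normal_density 0 \<sigma> x) \<partial>lborel) = 1"
    using assms by (subst nn_integral_eq_integral) (simp_all add: integral_normal_density)
  have "emeasure (gauss_noise \<sigma> :: (real^'p) measure) (space (gauss_noise \<sigma>)) = (\<integral>\<^sup>+x. ennreal (gauss_density \<sigma> x) \<partial>(lborel :: (real^'p) measure))"
    by (simp add: gauss_noise_eq emeasure_density)
  also have "\<dots> = (\<integral>\<^sup>+x. (\<Prod>b\<in>Basis. ennreal (normal_density 0 \<sigma> (x \<bullet> b))) \<partial>(lborel :: (real^'p) measure))"
    by (simp add: prod[symmetric] prod_ennreal)
  also have "\<dots> = (\<Prod>b\<in>(Basis :: (real^'p) set). \<integral>\<^sup>+x. ennreal (normal_density 0 \<sigma> x) \<partial>lborel)"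
    by (rule nn_integral_lborel_prod) simp_all
  also have "\<dots> = 1" unfolding one by simp
  finally show "emeasure (gauss_noise \<sigma> :: (real^'p) measure) (space (gauss_noise \<sigma>)) = 1" .
qed

text \<open>Lebesgue measure is translation invariant and the Gaussian law has a density with
  respect to it. A null set of data points is therefore a null event for the noise, whatever the
  shift c.\<close>

lemma AE_gauss_noise_translate:
  assumes "AE y in lborel. P y"
  shows "AE w in (gauss_noise \<sigma> :: (real^'p) measure). P (c + w)"
proof -
  have "AE y in distr lborel borel ((+) c). P y"
    unfolding lborel_distr_plus by (rule assms)
  then have "AE w in lborel. P (c + w)"
    by (rule AE_distrD[rotated]) simp
  then show ?thesis
    unfolding gauss_noise_eq by (subst AE_density) auto
qed

section \<open>Translating the Gaussian density; moments\<close>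

text \<open>The Cameron-Martin factor along a coordinate axis: only the i-th factor changes, and (x
  - t)^2 = x^2 - (2 t x - t^2).\<close>

lemma gauss_density_translate:
  assumes "\<sigma> > 0"
  shows "gauss_density \<sigma> (w - t *\<^sub>R axis i 1) = gauss_density \<sigma> w * exp ((2 * t * w $ i - t\<^sup>2) / (2 * \<sigma>\<^sup>2))"
proof -
  have one: "normal_density 0 \<sigma> (x - t) = normal_density 0 \<sigma> x * exp ((2 * t * x - t\<^sup>2) / (2 * \<sigma>\<^sup>2))" for x
  proof -
    have "- ((x - t)\<^sup>2) / (2 * \<sigma>\<^sup>2) = - x\<^sup>2 / (2 * \<sigma>\<^sup>2) + (2 * t * x - t\<^sup>2) / (2 * \<sigma>\<^sup>2)"
      by (simp add: add_divide_distrib[symmetric] power2_eq_square algebra_simps)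
    then show ?thesis
      by (simp only: normal_density_def diff_0_right exp_add mult.assoc)
  qed
  have "gauss_density \<sigma> (w - t *\<^sub>R axis i 1) =
      normal_density 0 \<sigma> (w $ i - t) * (\<Prod>j\<in>UNIV - {i}. normal_density 0 \<sigma> ((w - t *\<^sub>R axis i 1) $ j))"
    unfolding gauss_density_def by (subst prod.remove[of UNIV i]) (auto simp: axis_def)
  also have "(\<Prod>j\<in>UNIV - {i}. normal_density 0 \<sigma> ((w - t *\<^sub>R axis i 1) $ j)) =
      (\<Prod>j\<in>UNIV - {i}. normal_density 0 \<sigma> (w $ j))"
    by (intro prod.cong) (auto simp: axis_def)
  also have "normal_density 0 \<sigma> (w $ i - t) * \<dots> = gauss_density \<sigma> w * exp ((2 * t * w $ i - t\<^sup>2) / (2 * \<sigma>\<^sup>2))"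
    unfolding gauss_density_def one by (subst prod.remove[of UNIV i "\<lambda>j. normal_density 0 \<sigma> (w $ j)"]) auto
  finally show ?thesis .
qed

lemma gauss_integral_eq:
  fixes h :: "real^'p \<Rightarrow> 'b::{banach,second_countable_topology}"
  assumes "h \<in> borel_measurable borel"
  shows "(\<integral>w. h w \<partial>gauss_noise \<sigma>) = (\<integral>w. gauss_density \<sigma> w *\<^sub>R h w \<partial>lborel)"
  unfolding gauss_noise_eq using assms by (intro integral_density) (auto simp: gauss_density_nonneg)

lemma gauss_integrable_iff:
  fixes h :: "real^'p \<Rightarrow> 'b::{banach,second_countable_topology}"
  assumes "h \<in> borel_measurable borel"
  shows "integrable (gauss_noise \<sigma>) h \<longleftrightarrow> integrable lborel (\<lambda>w. gauss_density \<sigma> w *\<^sub>R h w)"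
  unfolding gauss_noise_eq using assms by (intro integrable_density) (auto simp: gauss_density_nonneg)

lemma gauss_integral_translate:
  fixes h :: "real^'p \<Rightarrow> 'b::{banach,second_countable_topology}"
  assumes "\<sigma> > 0" and [measurable]: "h \<in> borel_measurable borel"
  shows "(\<integral>w. h (w + t *\<^sub>R axis i 1) \<partial>gauss_noise \<sigma>) =
    (\<integral>w. exp ((2 * t * w $ i - t\<^sup>2) / (2 * \<sigma>\<^sup>2)) *\<^sub>R h w \<partial>gauss_noise \<sigma>)"
proof -
  let ?k = "\<lambda>w. gauss_density \<sigma> (w - t *\<^sub>R axis i 1) *\<^sub>R h w"
  have "(\<integral>w. h (w + t *\<^sub>R axis i 1) \<partial>gauss_noise \<sigma>) =
      (\<integral>w. gauss_density \<sigma> w *\<^sub>R h (w + t *\<^sub>R axis i 1) \<partial>lborel)"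
    by (rule gauss_integral_eq) measurable
  also have "\<dots> = (\<integral>w. ?k (w + t *\<^sub>R axis i 1) \<partial>lborel)" by simp
  also have "\<dots> = (\<integral>w. ?k w \<partial>lborel)"
    by (rule lborel_integral_translate) measurable
  also have "\<dots> = (\<integral>w. gauss_density \<sigma> w *\<^sub>R (exp ((2 * t * w $ i - t\<^sup>2) / (2 * \<sigma>\<^sup>2)) *\<^sub>R h w) \<partial>lborel)"
    unfolding gauss_density_translate[OF assms(1)] by simp
  also have "\<dots> = (\<integral>w. exp ((2 * t * w $ i - t\<^sup>2) / (2 * \<sigma>\<^sup>2)) *\<^sub>R h w \<partial>gauss_noise \<sigma>)"
    by (rule gauss_integral_eq[symmetric]) measurable
  finally show ?thesis .
qed

text \<open>For the shift t = c \<sigma>^2 the translated density is a positive constant times the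
  density times exp(c w_i), and a translate of an integrable function is integrable. No Gaussian
  integral has to be evaluated.\<close>

lemma gauss_exp_integrable:
  assumes "\<sigma> > 0"
  shows "integrable (gauss_noise \<sigma> :: (real^'p) measure) (\<lambda>w. exp (c * w $ i))"
proof -
  interpret prob_space "gauss_noise \<sigma> :: (real^'p) measure" by (rule prob_space_gauss_noise[OF assms])
  define t where "t = c * \<sigma>\<^sup>2"
  let ?p = "gauss_density \<sigma> :: real^'p \<Rightarrow> real"
  have "integrable lborel (\<lambda>w. ?p w *\<^sub>R (1 :: real))"
    by (subst gauss_integrable_iff[symmetric]) simp_all
  then have p: "integrable lborel ?p" by simp
  have "integrable lborel (\<lambda>w. ?p (- (t *\<^sub>R axis i 1) + w))"
  proof -
    have "integrable (distr lborel borel ((+) (- (t *\<^sub>R axis i 1)))) ?p"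
      unfolding lborel_distr_plus by (rule p)
    then show ?thesis
      by (subst (asm) integrable_distr_eq) auto
  qed
  then have "integrable lborel (\<lambda>w. ?p (w - t *\<^sub>R axis i 1))" by (simp add: add.commute)
  then have "integrable (gauss_noise \<sigma> :: (real^'p) measure) (\<lambda>w. exp ((2 * t * w $ i - t\<^sup>2) / (2 * \<sigma>\<^sup>2)))"
    unfolding gauss_density_translate[OF assms] by (subst gauss_integrable_iff) simp_all
  then have "integrable (gauss_noise \<sigma> :: (real^'p) measure)
      (\<lambda>w. exp (t\<^sup>2 / (2 * \<sigma>\<^sup>2)) * exp ((2 * t * w $ i - t\<^sup>2) / (2 * \<sigma>\<^sup>2)))"
    by (rule integrable_mult_right)
  moreover have "exp (t\<^sup>2 / (2 * \<sigma>\<^sup>2)) * exp ((2 * t * w $ i - t\<^sup>2) / (2 * \<sigma>\<^sup>2)) = exp (c * w $ i)" for w :: "real^'p"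
  proof -
    have "t\<^sup>2 / (2 * \<sigma>\<^sup>2) + (2 * t * w $ i - t\<^sup>2) / (2 * \<sigma>\<^sup>2) = (2 * t * w $ i) / (2 * \<sigma>\<^sup>2)"
      by (simp add: add_divide_distrib[symmetric])
    also have "\<dots> = c * w $ i" using assms by (simp add: t_def)
    finally show ?thesis by (simp add: exp_add[symmetric])
  qed
  ultimately show ?thesis by simp
qed

lemma gauss_exp_abs_integrable:
  assumes "\<sigma> > 0"
  shows "integrable (gauss_noise \<sigma> :: (real^'p) measure) (\<lambda>w. exp (c * \<bar>w $ i\<bar>))"
proof (rule Bochner_Integration.integrable_bound)
  show "integrable (gauss_noise \<sigma> :: (real^'p) measure) (\<lambda>w. exp (c * w $ i) + exp (- c * w $ i))"
    by (intro Bochner_Integration.integrable_add gauss_exp_integrable assms)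
  show "(\<lambda>w :: real^'p. exp (c * \<bar>w $ i\<bar>)) \<in> borel_measurable (gauss_noise \<sigma>)" by simp
  show "AE w in (gauss_noise \<sigma> :: (real^'p) measure). norm (exp (c * \<bar>w $ i\<bar>)) \<le> norm (exp (c * w $ i) + exp (- c * w $ i))"
  proof (intro always_eventually allI)
    fix w :: "real^'p"
    show "norm (exp (c * \<bar>w $ i\<bar>)) \<le> norm (exp (c * w $ i) + exp (- c * w $ i))"
      by (cases "w $ i \<ge> 0") (simp_all add: abs_of_nonneg abs_of_neg)
  qed
qed

lemma gauss_norm_square_integrable:
  assumes "\<sigma> > 0"
  shows "integrable (gauss_noise \<sigma> :: (real^'p) measure) (\<lambda>w. (norm w)\<^sup>2)"
proof -
  have "integrable (gauss_noise \<sigma> :: (real^'p) measure) (\<lambda>w. (w $ i)\<^sup>2)" for i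
  proof (rule Bochner_Integration.integrable_bound)
    show "integrable (gauss_noise \<sigma> :: (real^'p) measure) (\<lambda>w. 2 * exp (1 * \<bar>w $ i\<bar>))"
      by (intro integrable_mult_right gauss_exp_abs_integrable assms)
    show "(\<lambda>w :: real^'p. (w $ i)\<^sup>2) \<in> borel_measurable (gauss_noise \<sigma>)" by simp
    show "AE w in (gauss_noise \<sigma> :: (real^'p) measure). norm ((w $ i)\<^sup>2) \<le> norm (2 * exp (1 * \<bar>w $ i\<bar>))"
    proof (intro always_eventually allI)
      fix w :: "real^'p"
      have "1 + \<bar>w $ i\<bar> + \<bar>w $ i\<bar>\<^sup>2 / 2 \<le> exp \<bar>w $ i\<bar>"
        by (rule exp_lower_Taylor_quadratic) simp
      then have "(w $ i)\<^sup>2 \<le> 2 * exp \<bar>w $ i\<bar>" by simp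
      then show "norm ((w $ i)\<^sup>2) \<le> norm (2 * exp (1 * \<bar>w $ i\<bar>))" by simp
    qed
  qed
  then have "integrable (gauss_noise \<sigma> :: (real^'p) measure) (\<lambda>w. \<Sum>i\<in>UNIV. (w $ i)\<^sup>2)"
    by (rule Bochner_Integration.integrable_sum)
  then show ?thesis
    unfolding power2_norm_eq_inner inner_vec_def by (simp add: power2_eq_square)
qed

lemma gauss_norm_integrable:
  assumes "\<sigma> > 0"
  shows "integrable (gauss_noise \<sigma> :: (real^'p) measure) (\<lambda>w. norm w)"
proof -
  interpret prob_space "gauss_noise \<sigma> :: (real^'p) measure" by (rule prob_space_gauss_noise[OF assms])
  show ?thesis
  proof (rule Bochner_Integration.integrable_bound)
    show "integrable (gauss_noise \<sigma> :: (real^'p) measure) (\<lambda>w. 1 + (norm w)\<^sup>2)"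
      by (intro Bochner_Integration.integrable_add gauss_norm_square_integrable assms) simp
    show "AE w in (gauss_noise \<sigma> :: (real^'p) measure). norm (norm w) \<le> norm (1 + (norm w)\<^sup>2)"
    proof (intro always_eventually allI)
      fix w :: "real^'p"
      have "0 \<le> (norm w - 1)\<^sup>2" by simp
      then have "2 * norm w \<le> 1 + (norm w)\<^sup>2" by (simp add: power2_diff)
      then show "norm (norm w) \<le> norm (1 + (norm w)\<^sup>2)"
        using norm_ge_zero[of w] by (simp del: norm_ge_zero)
    qed
  qed simp
qed

lemma abs_exp_minus_1_le: "\<bar>exp a - 1\<bar> \<le> \<bar>a\<bar> * exp \<bar>a\<bar>" for a :: real
proof (cases "a \<ge> 0")
  case True
  have "(1 - a) * exp a \<le> exp (- a) * exp a"
    using exp_ge_add_one_self[of "- a"] by (intro mult_right_mono) auto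
  then have "exp a - 1 \<le> a * exp a" by (simp add: algebra_simps exp_minus)
  then show ?thesis using True by simp
next
  case False
  have "1 - exp a \<le> - a" using exp_ge_add_one_self[of a] by linarith
  also have "\<dots> \<le> - a * exp (- a)" using False by simp
  finally show ?thesis using False by simp
qed

text \<open>As \<open>j\<close> is only measurable and essentially bounded, its own difference
  quotients need not converge. The translation formula replaces them by (e_t - 1) / t times
  \<open>j\<close>, where e_t is the ratio of densities, smooth in t with derivative w_i /
  \<sigma>^2 at 0. Dominated convergence applies with an exponential of a multiple of the absolute
  value of w_i.\<close>

lemma gauss_translation_derivative:
  fixes j :: "real^'p \<Rightarrow> 'b::{banach,second_countable_topology}"
  assumes \<sigma>: "\<sigma> > 0" and [measurable]: "j \<in> borel_measurable borel"
    and B: "AE y in lborel. norm (j y) \<le> B"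
  shows "((\<lambda>t. (1 / t) *\<^sub>R ((\<integral>w. j (w + t *\<^sub>R axis i 1) \<partial>gauss_noise \<sigma>) - (\<integral>w. j w \<partial>gauss_noise \<sigma>)))
    \<longlongrightarrow> (\<integral>w. (w $ i / \<sigma>\<^sup>2) *\<^sub>R j w \<partial>gauss_noise \<sigma>)) (at_right 0)"
  unfolding tendsto_at_iff_sequentially
proof (intro allI impI)
  let ?M = "gauss_noise \<sigma> :: (real^'p) measure"
  interpret prob_space ?M by (rule prob_space_gauss_noise[OF \<sigma>])
  fix X :: "nat \<Rightarrow> real" assume X: "\<forall>n. X n \<in> {0<..} - {0}" "X \<longlonglongrightarrow> 0"
  have Xp: "X n > 0" for n using X(1) by auto
  obtain C where C: "\<And>n. \<bar>X n\<bar> \<le> C"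
    using Bseq_def[of X] convergent_imp_Bseq[OF convergentI[OF X(2)]] by auto
  have C0: "C > 0" using C[of 0] Xp[of 0] by linarith
  have BM: "AE w in ?M. norm (j w) \<le> B"
    using AE_gauss_noise_translate[OF B, where \<sigma> = \<sigma> and c = 0] by simp
  define e where "e t w = exp ((2 * t * w $ i - t\<^sup>2) / (2 * \<sigma>\<^sup>2))" for t and w :: "real^'p"
  have [measurable]: "e t \<in> borel_measurable borel" for t
    unfolding e_def[abs_def] by measurable
  \<comment> \<open>Let C bound the sequence X and b = (C + \<bar>w_i\<bar>) / \<sigma>^2. The
    exponent a of the density ratio satisfies \<bar>a\<bar> \<le> X n b, so the quotient is at most
    b exp(C b) \<le> exp((1 + C) b). Expanding b gives \<open>D\<close>, which is independent of
    n.\<close>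
  define D where "D w = exp ((1 + C) * C / \<sigma>\<^sup>2) * exp ((1 + C) / \<sigma>\<^sup>2 * \<bar>w $ i\<bar>)" for w :: "real^'p"
  have iD: "integrable ?M D"
    unfolding D_def[abs_def] by (intro integrable_mult_right gauss_exp_abs_integrable \<sigma>)
  have Dpos: "0 \<le> D w" for w by (simp add: D_def)
  have quot: "\<bar>(e (X n) w - 1) / X n\<bar> \<le> D w" for n w
  proof -
    define a where "a = (2 * X n * w $ i - (X n)\<^sup>2) / (2 * \<sigma>\<^sup>2)"
    define b where "b = (C + \<bar>w $ i\<bar>) / \<sigma>\<^sup>2"
    have "\<bar>2 * w $ i - X n\<bar> \<le> 2 * (C + \<bar>w $ i\<bar>)"
      using abs_triangle_ineq4[of "2 * w $ i" "X n"] C[of n] C0 by (simp add: abs_mult)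
    then have "\<bar>2 * w $ i - X n\<bar> / (2 * \<sigma>\<^sup>2) \<le> (2 * (C + \<bar>w $ i\<bar>)) / (2 * \<sigma>\<^sup>2)"
      by (intro divide_right_mono) auto
    also have "\<dots> = b" unfolding b_def by (rule mult_divide_mult_cancel_left) simp
    finally have q: "\<bar>2 * w $ i - X n\<bar> / (2 * \<sigma>\<^sup>2) \<le> b" .
    have "a = X n * ((2 * w $ i - X n) / (2 * \<sigma>\<^sup>2))"
      by (simp add: a_def power2_eq_square algebra_simps)
    then have "\<bar>a\<bar> = X n * (\<bar>2 * w $ i - X n\<bar> / (2 * \<sigma>\<^sup>2))"
      using Xp[of n] by (simp add: abs_mult abs_divide)
    also have "\<dots> \<le> X n * b" using q Xp[of n] by (intro mult_left_mono) auto
    finally have a1: "\<bar>a\<bar> \<le> X n * b" .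
    have b0: "0 \<le> b" using C0 by (simp add: b_def)
    have "X n * b \<le> C * b" using C[of n] b0 by (intro mult_right_mono) auto
    with a1 have a2: "\<bar>a\<bar> \<le> C * b" by linarith
    have "\<bar>e (X n) w - 1\<bar> \<le> \<bar>a\<bar> * exp \<bar>a\<bar>" unfolding e_def a_def by (rule abs_exp_minus_1_le)
    also have "\<dots> \<le> (X n * b) * exp (C * b)"
      using a1 a2 b0 Xp[of n] by (intro mult_mono) auto
    also have "\<dots> \<le> (X n * exp b) * exp (C * b)"
    proof -
      have "b \<le> exp b" using exp_ge_add_one_self[of b] by linarith
      then show ?thesis using Xp[of n] by (intro mult_right_mono mult_left_mono) auto
    qed
    also have "\<dots> = X n * exp ((1 + C) * b)"
      by (simp add: exp_add[symmetric] algebra_simps)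
    also have "exp ((1 + C) * b) = D w"
      unfolding D_def exp_add[symmetric] b_def by (simp add: add_divide_distrib algebra_simps)
    finally show ?thesis using Xp[of n] by (simp add: abs_divide divide_le_eq mult.commute)
  qed
  have lim: "(\<lambda>n. (e (X n) w - 1) / X n) \<longlonglongrightarrow> w $ i / \<sigma>\<^sup>2" for w
  proof -
    have "((\<lambda>t. e t w) has_real_derivative w $ i / \<sigma>\<^sup>2) (at 0)"
      unfolding e_def
      by (rule derivative_eq_intros refl | simp add: \<sigma> less_imp_neq[symmetric] power2_eq_square)+
    then have "((\<lambda>t. (e t w - 1) / t) \<longlongrightarrow> w $ i / \<sigma>\<^sup>2) (at 0)"
      by (simp add: DERIV_def e_def)
    moreover have "filterlim X (at 0) sequentially"
      using X(2) Xp by (simp add: filterlim_at less_imp_neq[symmetric])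
    ultimately show ?thesis by (rule filterlim_compose)
  qed
  have iX: "integrable ?M (\<lambda>w. ((e (X n) w - 1) / X n) *\<^sub>R j w)" for n
  proof (rule Bochner_Integration.integrable_bound)
    show "integrable ?M (\<lambda>w. D w * B)" using iD by simp
    show "AE w in ?M. norm (((e (X n) w - 1) / X n) *\<^sub>R j w) \<le> norm (D w * B)"
      using BM
    proof eventually_elim
      case (elim w)
      have "norm (((e (X n) w - 1) / X n) *\<^sub>R j w) \<le> D w * B"
        unfolding norm_scaleR using quot[of n w] elim Dpos[of w] by (intro mult_mono) auto
      also have "\<dots> \<le> norm (D w * B)" by simp
      finally show ?case .
    qed
  qed simp
  have ij: "integrable ?M j"
  proof (rule Bochner_Integration.integrable_bound)
    show "integrable ?M (\<lambda>w. B)" by simp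
    show "AE w in ?M. norm (j w) \<le> norm B" using BM by eventually_elim simp
  qed simp
  have eq: "(1 / X n) *\<^sub>R ((\<integral>w. j (w + X n *\<^sub>R axis i 1) \<partial>?M) - (\<integral>w. j w \<partial>?M)) =
      (\<integral>w. ((e (X n) w - 1) / X n) *\<^sub>R j w \<partial>?M)" for n
  proof -
    have ie: "integrable ?M (\<lambda>w. e (X n) w *\<^sub>R j w)"
    proof -
      have "integrable ?M (\<lambda>w. X n *\<^sub>R (((e (X n) w - 1) / X n) *\<^sub>R j w) + j w)"
        by (intro Bochner_Integration.integrable_add integrable_scaleR_right iX ij)
      moreover have "X n *\<^sub>R (((e (X n) w - 1) / X n) *\<^sub>R j w) + j w = e (X n) w *\<^sub>R j w" for w
        using Xp[of n] by (simp add: scaleR_left_diff_distrib)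
      ultimately show ?thesis by simp
    qed
    have "(\<integral>w. ((e (X n) w - 1) / X n) *\<^sub>R j w \<partial>?M) = (\<integral>w. (1 / X n) *\<^sub>R (e (X n) w *\<^sub>R j w - j w) \<partial>?M)"
      by (intro Bochner_Integration.integral_cong refl) (simp add: scaleR_left_diff_distrib diff_divide_distrib scaleR_right_diff_distrib)
    also have "\<dots> = (1 / X n) *\<^sub>R ((\<integral>w. e (X n) w *\<^sub>R j w \<partial>?M) - (\<integral>w. j w \<partial>?M))"
      using ie ij by simp
    also have "(\<integral>w. e (X n) w *\<^sub>R j w \<partial>?M) = (\<integral>w. j (w + X n *\<^sub>R axis i 1) \<partial>?M)"
      unfolding e_def by (rule gauss_integral_translate[OF \<sigma>, symmetric]) measurable
    finally show ?thesis by simp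
  qed
  have "(\<lambda>n. \<integral>w. ((e (X n) w - 1) / X n) *\<^sub>R j w \<partial>?M) \<longlonglongrightarrow> (\<integral>w. (w $ i / \<sigma>\<^sup>2) *\<^sub>R j w \<partial>?M)"
  proof (rule integral_dominated_convergence[where w = "\<lambda>w. D w * B"])
    show "integrable ?M (\<lambda>w. D w * B)" using iD by simp
    show "AE w in ?M. (\<lambda>n. ((e (X n) w - 1) / X n) *\<^sub>R j w) \<longlonglongrightarrow> (w $ i / \<sigma>\<^sup>2) *\<^sub>R j w"
      by (intro always_eventually allI tendsto_scaleR lim tendsto_const)
    show "AE w in ?M. norm (((e (X n) w - 1) / X n) *\<^sub>R j w) \<le> D w * B" for n
      using BM
    proof eventually_elim
      case (elim w)
      show ?case
        unfolding norm_scaleR using quot[of n w] elim Dpos[of w] by (intro mult_mono) auto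
    qed
  qed simp_all
  then show "((\<lambda>t. (1 / t) *\<^sub>R ((\<integral>w. j (w + t *\<^sub>R axis i 1) \<partial>?M) - (\<integral>w. j w \<partial>?M))) \<circ> X)
      \<longlonglongrightarrow> (\<integral>w. (w $ i / \<sigma>\<^sup>2) *\<^sub>R j w \<partial>?M)"
    unfolding comp_def eq .
qed

text \<open>The translation derivative of the constant 1: the finite differences are 0, and the
  limit is E[W_i] / \<sigma>^2.\<close>

lemma gauss_mean_zero:
  assumes "\<sigma> > 0"
  shows "(\<integral>w. w $ i \<partial>(gauss_noise \<sigma> :: (real^'p) measure)) = 0"
proof -
  let ?M = "gauss_noise \<sigma> :: (real^'p) measure"
  interpret prob_space ?M by (rule prob_space_gauss_noise[OF assms])
  have "((\<lambda>t :: real. (1 / t) *\<^sub>R ((\<integral>w. 1 \<partial>?M) - (\<integral>w. 1 \<partial>?M)))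
    \<longlongrightarrow> (\<integral>w. (w $ i / \<sigma>\<^sup>2) *\<^sub>R (1::real) \<partial>?M)) (at_right 0)"
    using gauss_translation_derivative[OF assms, of "\<lambda>_. 1 :: real" 1 i] by simp
  then have "((\<lambda>t :: real. 0 :: real) \<longlongrightarrow> (\<integral>w. w $ i / \<sigma>\<^sup>2 \<partial>?M)) (at_right 0)" by simp
  then have "(\<integral>w. w $ i / \<sigma>\<^sup>2 \<partial>?M) = 0"
    by (rule tendsto_unique[OF trivial_limit_at_right_real _ tendsto_const])
  then show ?thesis using assms by simp
qed

lemma gauss_integrable_quadratic:
  fixes h :: "real^'p \<Rightarrow> 'b::{banach,second_countable_topology}"
  assumes \<sigma>: "\<sigma> > 0" and [measurable]: "h \<in> borel_measurable borel"
    and b: "AE w in gauss_noise \<sigma>. norm (h w) \<le> a + b * norm w + c * (norm w)\<^sup>2"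
  shows "integrable (gauss_noise \<sigma>) h"
proof -
  interpret prob_space "gauss_noise \<sigma> :: (real^'p) measure" by (rule prob_space_gauss_noise[OF \<sigma>])
  show ?thesis
  proof (rule Bochner_Integration.integrable_bound)
    show "integrable (gauss_noise \<sigma>) (\<lambda>w :: real^'p. a + b * norm w + c * (norm w)\<^sup>2)"
      by (intro Bochner_Integration.integrable_add integrable_mult_right gauss_norm_integrable
          gauss_norm_square_integrable \<sigma>) simp
    show "AE w in gauss_noise \<sigma>. norm (h w) \<le> norm (a + b * norm w + c * (norm w)\<^sup>2)"
      using b by eventually_elim simp
  qed simp
qed

text \<open>The majorant factorises and K has finite measure, so integrability over noise and
  parameter together is reduced to a moment of the noise alone.\<close>

lemma integrable_pair_dominated:
  fixes h :: "'w \<times> 'a::euclidean_space \<Rightarrow> 'b::{banach,second_countable_topology}"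
  assumes M: "sigma_finite_measure M" and h: "h \<in> borel_measurable (M \<Otimes>\<^sub>M lborel)"
    and a: "integrable M a" and K: "compact K"
    and bnd: "AE z in M \<Otimes>\<^sub>M lborel. norm (h z) \<le> a (fst z) * indicat_real K (snd z)"
  shows "integrable (M \<Otimes>\<^sub>M lborel) h"
proof (rule Bochner_Integration.integrable_bound[OF _ h])
  interpret M: sigma_finite_measure M by (rule M)
  interpret P: pair_sigma_finite M "lborel :: 'a measure" ..
  have [measurable]: "K \<in> sets borel" by (intro borel_closed compact_imp_closed K)
  have [measurable]: "a \<in> borel_measurable M" using a by simp
  have iK: "integrable lborel (indicat_real K)"
    using emeasure_compact_finite[OF K] by (intro integrable_real_indicator) auto
  show "integrable (M \<Otimes>\<^sub>M lborel) (\<lambda>z. a (fst z) * indicat_real K (snd z))"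
  proof (rule P.Fubini_integrable)
    show "(\<lambda>z. a (fst z) * indicat_real K (snd z)) \<in> borel_measurable (M \<Otimes>\<^sub>M lborel)"
      by measurable
    show "integrable M (\<lambda>x. \<integral>y. norm (a (fst (x, y)) * indicat_real K (snd (x, y))) \<partial>lborel)"
      using a by (simp add: abs_mult)
    show "AE x in M. integrable lborel (\<lambda>y. a (fst (x, y)) * indicat_real K (snd (x, y)))"
      using iK by simp
  qed
  show "AE z in M \<Otimes>\<^sub>M lborel. norm (h z) \<le> norm (a (fst z) * indicat_real K (snd z))"
    using bnd
  proof eventually_elim
    case (elim z)
    then show ?case
      using abs_ge_self[of "a (fst z) * indicat_real K (snd z)"] unfolding real_norm_def by linarith
  qed
qed

text \<open>A crude constant: each row has norm at most its l^1 norm, hence at most d L, and the p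
  weighted rows are added up. All that is used later is linear growth in v.\<close>

lemma norm_transpose_matrix_vector_le:
  fixes J :: "real^'d^'p"
  assumes "\<And>i k. \<bar>J $ i $ k\<bar> \<le> L"
  shows "norm (transpose J *v v) \<le> real CARD('p) * (real CARD('d) * L) * norm v"
proof -
  have row: "norm (J $ i) \<le> real CARD('d) * L" for i
    using norm_le_l1_cart[of "J $ i"] sum_bounded_above[of UNIV "\<lambda>k. \<bar>J $ i $ k\<bar>" L] assms by fastforce
  have L: "0 \<le> real CARD('d) * L" using order_trans[OF norm_ge_zero row] .
  have "norm (transpose J *v v) \<le> (\<Sum>i\<in>UNIV. norm ((v $ i) *\<^sub>R J $ i))"
    unfolding transpose_matrix_vector_eq_sum by (rule norm_sum)
  also have "\<dots> \<le> (\<Sum>i\<in>(UNIV :: 'p set). norm v * (real CARD('d) * L))"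
    unfolding norm_scaleR using component_le_norm_cart row L
    by (intro sum_mono mult_mono) (auto simp: real_norm_def)
  also have "\<dots> = real CARD('p) * (real CARD('d) * L) * norm v" by simp
  finally show ?thesis .
qed

lemma matrix_vector_norm_bound:
  fixes A :: "real^'p^'m"
  shows "\<exists>C\<ge>0. \<forall>u. norm (A *v u) \<le> C * norm u"
  using bounded_linear.nonneg_bounded[OF matrix_vector_mul_bounded_linear[of A]]
  by (simp add: mult.commute)

lemma borel_measurable_matrix_vector [measurable]:
  fixes A :: "real^'p^'m"
  assumes "f \<in> borel_measurable M" shows "(\<lambda>x. A *v f x) \<in> borel_measurable M"
  by (rule measurable_compose[OF assms borel_measurable_continuous_onI])
    (rule linear_continuous_on[OF matrix_vector_mul_bounded_linear])

lemma borel_measurable_transpose_matrix_vector: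
  fixes J :: "'a \<Rightarrow> real^'d^'p"
  assumes [measurable]: "J \<in> borel_measurable M" "v \<in> borel_measurable M"
  shows "(\<lambda>x. transpose (J x) *v v x) \<in> borel_measurable M"
  unfolding transpose_matrix_vector_eq_sum by measurable

section \<open>Risk and degrees of freedom\<close>

text \<open>Changing one argument at a time gives the joint constant L1 + L2. This is the source of
  joint measurability of \<mu>. Empty \<Theta> is split off because it forces no sign on L1.\<close>

lemma joint_lipschitz_continuous:
  fixes \<mu> :: "'a::metric_space \<Rightarrow> 'b::metric_space \<Rightarrow> 'c::metric_space"
  assumes "\<And>\<theta>. \<theta> \<in> \<Theta> \<Longrightarrow> L1-lipschitz_on UNIV (\<lambda>y. \<mu> y \<theta>)" and "\<And>y. L2-lipschitz_on \<Theta> (\<lambda>\<theta>. \<mu> y \<theta>)"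
  shows "continuous_on (UNIV \<times> \<Theta>) (\<lambda>z. \<mu> (fst z) (snd z))"
proof (cases "\<Theta> = {}")
  case False
  then have L1: "0 \<le> L1" using assms(1) lipschitz_on_nonneg by blast
  have L2: "0 \<le> L2" using assms(2) lipschitz_on_nonneg by blast
  have "(L1 + L2)-lipschitz_on (UNIV \<times> \<Theta>) (\<lambda>z :: 'a \<times> 'b. \<mu> (fst z) (snd z))"
  proof (rule lipschitz_onI)
    fix z z' :: "'a \<times> 'b" assume z: "z \<in> UNIV \<times> \<Theta>" "z' \<in> UNIV \<times> \<Theta>"
    have "dist (\<mu> (fst z) (snd z)) (\<mu> (fst z') (snd z')) \<le>
        dist (\<mu> (fst z) (snd z)) (\<mu> (fst z') (snd z)) + dist (\<mu> (fst z') (snd z)) (\<mu> (fst z') (snd z'))"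
      by (rule dist_triangle)
    also have "\<dots> \<le> L1 * dist (fst z) (fst z') + L2 * dist (snd z) (snd z')"
      using z by (intro add_mono lipschitz_onD[OF assms(1)] lipschitz_onD[OF assms(2)]) auto
    also have "\<dots> \<le> L1 * dist z z' + L2 * dist z z'"
      using L1 L2 by (intro add_mono mult_left_mono dist_fst_le dist_snd_le)
    finally show "dist (\<mu> (fst z) (snd z)) (\<mu> (fst z') (snd z')) \<le> (L1 + L2) * dist z z'"
      by (simp add: distrib_right)
  qed (use L1 L2 in simp)
  then show ?thesis by (rule lipschitz_on_continuous_on)
qed simp

lemma inner_matrix_vector_mult:
  fixes A :: "real^'p^'m"
  shows "(A *v u) \<bullet> (A *v v) = ((transpose A ** A) *v u) \<bullet> v"
proof -
  have "((transpose A ** A) *v u) \<bullet> v = ((A *v u) v* A) \<bullet> v"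
    by (simp only: matrix_vector_mul_assoc[symmetric] transpose_matrix_vector)
  then show ?thesis by (simp only: dot_lmul_matrix)
qed

section \<open>The setting: growth, measurability and the almost sure Jacobian bound\<close>

locale gaussian_risk =
  fixes \<Theta> :: "(real^'d) set" and \<sigma> :: real and A :: "real^'p^'m" and \<mu>0 :: "real^'p"
    and \<mu> :: "real^'p \<Rightarrow> real^'d \<Rightarrow> real^'p"
    and J :: "real^'p \<Rightarrow> real^'d \<Rightarrow> real^'d^'p"
    and L1 L2 :: real
  assumes open_Theta: "open \<Theta>" and sigma_pos: "\<sigma> > 0"
    and L1_nonneg: "0 \<le> L1"
    and lip1: "\<And>\<theta>. \<theta> \<in> \<Theta> \<Longrightarrow> L1-lipschitz_on UNIV (\<lambda>y. \<mu> y \<theta>)"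
    and zero: "\<And>\<theta>. \<theta> \<in> \<Theta> \<Longrightarrow> \<mu> 0 \<theta> = 0"
    and lip2: "\<And>y. L2-lipschitz_on \<Theta> (\<lambda>\<theta>. \<mu> y \<theta>)"
    and J_weak: "\<And>y. weak_jacobian_on \<Theta> (\<lambda>\<theta>. \<mu> y \<theta>) (\<lambda>\<theta>. J y \<theta>)"
    and J_meas: "(\<lambda>z. J (fst z) (snd z)) \<in> borel_measurable borel"
begin

abbreviation noise :: "(real^'p) measure" where "noise \<equiv> gauss_noise \<sigma>"

abbreviation AtA :: "real^'p^'p" where "AtA \<equiv> transpose A ** A"

sublocale noise: prob_space noise
  by (rule prob_space_gauss_noise[OF sigma_pos])

sublocale noise_param: pair_sigma_finite noise "lborel :: (real^'d) measure" ..

lemma L2_nonneg: "0 \<le> L2"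
  by (rule lipschitz_on_nonneg[OF lip2])

text \<open>The normalisation at 0 turns the Lipschitz estimate into linear growth in the data,
  uniformly in \<theta>. Gaussian moments of order at most two thus control the risk and the degrees
  of freedom.\<close>

lemma mu_bound: "\<theta> \<in> \<Theta> \<Longrightarrow> norm (\<mu> (\<mu>0 + w) \<theta>) \<le> L1 * norm \<mu>0 + L1 * norm w"
  using lipschitz_onD[OF lip1 UNIV_I UNIV_I, of \<theta> "\<mu>0 + w" 0] zero[of \<theta>]
    mult_left_mono[OF norm_triangle_ineq[of \<mu>0 w] L1_nonneg]
  by (simp add: distrib_left)

text \<open>Nothing is known about \<mu> for parameters outside \<Theta>. Replacing its values there
  by 0 produces a Borel function on the whole product, equal to \<mu> wherever the indicator of a
  compact K \<subseteq> \<Theta> is nonzero.\<close>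

definition \<mu>\<^sub>\<Theta> :: "(real^'p) \<times> (real^'d) \<Rightarrow> real^'p" where
  "\<mu>\<^sub>\<Theta> z = (if z \<in> UNIV \<times> \<Theta> then \<mu> (fst z) (snd z) else 0)"

lemma mu_Theta_borel: "\<mu>\<^sub>\<Theta> \<in> borel_measurable borel"
  unfolding \<mu>\<^sub>\<Theta>_def[abs_def]
proof (rule borel_measurable_continuous_on_if)
  show "UNIV \<times> \<Theta> \<in> sets (borel :: ((real^'p) \<times> (real^'d)) measure)"
    by (intro borel_open open_Times open_Theta open_UNIV)
  show "continuous_on (UNIV \<times> \<Theta>) (\<lambda>z. \<mu> (fst z) (snd z))"
    by (rule joint_lipschitz_continuous[OF lip1 lip2])
qed (rule continuous_on_const)

lemma shift_measurable:
  "(\<lambda>z. (\<mu>0 + fst z, snd z)) \<in> noise \<Otimes>\<^sub>M lborel \<rightarrow>\<^sub>M (borel :: ((real^'p) \<times> (real^'d)) measure)"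
  unfolding borel_prod[symmetric] by measurable

lemma mu_shift_measurable [measurable]:
  "(\<lambda>z. \<mu>\<^sub>\<Theta> (\<mu>0 + fst z, snd z)) \<in> borel_measurable (noise \<Otimes>\<^sub>M (lborel :: (real^'d) measure))"
  by (rule measurable_compose[OF shift_measurable mu_Theta_borel])

lemma J_shift_measurable [measurable]:
  "(\<lambda>z. J (\<mu>0 + fst z) (snd z)) \<in> borel_measurable (noise \<Otimes>\<^sub>M (lborel :: (real^'d) measure))"
  using measurable_compose[OF shift_measurable J_meas] by simp

lemma J_borel_param [measurable]: "J y \<in> borel_measurable borel"
proof -
  have "(\<lambda>x. (y, x)) \<in> borel \<rightarrow>\<^sub>M (borel :: ((real^'p) \<times> (real^'d)) measure)"
    unfolding borel_prod[symmetric] by measurable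
  from measurable_compose[OF this J_meas] show ?thesis by simp
qed

lemma J_borel_data [measurable]: "(\<lambda>y. J y \<theta>) \<in> borel_measurable borel"
proof -
  have "(\<lambda>y. (y, \<theta>)) \<in> borel \<rightarrow>\<^sub>M (borel :: ((real^'p) \<times> (real^'d)) measure)"
    unfolding borel_prod[symmetric] by measurable
  from measurable_compose[OF this J_meas] show ?thesis by simp
qed

lemma mu_borel_data: 
  assumes "\<theta> \<in> \<Theta>" shows "(\<lambda>w. \<mu> (\<mu>0 + w) \<theta>) \<in> borel_measurable borel"
proof (rule borel_measurable_continuous_onI)
  have "continuous_on UNIV (\<lambda>y. \<mu> y \<theta>)" by (rule lipschitz_on_continuous_on[OF lip1[OF assms]])
  then show "continuous_on UNIV (\<lambda>w. \<mu> (\<mu>0 + w) \<theta>)"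
    by (rule continuous_on_compose2) (auto intro!: continuous_intros)
qed

definition J_bounded :: "real^'d^'p \<Rightarrow> bool" where
  "J_bounded B \<longleftrightarrow> (\<forall>i k. \<bar>B $ i $ k\<bar> \<le> L2)"

lemma J_bounded_param: "AE \<theta> in lborel. \<theta> \<in> \<Theta> \<longrightarrow> J_bounded (J y \<theta>)"
  unfolding J_bounded_def by (rule weak_jacobian_bound[OF open_Theta lip2 J_weak]) measurable

lemma J_bounded_sets [measurable]: "Measurable.pred borel J_bounded"
  unfolding J_bounded_def[abs_def] by measurable

lemma J_bounded_pair: "AE z in noise \<Otimes>\<^sub>M lborel. snd z \<in> \<Theta> \<longrightarrow> J_bounded (J (\<mu>0 + fst z) (snd z))"
proof (rule noise_param.AE_pair_measure)
  have [measurable]: "\<Theta> \<in> sets borel" using open_Theta by simp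
  show "{z \<in> space (noise \<Otimes>\<^sub>M lborel). snd z \<in> \<Theta> \<longrightarrow> J_bounded (J (\<mu>0 + fst z) (snd z))}
      \<in> sets (noise \<Otimes>\<^sub>M lborel)"
    by measurable
  show "AE w in noise. AE x in lborel. snd (w, x) \<in> \<Theta> \<longrightarrow> J_bounded (J (\<mu>0 + fst (w, x)) (snd (w, x)))"
    using J_bounded_param by simp
qed

text \<open>Fubini for the exceptional set, which is measurable in both variables together because
  \<open>J\<close> is. The null set of parameters found here is the one that the theorem
  discards.\<close>

lemma J_bounded_data: "AE \<theta> in lborel. \<theta> \<in> \<Theta> \<longrightarrow> (AE y in lborel. J_bounded (J y \<theta>))"
proof -
  have [measurable]: "\<Theta> \<in> sets borel" using open_Theta by simp
  have [measurable]: "(\<lambda>z. J (fst z) (snd z)) \<in> borel_measurable ((lborel :: (real^'p) measure) \<Otimes>\<^sub>M (lborel :: (real^'d) measure))"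
    using J_meas by (simp add: lborel_prod)
  have "AE \<theta> in lborel. AE y in lborel. \<theta> \<in> \<Theta> \<longrightarrow> J_bounded (J y \<theta>)"
    using J_bounded_param by (subst lborel_pair.AE_commute[symmetric]) measurable
  then show ?thesis by eventually_elim simp
qed

definition CJ :: real where "CJ = real CARD('p) * (real CARD('d) * L2)"

lemma CJ_nonneg: "0 \<le> CJ"
  using L2_nonneg by (simp add: CJ_def)

lemma J_bounded_norm: "J_bounded B \<Longrightarrow> norm (transpose B *v v) \<le> CJ * norm v"
  unfolding CJ_def J_bounded_def by (rule norm_transpose_matrix_vector_le) blast

section \<open>Weak gradients of the two expectations\<close>

definition risk_integrand :: "real^'p \<Rightarrow> real^'d \<Rightarrow> real" where
  "risk_integrand w \<theta> = (norm (A *v (\<mu> (\<mu>0 + w) \<theta> - \<mu>0)))\<^sup>2"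

definition risk_gradient :: "real^'p \<Rightarrow> real^'d \<Rightarrow> real^'d" where
  "risk_gradient w \<theta> = 2 *\<^sub>R (transpose (J (\<mu>0 + w) \<theta>) *v (AtA *v (\<mu> (\<mu>0 + w) \<theta> - \<mu>0)))"

definition dof_integrand :: "real^'p \<Rightarrow> real^'d \<Rightarrow> real" where
  "dof_integrand w \<theta> = ((1 / \<sigma>\<^sup>2) *\<^sub>R (AtA *v w)) \<bullet> \<mu> (\<mu>0 + w) \<theta>"

definition dof_gradient :: "real^'p \<Rightarrow> real^'d \<Rightarrow> real^'d" where
  "dof_gradient w \<theta> = transpose (J (\<mu>0 + w) \<theta>) *v ((1 / \<sigma>\<^sup>2) *\<^sub>R (AtA *v w))"

text \<open>For each fixed w the chain rule for squared norms applies. The majorants over a compact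
  K are quadratic in the norm of w for the integrand and linear for its gradient; the latter holds
  only almost everywhere on the product, through the entrywise bound on \<open>J\<close>.\<close>

lemma risk_weak_gradient: "weak_gradient_on \<Theta> (\<lambda>\<theta>. \<integral>w. risk_integrand w \<theta> \<partial>noise) (\<lambda>\<theta>. \<integral>w. risk_gradient w \<theta> \<partial>noise)"
proof (rule weak_gradient_on_expectation)
  show "sigma_finite_measure noise" by unfold_locales
  show "weak_gradient_on \<Theta> (risk_integrand w) (risk_gradient w)" for w
    unfolding risk_integrand_def[abs_def] risk_gradient_def[abs_def]
    by (rule weak_gradient_on_norm_square[OF open_Theta lip2 J_weak]) measurable
  fix K assume K: "compact K" "K \<subseteq> \<Theta>"
  have [measurable]: "K \<in> sets borel" by (intro borel_closed compact_imp_closed K)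
  \<comment> \<open>These come from linear growth and the triangle inequality: a + b times the norm
    of w bounds the residual against \<mu>0.\<close>
  define a b where "a = L1 * norm \<mu>0 + norm \<mu>0" and "b = L1"
  have ab: "0 \<le> a" "0 \<le> b" using L1_nonneg by (auto simp: a_def b_def)
  have res: "norm (\<mu> (\<mu>0 + w) \<theta> - \<mu>0) \<le> a + b * norm w" if "\<theta> \<in> K" for w \<theta>
    using mu_bound[of \<theta> w] norm_triangle_ineq4[of "\<mu> (\<mu>0 + w) \<theta>" \<mu>0] that K(2)
    by (auto simp: a_def b_def)
  obtain C where C: "C \<ge> 0" "\<And>u. norm (A *v u) \<le> C * norm u" using matrix_vector_norm_bound[of A] by blast
  obtain C' where C': "C' \<ge> 0" "\<And>u. norm (AtA *v u) \<le> C' * norm u" using matrix_vector_norm_bound[of AtA] by blast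
  let ?m = "\<lambda>z. \<mu>\<^sub>\<Theta> (\<mu>0 + fst z, snd z) - \<mu>0"
  have m: "?m z = \<mu> (\<mu>0 + fst z) (snd z) - \<mu>0" if "snd z \<in> K" for z
    using that K(2) by (auto simp: \<mu>\<^sub>\<Theta>_def)
  show "integrable (noise \<Otimes>\<^sub>M lborel) (\<lambda>(w, x). indicat_real K x * risk_integrand w x)"
  proof (rule integrable_pair_dominated[OF _ _ _ K(1)])
    show "sigma_finite_measure noise" by unfold_locales
    have eq: "(\<lambda>(w, x). indicat_real K x * risk_integrand w x) = (\<lambda>z. indicat_real K (snd z) * (norm (A *v ?m z))\<^sup>2)"
    proof (rule ext)
      fix z show "(case z of (w, x) \<Rightarrow> indicat_real K x * risk_integrand w x) = indicat_real K (snd z) * (norm (A *v ?m z))\<^sup>2"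
        using m[of z] by (cases "snd z \<in> K") (simp_all add: case_prod_beta' risk_integrand_def)
    qed
    show "(\<lambda>(w, x). indicat_real K x * risk_integrand w x) \<in> borel_measurable (noise \<Otimes>\<^sub>M lborel)"
      unfolding eq by measurable
    show "integrable noise (\<lambda>w. C\<^sup>2 * (a\<^sup>2 + 2 * a * b * norm w + b\<^sup>2 * (norm w)\<^sup>2))"
      using sigma_pos by (intro integrable_mult_right Bochner_Integration.integrable_add gauss_norm_integrable
          gauss_norm_square_integrable) simp_all
    show "AE z in noise \<Otimes>\<^sub>M lborel. norm (case z of (w, x) \<Rightarrow> indicat_real K x * risk_integrand w x)
        \<le> C\<^sup>2 * (a\<^sup>2 + 2 * a * b * norm (fst z) + b\<^sup>2 * (norm (fst z))\<^sup>2) * indicat_real K (snd z)"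
    proof (intro always_eventually allI)
      fix z :: "(real^'p) \<times> (real^'d)"
      have "risk_integrand (fst z) (snd z) \<le> C\<^sup>2 * (a\<^sup>2 + 2 * a * b * norm (fst z) + b\<^sup>2 * (norm (fst z))\<^sup>2)" if z: "snd z \<in> K"
      proof -
        have "norm (A *v (\<mu> (\<mu>0 + fst z) (snd z) - \<mu>0)) \<le> C * (a + b * norm (fst z))"
          by (rule order_trans[OF C(2) mult_left_mono[OF res[OF z] C(1)]])
        from power_mono[OF this, of 2]
        have "risk_integrand (fst z) (snd z) \<le> (C * (a + b * norm (fst z)))\<^sup>2"
          unfolding risk_integrand_def by simp
        also have "\<dots> = C\<^sup>2 * (a\<^sup>2 + 2 * a * b * norm (fst z) + b\<^sup>2 * (norm (fst z))\<^sup>2)"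
          by (simp add: power2_eq_square distrib_left distrib_right)
        finally show ?thesis .
      qed
      then show "norm (case z of (w, x) \<Rightarrow> indicat_real K x * risk_integrand w x)
        \<le> C\<^sup>2 * (a\<^sup>2 + 2 * a * b * norm (fst z) + b\<^sup>2 * (norm (fst z))\<^sup>2) * indicat_real K (snd z)"
        by (cases "snd z \<in> K") (simp_all add: case_prod_beta' risk_integrand_def)
    qed
  qed
  show "integrable (noise \<Otimes>\<^sub>M lborel) (\<lambda>(w, x). indicat_real K x *\<^sub>R risk_gradient w x)"
  proof (rule integrable_pair_dominated[OF _ _ _ K(1)])
    show "sigma_finite_measure noise" by unfold_locales
    have eq: "(\<lambda>(w, x). indicat_real K x *\<^sub>R risk_gradient w x) =
        (\<lambda>z. indicat_real K (snd z) *\<^sub>R (2 *\<^sub>R (transpose (J (\<mu>0 + fst z) (snd z)) *v (AtA *v ?m z))))"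
    proof (rule ext)
      fix z show "(case z of (w, x) \<Rightarrow> indicat_real K x *\<^sub>R risk_gradient w x) =
          indicat_real K (snd z) *\<^sub>R (2 *\<^sub>R (transpose (J (\<mu>0 + fst z) (snd z)) *v (AtA *v ?m z)))"
        using m[of z] by (cases "snd z \<in> K") (simp_all add: case_prod_beta' risk_gradient_def)
    qed
    have [measurable]: "(\<lambda>z. transpose (J (\<mu>0 + fst z) (snd z)) *v (AtA *v ?m z)) \<in> borel_measurable (noise \<Otimes>\<^sub>M lborel)"
      by (rule borel_measurable_transpose_matrix_vector) measurable
    show "(\<lambda>(w, x). indicat_real K x *\<^sub>R risk_gradient w x) \<in> borel_measurable (noise \<Otimes>\<^sub>M lborel)"
      unfolding eq by measurable
    show "integrable noise (\<lambda>w. 2 * (CJ * (C' * (a + b * norm w))))"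
      using sigma_pos by (intro integrable_mult_right Bochner_Integration.integrable_add gauss_norm_integrable) simp_all
    show "AE z in noise \<Otimes>\<^sub>M lborel. norm (case z of (w, x) \<Rightarrow> indicat_real K x *\<^sub>R risk_gradient w x)
        \<le> 2 * (CJ * (C' * (a + b * norm (fst z)))) * indicat_real K (snd z)"
      using J_bounded_pair
    proof eventually_elim
      case (elim z)
      have "norm (risk_gradient (fst z) (snd z)) \<le> 2 * (CJ * (C' * (a + b * norm (fst z))))" if z: "snd z \<in> K"
      proof -
        have B: "J_bounded (J (\<mu>0 + fst z) (snd z))" using elim z K(2) by blast
        have "norm (AtA *v (\<mu> (\<mu>0 + fst z) (snd z) - \<mu>0)) \<le> C' * (a + b * norm (fst z))"
          by (rule order_trans[OF C'(2) mult_left_mono[OF res[OF z] C'(1)]])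
        from order_trans[OF J_bounded_norm[OF B] mult_left_mono[OF this CJ_nonneg]]
        show ?thesis by (simp only: risk_gradient_def norm_scaleR)
      qed
      then show ?case
        by (cases "snd z \<in> K") (simp_all add: case_prod_beta')
    qed
  qed
qed

lemma dof_weak_gradient: "weak_gradient_on \<Theta> (\<lambda>\<theta>. \<integral>w. dof_integrand w \<theta> \<partial>noise) (\<lambda>\<theta>. \<integral>w. dof_gradient w \<theta> \<partial>noise)"
proof (rule weak_gradient_on_expectation)
  show "sigma_finite_measure noise" by unfold_locales
  show "weak_gradient_on \<Theta> (dof_integrand w) (dof_gradient w)" for w
    unfolding dof_integrand_def[abs_def] dof_gradient_def[abs_def]
    by (rule weak_gradient_on_inner[OF J_weak])
  fix K assume K: "compact K" "K \<subseteq> \<Theta>"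
  have [measurable]: "K \<in> sets borel" by (intro borel_closed compact_imp_closed K)
  define a where "a = L1 * norm \<mu>0"
  obtain C where C: "C \<ge> 0" "\<And>u. norm (AtA *v u) \<le> C * norm u" using matrix_vector_norm_bound[of AtA] by blast
  define c where "c = (1 / \<sigma>\<^sup>2) * C"
  have c0: "0 \<le> c" using C(1) by (simp add: c_def)
  have v: "norm ((1 / \<sigma>\<^sup>2) *\<^sub>R (AtA *v w)) \<le> c * norm w" for w
    unfolding c_def mult.assoc norm_scaleR using mult_left_mono[OF C(2)[of w], of "1 / \<sigma>\<^sup>2"] by simp
  let ?m = "\<lambda>z. \<mu>\<^sub>\<Theta> (\<mu>0 + fst z, snd z)"
  have m: "?m z = \<mu> (\<mu>0 + fst z) (snd z)" if "snd z \<in> K" for z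
    using that K(2) by (auto simp: \<mu>\<^sub>\<Theta>_def)
  show "integrable (noise \<Otimes>\<^sub>M lborel) (\<lambda>(w, x). indicat_real K x * dof_integrand w x)"
  proof (rule integrable_pair_dominated[OF _ _ _ K(1)])
    show "sigma_finite_measure noise" by unfold_locales
    have eq: "(\<lambda>(w, x). indicat_real K x * dof_integrand w x) =
        (\<lambda>z. indicat_real K (snd z) * (((1 / \<sigma>\<^sup>2) *\<^sub>R (AtA *v fst z)) \<bullet> ?m z))"
    proof (rule ext)
      fix z show "(case z of (w, x) \<Rightarrow> indicat_real K x * dof_integrand w x) =
          indicat_real K (snd z) * (((1 / \<sigma>\<^sup>2) *\<^sub>R (AtA *v fst z)) \<bullet> ?m z)"
        using m[of z] by (cases "snd z \<in> K") (simp_all add: case_prod_beta' dof_integrand_def)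
    qed
    show "(\<lambda>(w, x). indicat_real K x * dof_integrand w x) \<in> borel_measurable (noise \<Otimes>\<^sub>M lborel)"
      unfolding eq by measurable
    show "integrable noise (\<lambda>w. c * (a * norm w + L1 * (norm w)\<^sup>2))"
      using sigma_pos by (intro integrable_mult_right Bochner_Integration.integrable_add gauss_norm_integrable
          gauss_norm_square_integrable) simp_all
    show "AE z in noise \<Otimes>\<^sub>M lborel. norm (case z of (w, x) \<Rightarrow> indicat_real K x * dof_integrand w x)
        \<le> c * (a * norm (fst z) + L1 * (norm (fst z))\<^sup>2) * indicat_real K (snd z)"
    proof (intro always_eventually allI)
      fix z :: "(real^'p) \<times> (real^'d)"
      have "\<bar>dof_integrand (fst z) (snd z)\<bar> \<le> c * (a * norm (fst z) + L1 * (norm (fst z))\<^sup>2)" if z: "snd z \<in> K"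
      proof -
        have "\<bar>dof_integrand (fst z) (snd z)\<bar> \<le> norm ((1 / \<sigma>\<^sup>2) *\<^sub>R (AtA *v fst z)) * norm (\<mu> (\<mu>0 + fst z) (snd z))"
          unfolding dof_integrand_def by (rule Cauchy_Schwarz_ineq2)
        also have "\<dots> \<le> (c * norm (fst z)) * (a + L1 * norm (fst z))"
          unfolding a_def using z K(2) c0 by (intro mult_mono v mu_bound) auto
        finally show ?thesis by (simp add: power2_eq_square algebra_simps)
      qed
      then show "norm (case z of (w, x) \<Rightarrow> indicat_real K x * dof_integrand w x)
        \<le> c * (a * norm (fst z) + L1 * (norm (fst z))\<^sup>2) * indicat_real K (snd z)"
        by (cases "snd z \<in> K") (simp_all add: case_prod_beta')
    qed
  qed
  show "integrable (noise \<Otimes>\<^sub>M lborel) (\<lambda>(w, x). indicat_real K x *\<^sub>R dof_gradient w x)"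
  proof (rule integrable_pair_dominated[OF _ _ _ K(1)])
    show "sigma_finite_measure noise" by unfold_locales
    have [measurable]: "(\<lambda>z. transpose (J (\<mu>0 + fst z) (snd z)) *v ((1 / \<sigma>\<^sup>2) *\<^sub>R (AtA *v fst z))) \<in> borel_measurable (noise \<Otimes>\<^sub>M lborel)"
      by (rule borel_measurable_transpose_matrix_vector) measurable
    show "(\<lambda>(w, x). indicat_real K x *\<^sub>R dof_gradient w x) \<in> borel_measurable (noise \<Otimes>\<^sub>M lborel)"
      unfolding dof_gradient_def case_prod_beta' by measurable
    show "integrable noise (\<lambda>w. CJ * (c * norm w))"
      using sigma_pos by (intro integrable_mult_right gauss_norm_integrable)
    show "AE z in noise \<Otimes>\<^sub>M lborel. norm (case z of (w, x) \<Rightarrow> indicat_real K x *\<^sub>R dof_gradient w x)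
        \<le> CJ * (c * norm (fst z)) * indicat_real K (snd z)"
      using J_bounded_pair
    proof eventually_elim
      case (elim z)
      have "norm (dof_gradient (fst z) (snd z)) \<le> CJ * (c * norm (fst z))" if z: "snd z \<in> K"
      proof -
        have B: "J_bounded (J (\<mu>0 + fst z) (snd z))" using elim z K(2) by blast
        show ?thesis
          unfolding dof_gradient_def
          by (rule order_trans[OF J_bounded_norm[OF B] mult_left_mono[OF v CJ_nonneg]])
      qed
      then show ?case
        by (cases "snd z \<in> K") (simp_all add: case_prod_beta')
    qed
  qed
qed

section \<open>Risk and degrees of freedom as expectations of the integrands\<close>

lemma risk_eq: "risk \<sigma> A \<mu> \<mu>0 \<theta> = (\<integral>w. risk_integrand w \<theta> \<partial>noise)"
  by (simp add: risk_def EW_def risk_integrand_def)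

text \<open>Split A Y into A \<mu>0 + A W. In each covariance the deterministic part gives (A
  \<mu>0)_j E[(A \<mu>)_j], which is exactly the product of expectations being subtracted, as E[A W]
  = 0. Summing over j turns the rest into an inner product, where A is moved to the other
  side.\<close>

lemma dof_eq:
  assumes \<theta>: "\<theta> \<in> \<Theta>"
  shows "dof \<sigma> A \<mu> \<mu>0 \<theta> = (\<integral>w. dof_integrand w \<theta> \<partial>noise)"
proof -
  obtain C where C: "C \<ge> 0" "\<And>u. norm (A *v u) \<le> C * norm u" using matrix_vector_norm_bound[of A] by blast
  have Cj: "\<bar>(A *v u) $ j\<bar> \<le> C * norm u" for u j
    by (rule order_trans[OF component_le_norm_cart C(2)])
  have [measurable]: "(\<lambda>w. \<mu> (\<mu>0 + w) \<theta>) \<in> borel_measurable borel" by (rule mu_borel_data[OF \<theta>])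
  let ?m = "\<lambda>w. A *v \<mu> (\<mu>0 + w) \<theta>"
  define a where "a = L1 * norm \<mu>0"
  have mu: "C * norm (\<mu> (\<mu>0 + w) \<theta>) \<le> C * a + C * L1 * norm w" for w
    using mult_left_mono[OF mu_bound[OF \<theta>, of w] C(1)] by (simp add: a_def distrib_left mult.assoc)
  have i1: "integrable noise (\<lambda>w. (A *v w) $ j)" for j
  proof (rule gauss_integrable_quadratic[OF sigma_pos, where a = 0 and b = C and c = 0])
    show "AE w in noise. norm ((A *v w) $ j) \<le> 0 + C * norm w + 0 * (norm w)\<^sup>2"
      using Cj by (intro always_eventually allI) simp
  qed measurable
  have i2: "integrable noise (\<lambda>w. ?m w $ j)" for j
  proof (rule gauss_integrable_quadratic[OF sigma_pos, where a = "C * a" and b = "C * L1" and c = 0])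
    show "AE w in noise. norm (?m w $ j) \<le> C * a + C * L1 * norm w + 0 * (norm w)\<^sup>2"
    proof (intro always_eventually allI)
      fix w show "norm (?m w $ j) \<le> C * a + C * L1 * norm w + 0 * (norm w)\<^sup>2"
        using order_trans[OF Cj mu] by simp
    qed
  qed measurable
  have i3: "integrable noise (\<lambda>w. (A *v w) $ j * ?m w $ j)" for j
  proof (rule gauss_integrable_quadratic[OF sigma_pos, where a = 0 and b = "C * (C * a)" and c = "C * (C * L1)"])
    show "AE w in noise. norm ((A *v w) $ j * ?m w $ j) \<le> 0 + C * (C * a) * norm w + C * (C * L1) * (norm w)\<^sup>2"
    proof (intro always_eventually allI)
      fix w
      have "\<bar>(A *v w) $ j\<bar> * \<bar>?m w $ j\<bar> \<le> (C * norm w) * (C * a + C * L1 * norm w)"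
        using C(1) by (intro mult_mono Cj order_trans[OF Cj mu]) auto
      also have "\<dots> = 0 + C * (C * a) * norm w + C * (C * L1) * (norm w)\<^sup>2"
        by (simp add: power2_eq_square distrib_left)
      finally show "norm ((A *v w) $ j * ?m w $ j) \<le> 0 + C * (C * a) * norm w + C * (C * L1) * (norm w)\<^sup>2"
        by (simp only: real_norm_def abs_mult)
    qed
  qed measurable
  have iw: "integrable noise (\<lambda>w. w $ i)" for i
  proof (rule gauss_integrable_quadratic[OF sigma_pos, where a = 0 and b = 1 and c = 0])
    show "AE w in noise. norm (w $ i) \<le> 0 + 1 * norm w + 0 * (norm w)\<^sup>2"
      using component_le_norm_cart by (intro always_eventually allI) simp
  qed measurable
  have mean: "(\<integral>w. (A *v w) $ j \<partial>noise) = 0" for j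
  proof -
    have "(\<integral>w. (A *v w) $ j \<partial>noise) = (\<Sum>i\<in>UNIV. \<integral>w. A $ j $ i * w $ i \<partial>noise)"
      unfolding matrix_vector_mult_def vec_lambda_beta
      by (rule Bochner_Integration.integral_sum) (rule integrable_mult_right[OF iw])
    also have "\<dots> = 0" by (simp add: gauss_mean_zero[OF sigma_pos])
    finally show ?thesis .
  qed
  have cov: "EW \<sigma> \<mu>0 (\<lambda>y. (A *v y) $ j * (A *v \<mu> y \<theta>) $ j)
      - EW \<sigma> \<mu>0 (\<lambda>y. (A *v y) $ j) * EW \<sigma> \<mu>0 (\<lambda>y. (A *v \<mu> y \<theta>) $ j)
      = (\<integral>w. (A *v w) $ j * ?m w $ j \<partial>noise)" for j
  proof -
    have "EW \<sigma> \<mu>0 (\<lambda>y. (A *v y) $ j * (A *v \<mu> y \<theta>) $ j) =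
        (\<integral>w. (A *v \<mu>0) $ j * ?m w $ j + (A *v w) $ j * ?m w $ j \<partial>noise)"
      unfolding EW_def matrix_vector_right_distrib vector_add_component distrib_right ..
    also have "\<dots> = (A *v \<mu>0) $ j * (\<integral>w. ?m w $ j \<partial>noise) + (\<integral>w. (A *v w) $ j * ?m w $ j \<partial>noise)"
      by (subst Bochner_Integration.integral_add[OF integrable_mult_right[OF i2] i3]) simp
    finally have 1: "EW \<sigma> \<mu>0 (\<lambda>y. (A *v y) $ j * (A *v \<mu> y \<theta>) $ j) =
        (A *v \<mu>0) $ j * (\<integral>w. ?m w $ j \<partial>noise) + (\<integral>w. (A *v w) $ j * ?m w $ j \<partial>noise)" .
    have "EW \<sigma> \<mu>0 (\<lambda>y. (A *v y) $ j) = (\<integral>w. (A *v \<mu>0) $ j + (A *v w) $ j \<partial>noise)"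
      unfolding EW_def matrix_vector_right_distrib vector_add_component ..
    also have "\<dots> = (A *v \<mu>0) $ j"
      by (subst Bochner_Integration.integral_add[OF _ i1]) (simp_all add: mean noise.prob_space[simplified])
    finally have 2: "EW \<sigma> \<mu>0 (\<lambda>y. (A *v y) $ j) = (A *v \<mu>0) $ j" .
    show ?thesis unfolding 1 2 by (simp add: EW_def)
  qed
  have "dof \<sigma> A \<mu> \<mu>0 \<theta> = (\<Sum>j\<in>UNIV. \<integral>w. (A *v w) $ j * ?m w $ j \<partial>noise) / \<sigma>\<^sup>2"
    unfolding dof_def cov ..
  also have "(\<Sum>j\<in>UNIV. \<integral>w. (A *v w) $ j * ?m w $ j \<partial>noise) = (\<integral>w. (\<Sum>j\<in>UNIV. (A *v w) $ j * ?m w $ j) \<partial>noise)"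
    by (rule Bochner_Integration.integral_sum[symmetric]) (rule i3)
  also have "\<dots> = (\<integral>w. (AtA *v w) \<bullet> \<mu> (\<mu>0 + w) \<theta> \<partial>noise)"
  proof (intro Bochner_Integration.integral_cong refl)
    fix w
    have "(\<Sum>j\<in>UNIV. (A *v w) $ j * ?m w $ j) = (A *v w) \<bullet> ?m w"
      unfolding inner_vec_def inner_real_def ..
    then show "(\<Sum>j\<in>UNIV. (A *v w) $ j * ?m w $ j) = (AtA *v w) \<bullet> \<mu> (\<mu>0 + w) \<theta>"
      unfolding inner_matrix_vector_mult .
  qed
  also have "\<dots> / \<sigma>\<^sup>2 = (\<integral>w. ((AtA *v w) \<bullet> \<mu> (\<mu>0 + w) \<theta>) / \<sigma>\<^sup>2 \<partial>noise)"
    by (rule integral_divide_zero[symmetric])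
  also have "\<dots> = (\<integral>w. dof_integrand w \<theta> \<partial>noise)"
    unfolding dof_integrand_def inner_scaleR_left by simp
  finally show ?thesis .
qed

section \<open>Limits of the finite-difference estimators\<close>

text \<open>For each i the vector v_i = A^T A e_i is fixed, and the i-th summand is the difference
  quotient, along e_i, of the essentially bounded function j_i = J^T v_i. The translation derivative
  gives E[(W_i / \<sigma>^2) j_i], and the sum of W_i v_i over i reassembles A^T A W. The
  integrability claims allow the later splitting of expectations.\<close>

lemma grad_df_FD_limit:
  assumes good: "AE y in lborel. J_bounded (J y \<theta>)"
  shows "((\<lambda>\<epsilon>. EW \<sigma> \<mu>0 (\<lambda>y. grad_df_FD A J y \<theta> \<epsilon>)) \<longlongrightarrow> (\<integral>w. dof_gradient w \<theta> \<partial>noise)) (at_right 0)"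
    and "integrable noise (\<lambda>w. grad_df_FD A J (\<mu>0 + w) \<theta> \<epsilon>)"
    and "integrable noise (\<lambda>w. dof_gradient w \<theta>)"
proof -
  define v where "v i = AtA *v axis i 1" for i
  define j where "j i w = transpose (J (\<mu>0 + w) \<theta>) *v v i" for i w
  have [measurable]: "(\<lambda>w. J (\<mu>0 + w) \<theta>) \<in> borel_measurable borel"
    by (rule measurable_compose[OF _ J_borel_data]) measurable
  have jm [measurable]: "j i \<in> borel_measurable borel" for i
    unfolding j_def[abs_def] by (rule borel_measurable_transpose_matrix_vector) measurable
  have shift: "AE w in lborel. J_bounded (J (\<mu>0 + w) \<theta>)"
  proof -
    have "AE y in distr lborel borel ((+) \<mu>0). J_bounded (J y \<theta>)"
      unfolding lborel_distr_plus by (rule good)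
    then show ?thesis by (rule AE_distrD[rotated]) simp
  qed
  have jb: "AE w in lborel. norm (j i w) \<le> CJ * norm (v i)" for i
    using shift unfolding j_def by eventually_elim (rule J_bounded_norm)
  have ij: "integrable noise (\<lambda>w. j i (c + w))" for i c
  proof (rule gauss_integrable_quadratic[OF sigma_pos, where a = "CJ * norm (v i)" and b = 0 and c = 0])
    show "AE w in noise. norm (j i (c + w)) \<le> CJ * norm (v i) + 0 * norm w + 0 * (norm w)\<^sup>2"
      using AE_gauss_noise_translate[OF jb] by simp
  qed measurable
  have ij': "integrable noise (\<lambda>w. j i (w + c))" "integrable noise (j i)" for i c
    using ij[of i c] ij[of i 0] by (simp_all add: add.commute)
  have grad: "grad_df_FD A J (\<mu>0 + w) \<theta> \<epsilon> = (\<Sum>i\<in>UNIV. (1 / \<epsilon>) *\<^sub>R (j i (w + \<epsilon> *\<^sub>R axis i 1) - j i w))" for w \<epsilon>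
  proof -
    have "transpose (B - B') *v u = transpose B *v u - transpose B' *v u" for B B' :: "real^'d^'p" and u
      unfolding transpose_matrix_vector_eq_sum by (simp add: scaleR_right_diff_distrib sum_subtractf)
    then show ?thesis
      unfolding grad_df_FD_def j_def v_def scaleR_sum_right add.assoc by simp
  qed
  show "integrable noise (\<lambda>w. grad_df_FD A J (\<mu>0 + w) \<theta> \<epsilon>)"
    unfolding grad
    by (intro Bochner_Integration.integrable_sum integrable_scaleR_right Bochner_Integration.integrable_diff ij')
  have EWgrad: "EW \<sigma> \<mu>0 (\<lambda>y. grad_df_FD A J y \<theta> \<epsilon>) =
      (\<Sum>i\<in>UNIV. (1 / \<epsilon>) *\<^sub>R ((\<integral>w. j i (w + \<epsilon> *\<^sub>R axis i 1) \<partial>noise) - (\<integral>w. j i w \<partial>noise)))" for \<epsilon>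
  proof -
    have "EW \<sigma> \<mu>0 (\<lambda>y. grad_df_FD A J y \<theta> \<epsilon>) =
        (\<Sum>i\<in>UNIV. \<integral>w. (1 / \<epsilon>) *\<^sub>R (j i (w + \<epsilon> *\<^sub>R axis i 1) - j i w) \<partial>noise)"
      unfolding EW_def grad
      by (intro Bochner_Integration.integral_sum integrable_scaleR_right Bochner_Integration.integrable_diff ij')
    also have "\<dots> = (\<Sum>i\<in>UNIV. (1 / \<epsilon>) *\<^sub>R ((\<integral>w. j i (w + \<epsilon> *\<^sub>R axis i 1) \<partial>noise) - (\<integral>w. j i w \<partial>noise)))"
      unfolding integral_scaleR_right
      by (intro sum.cong refl arg_cong[of _ _ "\<lambda>x. (1 / \<epsilon>) *\<^sub>R x"] Bochner_Integration.integral_diff ij')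
    finally show ?thesis .
  qed
  have iwj: "integrable noise (\<lambda>w. (w $ i / \<sigma>\<^sup>2) *\<^sub>R j i w)" for i
  proof (rule gauss_integrable_quadratic[OF sigma_pos, where a = 0 and b = "(1 / \<sigma>\<^sup>2) * (CJ * norm (v i))" and c = 0])
    have "AE w in noise. norm (j i w) \<le> CJ * norm (v i)"
      using AE_gauss_noise_translate[OF jb, where \<sigma> = \<sigma> and c = 0] by simp
    then show "AE w in noise. norm ((w $ i / \<sigma>\<^sup>2) *\<^sub>R j i w) \<le>
        0 + (1 / \<sigma>\<^sup>2) * (CJ * norm (v i)) * norm w + 0 * (norm w)\<^sup>2"
    proof eventually_elim
      case (elim w)
      have "\<bar>w $ i / \<sigma>\<^sup>2\<bar> \<le> (1 / \<sigma>\<^sup>2) * norm w"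
        using divide_right_mono[OF component_le_norm_cart[of w i], of "\<sigma>\<^sup>2"] by (simp add: abs_divide)
      from mult_mono[OF this elim] show ?case by (simp add: mult.commute mult.left_commute)
    qed
  qed measurable
  have dg: "(\<Sum>i\<in>UNIV. (w $ i / \<sigma>\<^sup>2) *\<^sub>R j i w) = dof_gradient w \<theta>" for w
  proof -
    have "(1 / \<sigma>\<^sup>2) *\<^sub>R (AtA *v w) = (\<Sum>i\<in>UNIV. (w $ i / \<sigma>\<^sup>2) *\<^sub>R v i)"
    proof -
      have "AtA *v w = (\<Sum>i\<in>UNIV. (w $ i) *\<^sub>R v i)"
        unfolding v_def matrix_vector_mult_basis
        by (simp only: matrix_mult_sum scalar_mult_eq_scaleR)
      then show ?thesis by (simp only: scaleR_sum_right scaleR_scaleR) simp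
    qed
    then show ?thesis
      unfolding dof_gradient_def j_def
      by (simp only: linear_sum[OF matrix_vector_mul_linear] matrix_vector_mult_scaleR)
  qed
  show "integrable noise (\<lambda>w. dof_gradient w \<theta>)"
    unfolding dg[symmetric] by (intro Bochner_Integration.integrable_sum iwj)
  have lim: "((\<lambda>\<epsilon>. \<Sum>i\<in>UNIV. (1 / \<epsilon>) *\<^sub>R ((\<integral>w. j i (w + \<epsilon> *\<^sub>R axis i 1) \<partial>noise) - (\<integral>w. j i w \<partial>noise)))
      \<longlongrightarrow> (\<Sum>i\<in>UNIV. \<integral>w. (w $ i / \<sigma>\<^sup>2) *\<^sub>R j i w \<partial>noise)) (at_right 0)"
    by (intro tendsto_sum gauss_translation_derivative[OF sigma_pos jm jb])
  have "(\<Sum>i\<in>UNIV. \<integral>w. (w $ i / \<sigma>\<^sup>2) *\<^sub>R j i w \<partial>noise) = (\<integral>w. dof_gradient w \<theta> \<partial>noise)"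
    unfolding dg[symmetric] by (rule Bochner_Integration.integral_sum[symmetric]) (rule iwj)
  with lim show "((\<lambda>\<epsilon>. EW \<sigma> \<mu>0 (\<lambda>y. grad_df_FD A J y \<theta> \<epsilon>)) \<longlongrightarrow> (\<integral>w. dof_gradient w \<theta> \<partial>noise)) (at_right 0)"
    unfolding EWgrad by simp
qed

text \<open>The residual part \<open>h\<close> does not involve \<epsilon>, and linear growth of
  \<mu> together with the bound on \<open>J\<close> makes it integrable; only the finite-difference
  part has to be passed to the limit.\<close>

lemma SUGAR_FD_limit:
  assumes \<theta>: "\<theta> \<in> \<Theta>" and good: "AE y in lborel. J_bounded (J y \<theta>)"
  shows "((\<lambda>\<epsilon>. EW \<sigma> \<mu>0 (\<lambda>y. SUGAR_FD \<sigma> A \<mu> J y \<theta> \<epsilon>)) \<longlongrightarrow> (\<integral>w. risk_gradient w \<theta> \<partial>noise)) (at_right 0)"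
proof -
  define h where "h w = 2 *\<^sub>R (transpose (J (\<mu>0 + w) \<theta>) *v (AtA *v (\<mu> (\<mu>0 + w) \<theta> - (\<mu>0 + w))))" for w
  obtain C where C: "C \<ge> 0" "\<And>u. norm (AtA *v u) \<le> C * norm u" using matrix_vector_norm_bound[of AtA] by blast
  have [measurable]: "(\<lambda>w. J (\<mu>0 + w) \<theta>) \<in> borel_measurable borel"
    by (rule measurable_compose[OF _ J_borel_data]) measurable
  have [measurable]: "(\<lambda>w. \<mu> (\<mu>0 + w) \<theta>) \<in> borel_measurable borel" by (rule mu_borel_data[OF \<theta>])
  have ih: "integrable noise h"
  proof (rule gauss_integrable_quadratic[OF sigma_pos,
        where a = "2 * (CJ * (C * (L1 * norm \<mu>0 + norm \<mu>0)))" and b = "2 * (CJ * (C * (L1 + 1)))" and c = 0])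
    have "(\<lambda>w. transpose (J (\<mu>0 + w) \<theta>) *v (AtA *v (\<mu> (\<mu>0 + w) \<theta> - (\<mu>0 + w)))) \<in> borel_measurable borel"
      by (rule borel_measurable_transpose_matrix_vector) measurable
    then show "h \<in> borel_measurable borel" unfolding h_def[abs_def] by measurable
    show "AE w in noise. norm (h w) \<le> 2 * (CJ * (C * (L1 * norm \<mu>0 + norm \<mu>0)))
        + 2 * (CJ * (C * (L1 + 1))) * norm w + 0 * (norm w)\<^sup>2"
      using AE_gauss_noise_translate[OF good, where \<sigma> = \<sigma> and c = \<mu>0]
    proof eventually_elim
      case (elim w)
      have "norm (\<mu> (\<mu>0 + w) \<theta> - (\<mu>0 + w)) \<le> (L1 * norm \<mu>0 + norm \<mu>0) + (L1 + 1) * norm w"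
        using mu_bound[OF \<theta>, of w] norm_triangle_ineq4[of "\<mu> (\<mu>0 + w) \<theta>" "\<mu>0 + w"]
          norm_triangle_ineq[of \<mu>0 w] by (simp add: distrib_right)
      from order_trans[OF C(2) mult_left_mono[OF this C(1)]]
      have "norm (AtA *v (\<mu> (\<mu>0 + w) \<theta> - (\<mu>0 + w))) \<le> C * ((L1 * norm \<mu>0 + norm \<mu>0) + (L1 + 1) * norm w)" .
      from order_trans[OF J_bounded_norm[OF elim] mult_left_mono[OF this CJ_nonneg]]
      have "norm (h w) \<le> 2 * (CJ * (C * ((L1 * norm \<mu>0 + norm \<mu>0) + (L1 + 1) * norm w)))"
        unfolding h_def norm_scaleR by simp
      then show ?case by (simp add: distrib_left distrib_right mult.assoc)
    qed
  qed
  note lim = grad_df_FD_limit[OF good]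
  have EWS: "EW \<sigma> \<mu>0 (\<lambda>y. SUGAR_FD \<sigma> A \<mu> J y \<theta> \<epsilon>) =
      (\<integral>w. h w \<partial>noise) + (2 * \<sigma>\<^sup>2) *\<^sub>R EW \<sigma> \<mu>0 (\<lambda>y. grad_df_FD A J y \<theta> \<epsilon>)" for \<epsilon>
  proof -
    have "EW \<sigma> \<mu>0 (\<lambda>y. SUGAR_FD \<sigma> A \<mu> J y \<theta> \<epsilon>) =
        (\<integral>w. h w + (2 * \<sigma>\<^sup>2) *\<^sub>R grad_df_FD A J (\<mu>0 + w) \<theta> \<epsilon> \<partial>noise)"
      unfolding EW_def SUGAR_FD_def h_def ..
    also have "\<dots> = (\<integral>w. h w \<partial>noise) + (\<integral>w. (2 * \<sigma>\<^sup>2) *\<^sub>R grad_df_FD A J (\<mu>0 + w) \<theta> \<epsilon> \<partial>noise)"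
      by (rule Bochner_Integration.integral_add[OF ih integrable_scaleR_right]) (rule lim(2))
    finally show ?thesis unfolding EW_def integral_scaleR_right .
  qed
  have "h w + (2 * \<sigma>\<^sup>2) *\<^sub>R dof_gradient w \<theta> = risk_gradient w \<theta>" for w
  proof -
    have s: "(2 * \<sigma>\<^sup>2) *\<^sub>R dof_gradient w \<theta> = 2 *\<^sub>R (transpose (J (\<mu>0 + w) \<theta>) *v (AtA *v w))"
      unfolding dof_gradient_def matrix_vector_mult_scaleR scaleR_scaleR using sigma_pos by simp
    \<comment> \<open>The noise contributed by the finite-difference limit turns the observable
      residual, taken against the data, into the residual against the unknown mean.\<close>
    have "\<mu> (\<mu>0 + w) \<theta> - (\<mu>0 + w) + w = \<mu> (\<mu>0 + w) \<theta> - \<mu>0" by simp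
    then show ?thesis
      unfolding s h_def risk_gradient_def scaleR_right_distrib[symmetric] matrix_vector_right_distrib[symmetric]
      by (simp only:)
  qed
  then have "(\<integral>w. h w \<partial>noise) + (2 * \<sigma>\<^sup>2) *\<^sub>R (\<integral>w. dof_gradient w \<theta> \<partial>noise) = (\<integral>w. risk_gradient w \<theta> \<partial>noise)"
    by (subst integral_scaleR_right[symmetric],
        subst Bochner_Integration.integral_add[OF ih integrable_scaleR_right[OF lim(3)], symmetric]) simp
  moreover have "((\<lambda>\<epsilon>. (\<integral>w. h w \<partial>noise) + (2 * \<sigma>\<^sup>2) *\<^sub>R EW \<sigma> \<mu>0 (\<lambda>y. grad_df_FD A J y \<theta> \<epsilon>))
      \<longlongrightarrow> (\<integral>w. h w \<partial>noise) + (2 * \<sigma>\<^sup>2) *\<^sub>R (\<integral>w. dof_gradient w \<theta> \<partial>noise)) (at_right 0)"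
    by (intro tendsto_add tendsto_scaleR tendsto_const lim(1))
  ultimately show ?thesis unfolding EWS by simp
qed

end

text \<open>The witnesses are the expectations of \<open>risk_gradient\<close> and
  \<open>dof_gradient\<close>. A weak gradient is determined up to null sets, so convergence almost
  everywhere to these representatives is convergence almost everywhere to any other. The limits are
  one-sided because \<epsilon> is positive.\<close>

theorem theorem1:
  fixes \<Theta> :: "(real^'d) set" and \<sigma> :: real and A :: "real^'p^'m" and \<mu>0 :: "real^'p"
    and \<mu> :: "real^'p \<Rightarrow> real^'d \<Rightarrow> real^'p"
    and J :: "real^'p \<Rightarrow> real^'d \<Rightarrow> real^'d^'p"
  assumes "open \<Theta>" and "\<sigma> > 0"
    and A1: "\<exists>L1. \<forall>\<theta>\<in>\<Theta>. L1-lipschitz_on UNIV (\<lambda>y. \<mu> y \<theta>)"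
    and A2: "\<forall>\<theta>\<in>\<Theta>. \<mu> 0 \<theta> = 0"
    and A3: "\<exists>L2. \<forall>y. L2-lipschitz_on \<Theta> (\<lambda>\<theta>. \<mu> y \<theta>)"
    and J_weak: "\<forall>y. weak_jacobian_on \<Theta> (\<lambda>\<theta>. \<mu> y \<theta>) (\<lambda>\<theta>. J y \<theta>)"
    and J_meas: "(\<lambda>z. J (fst z) (snd z)) \<in> borel_measurable borel"
  shows "\<exists>gR gdf. weak_gradient_on \<Theta> (\<lambda>\<theta>. risk \<sigma> A \<mu> \<mu>0 \<theta>) gR
           \<and> weak_gradient_on \<Theta> (\<lambda>\<theta>. dof \<sigma> A \<mu> \<mu>0 \<theta>) gdf
           \<and> (AE \<theta> in lborel. \<theta> \<in> \<Theta> \<longrightarrow>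
                ((\<lambda>\<epsilon>. EW \<sigma> \<mu>0 (\<lambda>y. SUGAR_FD \<sigma> A \<mu> J y \<theta> \<epsilon>)) \<longlongrightarrow> gR \<theta>) (at_right 0)
              \<and> ((\<lambda>\<epsilon>. EW \<sigma> \<mu>0 (\<lambda>y. grad_df_FD A J y \<theta> \<epsilon>)) \<longlongrightarrow> gdf \<theta>) (at_right 0))"
proof -
  obtain L1 where L1: "\<forall>\<theta>\<in>\<Theta>. L1-lipschitz_on UNIV (\<lambda>y. \<mu> y \<theta>)" using A1 by blast
  obtain L2 where L2: "\<forall>y. L2-lipschitz_on \<Theta> (\<lambda>\<theta>. \<mu> y \<theta>)" using A3 by blast
  \<comment> \<open>The absolute value is again a Lipschitz constant, and it is nonnegative even
    when \<Theta> is empty.\<close>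
  interpret gaussian_risk \<Theta> \<sigma> A \<mu>0 \<mu> J "\<bar>L1\<bar>" L2
  proof
    show "\<bar>L1\<bar>-lipschitz_on UNIV (\<lambda>y. \<mu> y \<theta>)" if "\<theta> \<in> \<Theta>" for \<theta>
      by (rule lipschitz_on_le[OF bspec[OF L1 that] abs_ge_self])
    show "\<mu> 0 \<theta> = 0" if "\<theta> \<in> \<Theta>" for \<theta> using A2 that by (rule bspec)
    show "L2-lipschitz_on \<Theta> (\<lambda>\<theta>. \<mu> y \<theta>)" for y using L2 by (rule spec)
    show "weak_jacobian_on \<Theta> (\<lambda>\<theta>. \<mu> y \<theta>) (\<lambda>\<theta>. J y \<theta>)" for y using J_weak by (rule spec)
  qed (use assms(1,2) J_meas in simp_all)
  show ?thesis
  proof (intro exI conjI)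
    show "weak_gradient_on \<Theta> (\<lambda>\<theta>. risk \<sigma> A \<mu> \<mu>0 \<theta>) (\<lambda>\<theta>. \<integral>w. risk_gradient w \<theta> \<partial>noise)"
      unfolding risk_eq by (rule risk_weak_gradient)
    show "weak_gradient_on \<Theta> (\<lambda>\<theta>. dof \<sigma> A \<mu> \<mu>0 \<theta>) (\<lambda>\<theta>. \<integral>w. dof_gradient w \<theta> \<partial>noise)"
      by (rule weak_gradient_on_cong[OF dof_eq[symmetric] refl dof_weak_gradient])
    show "AE \<theta> in lborel. \<theta> \<in> \<Theta> \<longrightarrow>
        ((\<lambda>\<epsilon>. EW \<sigma> \<mu>0 (\<lambda>y. SUGAR_FD \<sigma> A \<mu> J y \<theta> \<epsilon>)) \<longlongrightarrow> (\<integral>w. risk_gradient w \<theta> \<partial>noise)) (at_right 0)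
      \<and> ((\<lambda>\<epsilon>. EW \<sigma> \<mu>0 (\<lambda>y. grad_df_FD A J y \<theta> \<epsilon>)) \<longlongrightarrow> (\<integral>w. dof_gradient w \<theta> \<partial>noise)) (at_right 0)"
      using J_bounded_data
    proof eventually_elim
      case (elim \<theta>)
      show ?case
        by (intro impI conjI SUGAR_FD_limit grad_df_FD_limit(1) mp[OF elim])
    qed
  qed
qed

end
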